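(* Let $\nu>0$, $C\in(0,\infty)$, $r\in(0,\infty)$ and $\beta\in(1/2,1)$. Let $G$ be a distribution function on $\mathbb{R}$ with $\lim_{\mu\to\infty}(1-G(\mu))\mu^{\nu}=\lim_{\mu\to\infty}G(-\mu)\mu^{\nu}=C$. Let $\sigma_n=\dfrac{r\sqrt{2\log n}}{n^{(1-\beta)/\nu}}$ and $G_n(\mu)=G(\mu/\sigma_n)$. Then the critical sparsity level $\beta^*$ corresponding to $\{G_n\}$ equals $\beta$. Moreover, under the alternatives $H_1^n$ with this sequence $\{G_n\}$ and sparsity parameter equal to this same $\beta$: 1. For every $\alpha\in(0,1)$, the asymptotic power of the level-$\alpha$ max test is $$\lim_{n\to\infty}\mathbb{P}_{H_1^n}(\text{reject }H_0^n)=1-e^{-2Cr^{\nu}+\log(1-\alpha)};$$ in particular, this limit tends to $1$ as $r\to\infty$. 2. For every $r\in(0,\infty)$, the modified higher criticism test is asymptotically powerless: for every $\alpha\in(0,1)$, the probability under $H_1^n$ that the level-$\alpha$ modified higher criticism test rejects tends to $\alpha$ as $n\to\infty$.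
   Context: Model. We observe $X_1,\dots,X_n$ where, given $\mu_1,\dots,\mu_n$, the $X_i$ are independent with $X_i\sim N(\mu_i,1)$. Under $H_0^n$, all $\mu_i=0$. Under $H_1^n$ with sparsity parameter $b\in[0,1]$, the $\mu_i$ are i.i.d. from $(1-\pi_n)\delta_0+\pi_n G_n$ with $\pi_n=n^{-b}$, where $\delta_0$ is the point mass at $0$. $G_n$ also denotes the cumulative distribution function. Critical sparsity level. $d_{TV}(H_0^n,H_1^n)$ is the total variation distance ($d_{TV}(Q_1,Q_2)=\sup_A|Q_1(A)-Q_2(A)|$) between the laws of $(X_1,\dots,X_n)$ under $H_0^n$ and $H_1^n$. For a fixed sequence $\{G_n\}$ let $\underline{\beta}^*=\sup\{b\ge 0:\lim_n d_{TV}(H_0^n,H_1^n)=1\}$ and $\bar\beta^*=\inf\{b\le 1:\lim_n d_{TV}(H_0^n,H_1^n)=0\}$, where $H_1^n$ has sparsity parameter $b$ (conventions: $\sup\emptyset=0$, $\inf\emptyset=1$, $b$ ranges over $[0,1]$). When these agree, the common value $\beta^*$ is the critical sparsity level corresponding to $\{G_n\}$. Here $\{G_n\}$ is held fixed (with the given $\beta$ in the definition of $\sigma_n$) while $b$ varies. Max test. The level-$\alpha$ max test rejects $H_0^n$ when $\max_i|X_i|>m(n,\alpha)$, where $m(n,\alpha)$ is the $1-\alpha$ quantile of $\max_i|X_i|$ under $H_0^n$. Modified higher criticism test. Let $p_i=\mathbb{P}(|Z|\ge|X_i|)$, computed for $Z\sim N(0,1)$ independent of the data (two-sided $p$-values),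 and let $\widehat{F_n}(t)=\frac1n\sum_{i=1}^n 1\{p_i\le t\}$. The modified higher criticism statistic is $$mHC_n=\sup_{1/n\le t\le 1/2}\frac{\sqrt n(\widehat{F_n}(t)-t)}{\sqrt{t(1-t)}},$$ and the level-$\alpha$ modified higher criticism test rejects when $mHC_n$ exceeds its $1-\alpha$ quantile under $H_0^n$. *)

theory Defs
  imports "HOL-Probability.Probability"
begin

section \<open>The sparse normal mixture model\<close>

definition distribution_function :: "(real \<Rightarrow> real) \<Rightarrow> bool" where
  "distribution_function F \<longleftrightarrow>
     mono F \<and> (\<forall>x. continuous (at_right x) F) \<and> (F \<longlongrightarrow> 0) at_bot \<and> (F \<longlongrightarrow> 1) at_top"

definition normal_law :: "real \<Rightarrow> real measure" where
  "normal_law m = density lborel (normal_density m 1)"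

text \<open>The law of independent observations \<open>X\<^sub>1, \<dots>, X\<^sub>n\<close> with \<open>X\<^sub>i \<sim> N(\<mu>\<^sub>i, 1)\<close>.\<close>

definition obs_law :: "nat \<Rightarrow> (nat \<Rightarrow> real) \<Rightarrow> (nat \<Rightarrow> real) measure" where
  "obs_law n \<mu> = (\<Pi>\<^sub>M i\<in>{1..n}. normal_law (\<mu> i))"

text \<open>The mixture \<open>(1 - p) \<delta>\<^sub>0 + p G\<close>, for \<open>p \<in> [0, 1]\<close> and a distribution function \<open>G\<close>.\<close>

definition sparse_prior :: "real \<Rightarrow> (real \<Rightarrow> real) \<Rightarrow> real measure" where
  "sparse_prior p G = measure_of UNIV (sets borel)
     (\<lambda>A. ennreal (1 - p) * emeasure (return borel 0) A +
          ennreal p * emeasure (interval_measure G) A)"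

definition H0 :: "nat \<Rightarrow> (nat \<Rightarrow> real) measure" where
  "H0 n = obs_law n (\<lambda>_. 0)"

definition H1 :: "(nat \<Rightarrow> real \<Rightarrow> real) \<Rightarrow> real \<Rightarrow> nat \<Rightarrow> (nat \<Rightarrow> real) measure" where
  "H1 Gs b n = (\<Pi>\<^sub>M i\<in>{1..n}. sparse_prior (real n powr (- b)) (Gs n)) \<bind> obs_law n"


section \<open>Critical sparsity level\<close>

definition tv_dist :: "'a measure \<Rightarrow> 'a measure \<Rightarrow> real" where
  "tv_dist P Q = (SUP A\<in>sets P. \<bar>measure P A - measure Q A\<bar>)"

text \<open>The cases for the empty set implement the conventions \<open>sup \<emptyset> = 0\<close> and \<open>inf \<emptyset> = 1\<close>
  for subsets of \<open>[0, 1]\<close>; on the reals the library leaves both values unspecified.\<close>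

definition lower_critical_level :: "(nat \<Rightarrow> real \<Rightarrow> real) \<Rightarrow> real" where
  "lower_critical_level Gs =
     (let S = {b \<in> {0..1}. (\<lambda>n. tv_dist (H0 n) (H1 Gs b n)) \<longlonglongrightarrow> 1}
      in if S = {} then 0 else Sup S)"

definition upper_critical_level :: "(nat \<Rightarrow> real \<Rightarrow> real) \<Rightarrow> real" where
  "upper_critical_level Gs =
     (let S = {b \<in> {0..1}. (\<lambda>n. tv_dist (H0 n) (H1 Gs b n)) \<longlonglongrightarrow> 0}
      in if S = {} then 1 else Inf S)"

definition is_critical_sparsity_level :: "(nat \<Rightarrow> real \<Rightarrow> real) \<Rightarrow> real \<Rightarrow> bool" where
  "is_critical_sparsity_level Gs b \<longleftrightarrow>
     lower_critical_level Gs = b \<and> upper_critical_level Gs = b"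


section \<open>Tests\<close>

definition quantile :: "'a measure \<Rightarrow> ('a \<Rightarrow> real) \<Rightarrow> real \<Rightarrow> real" where
  "quantile P T q = Inf {x. q \<le> measure P {\<omega> \<in> space P. T \<omega> \<le> x}}"

text \<open>The probability under \<open>Q\<close> that the level-\<open>\<alpha>\<close> test with null law \<open>P\<close> and test
  statistic \<open>T\<close> rejects.\<close>

definition rejection_prob :: "'a measure \<Rightarrow> 'a measure \<Rightarrow> ('a \<Rightarrow> real) \<Rightarrow> real \<Rightarrow> real" where
  "rejection_prob P Q T \<alpha> = measure Q {\<omega> \<in> space Q. T \<omega> > quantile P T (1 - \<alpha>)}"

definition max_stat :: "nat \<Rightarrow> (nat \<Rightarrow> real) \<Rightarrow> real" where
  "max_stat n x = Max ((\<lambda>i. \<bar>x i\<bar>) ` {1..n})"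

definition p_value :: "real \<Rightarrow> real" where
  "p_value x = measure (normal_law 0) {z. \<bar>z\<bar> \<ge> \<bar>x\<bar>}"

definition p_value_ecdf :: "nat \<Rightarrow> (nat \<Rightarrow> real) \<Rightarrow> real \<Rightarrow> real" where
  "p_value_ecdf n x t = (1 / real n) * (\<Sum>i=1..n. of_bool (p_value (x i) \<le> t))"

definition mHC_stat :: "nat \<Rightarrow> (nat \<Rightarrow> real) \<Rightarrow> real" where
  "mHC_stat n x =
     (SUP t\<in>{1 / real n..1 / 2}. sqrt (real n) * (p_value_ecdf n x t - t) / sqrt (t * (1 - t)))"

definition max_test_power :: "(nat \<Rightarrow> real \<Rightarrow> real) \<Rightarrow> real \<Rightarrow> real \<Rightarrow> nat \<Rightarrow> real" where
  "max_test_power Gs b \<alpha> n = rejection_prob (H0 n) (H1 Gs b n) (max_stat n) \<alpha>"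

definition mHC_test_power :: "(nat \<Rightarrow> real \<Rightarrow> real) \<Rightarrow> real \<Rightarrow> real \<Rightarrow> nat \<Rightarrow> real" where
  "mHC_test_power Gs b \<alpha> n = rejection_prob (H0 n) (H1 Gs b n) (mHC_stat n) \<alpha>"


section \<open>The scaled sequence\<close>

definition scale :: "real \<Rightarrow> real \<Rightarrow> real \<Rightarrow> nat \<Rightarrow> real" where
  "scale \<nu> \<beta> r n = r * sqrt (2 * ln (real n)) / real n powr ((1 - \<beta>) / \<nu>)"

text \<open>For \<open>n \<le> 1\<close> the scale is \<open>0\<close> and the value below is a junk constant function; only
  the behaviour as \<open>n \<rightarrow> \<infinity>\<close> is ever used.\<close>

definition scaled_seq :: "(real \<Rightarrow> real) \<Rightarrow> real \<Rightarrow> real \<Rightarrow> real \<Rightarrow> nat \<Rightarrow> real \<Rightarrow> real" where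
  "scaled_seq G \<nu> \<beta> r n x = G (x / scale \<nu> \<beta> r n)"


section \<open>Well-definedness of the model\<close>

lemma space_normal_law [simp]: "space (normal_law m) = UNIV"
  by (simp add: normal_law_def)

lemma sets_normal_law [simp, measurable_cong]: "sets (normal_law m) = sets borel"
  by (simp add: normal_law_def)

lemma prob_space_normal_law: "prob_space (normal_law m)"
  unfolding normal_law_def by (rule prob_space_normal_density) simp

lemma real_distribution_distribution_function:
  assumes "distribution_function F"
  shows "real_distribution (interval_measure F)" and "cdf (interval_measure F) = F"
proof -
  have "\<And>x y. x \<le> y \<Longrightarrow> F x \<le> F y" "\<And>a. continuous (at_right a) F"
      "(F \<longlongrightarrow> 0) at_bot" "(F \<longlongrightarrow> 1) at_top"
    using assms unfolding distribution_function_def by (auto dest: monoD)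
  then show "real_distribution (interval_measure F)" "cdf (interval_measure F) = F"
    by (auto intro!: real_distribution_interval_measure cdf_interval_measure)
qed

lemma space_sparse_prior [simp]: "space (sparse_prior p G) = UNIV"
  by (simp add: sparse_prior_def space_measure_of_conv)

lemma sets_sparse_prior [simp, measurable_cong]: "sets (sparse_prior p G) = sets borel"
  using sets.sigma_sets_eq[of "borel :: real measure"]
  by (simp add: sparse_prior_def sets_measure_of_conv)

lemma emeasure_sparse_prior:
  assumes "A \<in> sets borel"
  shows "emeasure (sparse_prior p G) A =
    ennreal (1 - p) * emeasure (return borel 0) A + ennreal p * emeasure (interval_measure G) A"
proof (rule emeasure_measure_of[OF sparse_prior_def])
  show "sets borel \<subseteq> Pow (UNIV :: real set)" by simp
  show "A \<in> sets (sparse_prior p G)" using assms by simp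
  show "positive (sets (sparse_prior p G)) (\<lambda>A. ennreal (1 - p) * emeasure (return borel 0) A +
      ennreal p * emeasure (interval_measure G) A)"
    by (simp add: positive_def)
  show "countably_additive (sets (sparse_prior p G)) (\<lambda>A. ennreal (1 - p) *
      emeasure (return borel 0) A + ennreal p * emeasure (interval_measure G) A)"
  proof (rule countably_additiveI)
    fix A :: "nat \<Rightarrow> real set"
    assume "range A \<subseteq> sets (sparse_prior p G)" and disj: "disjoint_family A"
    then have A: "range A \<subseteq> sets borel" by simp
    have *: "(\<Sum>i. emeasure M (A i)) = emeasure M (\<Union>i. A i)" if "sets M = sets borel" for M
      using that A disj by (intro suminf_emeasure) auto
    show "(\<Sum>i. ennreal (1 - p) * emeasure (return borel 0) (A i) +
        ennreal p * emeasure (interval_measure G) (A i)) =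
      ennreal (1 - p) * emeasure (return borel 0) (\<Union>i. A i) +
        ennreal p * emeasure (interval_measure G) (\<Union>i. A i)"
      by (subst suminf_add[symmetric]) (simp_all add: * ennreal_suminf_cmult)
  qed
qed

lemma prob_space_sparse_prior:
  assumes "p \<in> {0..1}" and "distribution_function G"
  shows "prob_space (sparse_prior p G)"
proof
  interpret real_distribution "interval_measure G"
    using assms(2) by (rule real_distribution_distribution_function)
  have "emeasure (interval_measure G) UNIV = 1"
    using emeasure_space_1 by simp
  then show "emeasure (sparse_prior p G) (space (sparse_prior p G)) = 1"
    using assms(1) by (simp add: emeasure_sparse_prior flip: ennreal_plus)
qed

lemma sets_obs_law [simp, measurable_cong]: "sets (obs_law n \<mu>) = sets (\<Pi>\<^sub>M i\<in>{1..n}. borel)"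
  unfolding obs_law_def by (intro sets_PiM_cong) auto

lemma prob_space_obs_law: "prob_space (obs_law n \<mu>)"
  unfolding obs_law_def by (intro prob_space_PiM prob_space_normal_law)

lemma measurable_obs_law [measurable]:
  "obs_law n \<in> (\<Pi>\<^sub>M i\<in>{1..n}. borel) \<rightarrow>\<^sub>M prob_algebra (\<Pi>\<^sub>M i\<in>{1..n}. borel)"
proof (rule measurable_prob_algebra_generated[OF sets_PiM Int_stable_prod_algebra
      prod_algebra_sets_into_space])
  fix \<mu> :: "nat \<Rightarrow> real"
  show "prob_space (obs_law n \<mu>)" by (rule prob_space_obs_law)
  show "sets (obs_law n \<mu>) = sets (\<Pi>\<^sub>M i\<in>{1..n}. borel)" by simp
next
  fix A :: "(nat \<Rightarrow> real) set" assume "A \<in> prod_algebra {1..n} (\<lambda>_. borel)"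
  then obtain X where A: "A = (\<Pi>\<^sub>E i\<in>{1..n}. X i)" and X: "\<And>i. i \<in> {1..n} \<Longrightarrow> X i \<in> sets borel"
    unfolding prod_algebra_eq_finite[OF finite_atLeastAtMost] by blast
  have "emeasure (obs_law n \<mu>) A = (\<Prod>i\<in>{1..n}. emeasure (normal_law (\<mu> i)) (X i))" for \<mu>
  proof -
    interpret product_prob_space "\<lambda>i. normal_law (\<mu> i)" "{1..n}"
      by (intro product_prob_spaceI prob_space_normal_law)
    show ?thesis
      unfolding obs_law_def A using X by (intro emeasure_PiM) auto
  qed
  moreover have "(\<lambda>m. emeasure (normal_law m) B) \<in> borel_measurable borel"
    if [measurable]: "B \<in> sets borel" for B
    unfolding normal_law_def normal_density_def by (simp add: emeasure_density)
  ultimately show "(\<lambda>\<mu>. emeasure (obs_law n \<mu>) A) \<in> borel_measurable (\<Pi>\<^sub>M i\<in>{1..n}. borel)"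
    using X by (auto intro!: borel_measurable_prod_ennreal measurable_compose[OF measurable_component_singleton])
qed

end

theory Submission
  imports Defs "HOL-Real_Asymp.Real_Asymp"
begin

text \<open>
  Under \<open>H\<^sub>1\<close> the observations are i.i.d. from the mixture \<open>(1 - \<pi>) N(0, 1) + \<pi> (G\<^sub>n * N(0, 1))\<close>, and about
  \<open>2 C (r / x)\<^sup>\<nu> n powr (\<beta> - b)\<close> effects exceed \<open>x sqrt (2 ln n)\<close>. Effects that are a small fraction of the null
  maximum, which is near \<open>sqrt (2 ln n)\<close>, are lifted beyond it by the noise with probability \<open>o(n powr (\<beta> - 1))\<close>
  only, and the larger ones, which number \<open>O(n powr (\<beta> - b))\<close>, are not moved by the noise on that scale. This gives
  the power of the max test at \<open>b = \<beta>\<close>, and total variation distance tending to \<open>1\<close> for \<open>b < \<beta>\<close>.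

  Trim each observation, replacing values beyond a threshold \<open>\<tau>\<close> by a constant. The trimmed likelihood ratio
  has a chi-square distance to the null of order at most \<open>n powr (- 1 - c) + 1 / (n\<^sup>2 p(\<tau>))\<close> when \<open>b \<ge> \<beta>\<close>, which is \<open>o(1 / n)\<close> as soon
  as the expected number \<open>n p(\<tau>)\<close> of trimmed null observations tends to infinity. For \<open>b > \<beta>\<close> it may even
  tend to \<open>0\<close> slowly, and trimming then changes nothing with high probability.

  Modified higher criticism restricted to \<open>t \<ge> p(\<tau>)\<close> only depends on the trimmed observations, and by
  Chebyshev's inequality the range \<open>t < p(\<tau>)\<close> stays below the critical value. The critical value tends to
  infinity because the null law is close to the average of many nearly uncorrelated tilts, each of which pushes
  the empirical distribution function of the \<open>p\<close>-values up at one point \<open>t\<close> by many standard deviations.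
\<close>

section \<open>Product measures\<close>

text \<open>At \<open>b = \<beta>\<close> the two laws do not merge: a bounded number of huge
  effects remains visible, and they are all that the max test reacts to. The full likelihood ratio
  cannot show that nothing else is visible, since the polynomial tails of \<open>G\<close> make its
  second moment infinite, through the mean of \<open>exp (m * m')\<close> over two independent
  effects. Trimming hides these observations and leaves a ratio with an envelope that does not
  depend on the effect. The scale is forced by the balance at \<open>b = \<beta>\<close>: the
  effects beyond a multiple of \<open>sqrt (2 ln n)\<close> have mass of order
  \<open>n powr (\<beta> - 1)\<close>, hence of order \<open>1 / n\<close> after multiplication by
  the sparsity. Higher criticism overlooks a bounded number of extremes because for
  \<open>t \<ge> 1 / n\<close> the count of small \<open>p\<close>-values has a standard deviation
  bounded away from zero. They shift the statistic by a bounded amount, while its critical value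
  diverges, at whatever rate. As the statistic has a distribution with atoms, the null rejection
  probability is \<open>\<alpha>\<close> only up to the atom at the critical value, which has to be
  shown negligible.\<close>

lemma (in prob_space) expectation_abs_le_sqrt:
  fixes f :: "'a \<Rightarrow> real"
  assumes f: "f \<in> borel_measurable M" and f2: "integrable M (\<lambda>x. (f x)\<^sup>2)"
  shows "expectation (\<lambda>x. \<bar>f x\<bar>) \<le> sqrt (expectation (\<lambda>x. (f x)\<^sup>2))"
proof -
  have i: "integrable M f" using square_integrable_imp_integrable[OF f f2] by simp
  have "(expectation (\<lambda>x. \<bar>f x\<bar>))\<^sup>2 \<le> expectation (\<lambda>x. \<bar>f x\<bar>\<^sup>2)"
    using variance_eq[of "\<lambda>x. \<bar>f x\<bar>"] variance_positive[of "\<lambda>x. \<bar>f x\<bar>"] i f2 by simp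
  then show ?thesis by (intro real_le_rsqrt) simp
qed

text \<open>The difference is the integral of \<open>(Z - 1) * indicator A\<close>, which the L1
  norm and then the L2 norm of \<open>Z - 1\<close> control. It serves twice: for the product of
  trimmed densities and for the average of tilts.\<close>

lemma (in prob_space) tilted_prob_diff_le:
  fixes Z :: "'a \<Rightarrow> real"
  assumes Z: "Z \<in> borel_measurable M" and Z2: "integrable M (\<lambda>x. (Z x - 1)\<^sup>2)" and A: "A \<in> events"
  shows "\<bar>(\<integral>x. Z x * indicator A x \<partial>M) - prob A\<bar> \<le> sqrt (expectation (\<lambda>x. (Z x - 1)\<^sup>2))"
proof -
  have i: "integrable M (\<lambda>x. Z x - 1)"
    using square_integrable_imp_integrable[OF _ Z2] Z by simp
  then have iZ: "integrable M Z" using Bochner_Integration.integrable_add[OF i, of "\<lambda>_. 1"] by simp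
  have "(\<integral>x. Z x * indicator A x \<partial>M) - prob A = (\<integral>x. Z x * indicator A x \<partial>M) - (\<integral>x. indicator A x \<partial>M)"
    using A by simp
  also have "\<dots> = (\<integral>x. Z x * indicator A x - indicator A x \<partial>M)"
    using A iZ by (intro Bochner_Integration.integral_diff[symmetric] integrable_real_mult_indicator integrable_real_indicator) (auto simp: less_top[symmetric])
  also have "\<dots> = (\<integral>x. (Z x - 1) * indicator A x \<partial>M)" by (simp add: algebra_simps)
  finally have "\<bar>(\<integral>x. Z x * indicator A x \<partial>M) - prob A\<bar> \<le> (\<integral>x. \<bar>(Z x - 1) * indicator A x\<bar> \<partial>M)"
    using integral_abs_bound by metis
  also have "\<dots> \<le> (\<integral>x. \<bar>Z x - 1\<bar> \<partial>M)"
    using A i by (intro integral_mono integrable_abs integrable_real_mult_indicator) (auto split: split_indicator)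
  also have "\<dots> \<le> sqrt (expectation (\<lambda>x. (Z x - 1)\<^sup>2))"
    using Z by (intro expectation_abs_le_sqrt Z2) simp
  finally show ?thesis .
qed

lemma PiM_density:
  fixes l :: "'a \<Rightarrow> real"
  assumes "finite I" "prob_space M" and l[measurable]: "l \<in> borel_measurable M" and nn: "\<And>x. 0 \<le> l x"
    and one: "(\<integral>\<^sup>+x. ennreal (l x) \<partial>M) = 1"
  shows "(\<Pi>\<^sub>M i\<in>I. density M (\<lambda>x. ennreal (l x))) =
    density (\<Pi>\<^sub>M i\<in>I. M) (\<lambda>x. ennreal (\<Prod>i\<in>I. l (x i)))"
proof -
  let ?P = "\<Pi>\<^sub>M i\<in>I. M"
  interpret M: prob_space M by fact
  interpret P: product_prob_space "\<lambda>_. M" I by (intro product_prob_spaceI M.prob_space_axioms)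
  interpret D: prob_space "density M (\<lambda>x. ennreal (l x))"
    by (rule prob_spaceI) (simp add: emeasure_density one cong: nn_integral_cong)
  interpret PD: product_prob_space "\<lambda>_. density M (\<lambda>x. ennreal (l x))" I
    by (intro product_prob_spaceI D.prob_space_axioms)
  show ?thesis
  proof (rule PD.PiM_eqI[symmetric, OF \<open>finite I\<close>])
    show "sets (density ?P (\<lambda>x. ennreal (\<Prod>i\<in>I. l (x i)))) = sets (\<Pi>\<^sub>M i\<in>I. density M (\<lambda>x. ennreal (l x)))"
      by (auto intro!: sets_PiM_cong)
  next
    fix A assume "\<And>i. i \<in> I \<Longrightarrow> A i \<in> sets (density M (\<lambda>x. ennreal (l x)))"
    then have A: "\<And>i. i \<in> I \<Longrightarrow> A i \<in> sets M" by simp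
    have [measurable]: "(\<lambda>x. ennreal (\<Prod>i\<in>I. l (x i))) \<in> borel_measurable (Pi\<^sub>M I (\<lambda>i. M))"
      by measurable
    have "emeasure (density ?P (\<lambda>x. ennreal (\<Prod>i\<in>I. l (x i)))) (Pi\<^sub>E I A)
      = (\<integral>\<^sup>+x. ennreal (\<Prod>i\<in>I. l (x i)) * indicator (Pi\<^sub>E I A) x \<partial>?P)"
      using A \<open>finite I\<close> by (subst emeasure_density) (auto intro!: sets_PiM_I_finite)
    also have "\<dots> = (\<integral>\<^sup>+x. (\<Prod>i\<in>I. ennreal (l (x i)) * indicator (A i) (x i)) \<partial>?P)"
    proof (rule nn_integral_cong)
      fix x assume "x \<in> space ?P"
      then have "indicator (Pi\<^sub>E I A) x = (\<Prod>i\<in>I. indicator (A i) (x i) :: ennreal)"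
        using \<open>finite I\<close> by (auto simp: space_PiM PiE_iff prod.If_cases indicator_def prod_zero_iff split: if_splits)
      then show "ennreal (\<Prod>i\<in>I. l (x i)) * indicator (Pi\<^sub>E I A) x = (\<Prod>i\<in>I. ennreal (l (x i)) * indicator (A i) (x i))"
        by (simp add: prod.distrib prod_ennreal nn)
    qed
    also have "\<dots> = (\<Prod>i\<in>I. (\<integral>\<^sup>+x. ennreal (l x) * indicator (A i) x \<partial>M))"
      using A \<open>finite I\<close> by (intro P.product_nn_integral_prod) auto
    also have "\<dots> = (\<Prod>i\<in>I. emeasure (density M (\<lambda>x. ennreal (l x))) (A i))"
      using A by (intro prod.cong refl) (simp add: emeasure_density)
    finally show "emeasure (density ?P (\<lambda>x. ennreal (\<Prod>i\<in>I. l (x i)))) (Pi\<^sub>E I A) =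
      (\<Prod>i\<in>I. emeasure (density M (\<lambda>x. ennreal (l x))) (A i))" .
  qed
qed

lemma measure_PiM_density:
  fixes l :: "'a \<Rightarrow> real"
  assumes "finite I" "prob_space M" and l[measurable]: "l \<in> borel_measurable M" and nn: "\<And>x. 0 \<le> l x"
    and one: "(\<integral>\<^sup>+x. ennreal (l x) \<partial>M) = 1" and A[measurable]: "A \<in> sets (\<Pi>\<^sub>M i\<in>I. M)"
  shows "measure (\<Pi>\<^sub>M i\<in>I. density M (\<lambda>x. ennreal (l x))) A = (\<integral>x. (\<Prod>i\<in>I. l (x i)) * indicator A x \<partial>(\<Pi>\<^sub>M i\<in>I. M))"
proof -
  let ?P = "\<Pi>\<^sub>M i\<in>I. M"
  have [measurable]: "(\<lambda>x. (\<Prod>i\<in>I. l (x i))) \<in> borel_measurable (Pi\<^sub>M I (\<lambda>i. M))"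
      by measurable
  have "measure (density ?P (\<lambda>x. ennreal (\<Prod>i\<in>I. l (x i)))) A
     = (\<integral>x. indicator A x \<partial>density ?P (\<lambda>x. ennreal (\<Prod>i\<in>I. l (x i))))"
    by simp
  also have "\<dots> = (\<integral>x. (\<Prod>i\<in>I. l (x i)) * indicator A x \<partial>?P)"
    by (subst integral_density) (auto intro!: prod_nonneg nn)
  finally show ?thesis by (simp only: PiM_density[OF assms(1-5)])
qed

lemma PiM_integral_prod_const:
  fixes f :: "'a \<Rightarrow> real"
  assumes "finite I" "prob_space M" and "integrable M f"
  shows "integrable (\<Pi>\<^sub>M i\<in>I. M) (\<lambda>x. \<Prod>i\<in>I. f (x i))" (is ?c1)
    "(\<integral>x. (\<Prod>i\<in>I. f (x i)) \<partial>(\<Pi>\<^sub>M i\<in>I. M)) = (\<integral>x. f x \<partial>M) ^ card I" (is ?c2)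
proof -
  interpret M: prob_space M by fact
  interpret P: product_prob_space "\<lambda>_. M" I by (intro product_prob_spaceI M.prob_space_axioms)
  show ?c1
    using assms by (intro P.product_integrable_prod) auto
  show ?c2
    using assms by (subst P.product_integral_prod) auto
qed

text \<open>Product measures are compared through the second moment of the likelihood ratio, which tensorizes.\<close>

lemma PiM_density_prob_diff_le:
  fixes l :: "'a \<Rightarrow> real" and c :: real
  assumes "finite I" "prob_space M" and l[measurable]: "l \<in> borel_measurable M" and nn: "\<And>x. 0 \<le> l x"
    and one: "(\<integral>\<^sup>+x. ennreal (l x) \<partial>M) = 1" and l2: "integrable M (\<lambda>x. (l x - 1)\<^sup>2)"
    and le: "(\<integral>x. (l x - 1)\<^sup>2 \<partial>M) \<le> c" and A: "A \<in> sets (\<Pi>\<^sub>M i\<in>I. M)"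
  shows "\<bar>measure (\<Pi>\<^sub>M i\<in>I. density M (\<lambda>x. ennreal (l x))) A - measure (\<Pi>\<^sub>M i\<in>I. M) A\<bar>
    \<le> sqrt (exp (real (card I) * c) - 1)"
proof -
  let ?P = "\<Pi>\<^sub>M i\<in>I. M"
  interpret M: prob_space M by fact
  interpret P: product_prob_space "\<lambda>_. M" I by (intro product_prob_spaceI M.prob_space_axioms)
  let ?Z = "\<lambda>x. \<Prod>i\<in>I. l (x i)"
  have i1: "integrable M (\<lambda>x. l x - 1)"
    using M.square_integrable_imp_integrable[OF _ l2] l by simp
  then have il: "integrable M l" using Bochner_Integration.integrable_add[OF i1, of "\<lambda>_. 1"] by simp
  have El: "(\<integral>x. l x \<partial>M) = 1"
    using one nn by (subst integral_eq_nn_integral) auto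
  have sq: "(l x)\<^sup>2 = (l x - 1)\<^sup>2 + 2 * l x - 1" for x by (simp add: power2_eq_square algebra_simps)
  have il2: "integrable M (\<lambda>x. (l x)\<^sup>2)" unfolding sq using l2 il by auto
  have El2: "(\<integral>x. (l x)\<^sup>2 \<partial>M) = 1 + (\<integral>x. (l x - 1)\<^sup>2 \<partial>M)"
    unfolding sq using l2 il El by (simp add: M.prob_space)
  note Z1 = PiM_integral_prod_const[OF assms(1,2) il]
  note Z2 = PiM_integral_prod_const[OF assms(1,2) il2]
  have sqZ: "(?Z x - 1)\<^sup>2 = (\<Prod>i\<in>I. (l (x i))\<^sup>2) - 2 * ?Z x + 1" for x
    by (simp add: power2_eq_square algebra_simps prod.distrib)
  have iZ: "integrable ?P (\<lambda>x. (?Z x - 1)\<^sup>2)" unfolding sqZ using Z1 Z2 by auto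
  have "(\<integral>x. (?Z x - 1)\<^sup>2 \<partial>?P) = (1 + (\<integral>x. (l x - 1)\<^sup>2 \<partial>M)) ^ card I - 1"
    unfolding sqZ using Z1 Z2 by (simp add: El El2 P.P.prob_space)
  \<comment> \<open>With \<open>1 + c \<le> exp c\<close> the bound depends on
    \<open>card I * c\<close> only, the quantity that is later shown to vanish.\<close>
  also have "\<dots> \<le> exp c ^ card I - 1"
  proof -
    have "1 + (\<integral>x. (l x - 1)\<^sup>2 \<partial>M) \<le> exp c"
      using le exp_ge_add_one_self[of c] by linarith
    then show ?thesis by (intro diff_mono power_mono) auto
  qed
  also have "\<dots> = exp (real (card I) * c) - 1" by (simp add: exp_of_nat_mult)
  finally have "sqrt (\<integral>x. (?Z x - 1)\<^sup>2 \<partial>?P) \<le> sqrt (exp (real (card I) * c) - 1)" by simp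
  moreover have "\<bar>(\<integral>x. ?Z x * indicator A x \<partial>?P) - measure ?P A\<bar>
    \<le> sqrt (\<integral>x. (?Z x - 1)\<^sup>2 \<partial>?P)"
    by (rule P.P.tilted_prob_diff_le[OF _ iZ A]) measurable
  ultimately show ?thesis
    using measure_PiM_density[OF assms(1-5) A] by linarith
qed

lemma PiM_variance_sum:
  fixes f :: "'a \<Rightarrow> real"
  assumes "finite I" "prob_space M" and f[measurable]: "f \<in> borel_measurable M"
    and f2: "integrable M (\<lambda>x. (f x)\<^sup>2)" and z: "(\<integral>x. f x \<partial>M) = 0"
  shows "integrable (\<Pi>\<^sub>M i\<in>I. M) (\<lambda>x. (\<Sum>i\<in>I. f (x i))\<^sup>2)"
    "(\<integral>x. (\<Sum>i\<in>I. f (x i))\<^sup>2 \<partial>(\<Pi>\<^sub>M i\<in>I. M)) = card I * (\<integral>x. (f x)\<^sup>2 \<partial>M)"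
proof -
  let ?P = "\<Pi>\<^sub>M i\<in>I. M"
  interpret M: prob_space M by fact
  interpret P: product_prob_space "\<lambda>_. M" I by (intro product_prob_spaceI M.prob_space_axioms)
  have i1: "integrable M f" using M.square_integrable_imp_integrable[OF f f2] .
  \<comment> \<open>\<open>g i j k\<close> is the factor of coordinate \<open>k\<close> in
    \<open>f (x i) * f (x j)\<close>. For \<open>i = j\<close> both conditions hold at once and give
    the square, so one product formula covers diagonal and mixed terms.\<close>
  define g where "g i j k = (\<lambda>x. (if k = i then f x else 1) * (if k = j then f x else 1))" for i j k :: 'b
  have ig: "integrable M (g i j k)" for i j k
    unfolding g_def using i1 f2 by (cases "k = i"; cases "k = j") (auto simp: power2_eq_square)
  have pg: "(\<Prod>k\<in>I. g i j k (x k)) = f (x i) * f (x j)" if "i \<in> I" "j \<in> I" for i j x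
    using that \<open>finite I\<close> by (simp add: g_def prod.distrib prod.delta)
  have iij: "integrable ?P (\<lambda>x. f (x i) * f (x j))" if "i \<in> I" "j \<in> I" for i j
  proof -
    have "integrable ?P (\<lambda>x. \<Prod>k\<in>I. g i j k (x k))"
      by (rule P.product_integrable_prod[OF \<open>finite I\<close> ig])
    then show ?thesis using pg[OF that] by simp
  qed
  have eij: "(\<integral>x. f (x i) * f (x j) \<partial>?P) = (if i = j then (\<integral>x. (f x)\<^sup>2 \<partial>M) else 0)"
    if "i \<in> I" "j \<in> I" for i j
  proof -
    have "(\<integral>x. f (x i) * f (x j) \<partial>?P) = (\<Prod>k\<in>I. \<integral>x. g i j k x \<partial>M)"
    proof -
      have "(\<integral>x. (\<Prod>k\<in>I. g i j k (x k)) \<partial>?P) = (\<Prod>k\<in>I. \<integral>x. g i j k x \<partial>M)"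
        by (rule P.product_integral_prod[OF \<open>finite I\<close> ig])
      then show ?thesis using pg[OF that] by simp
    qed
    also have "\<dots> = (if i = j then (\<integral>x. (f x)\<^sup>2 \<partial>M) else 0)"
    proof (cases "i = j")
      case True
      then have "(\<integral>x. g i j k x \<partial>M) = (if k = i then (\<integral>x. (f x)\<^sup>2 \<partial>M) else 1)" for k
        by (auto simp: g_def power2_eq_square M.prob_space)
      then show ?thesis using True that \<open>finite I\<close> by (simp add: prod.delta)
    next
      case False
      then have "(\<integral>x. g i j i x \<partial>M) = 0" using z by (simp add: g_def)
      then show ?thesis using False that \<open>finite I\<close> by (auto intro!: prod_zero)
    qed
    finally show ?thesis .
  qed
  have sq: "(\<Sum>i\<in>I. f (x i))\<^sup>2 = (\<Sum>i\<in>I. \<Sum>j\<in>I. f (x i) * f (x j))" for x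
    by (simp add: power2_eq_square sum_product)
  show "integrable ?P (\<lambda>x. (\<Sum>i\<in>I. f (x i))\<^sup>2)"
    unfolding sq by (intro Bochner_Integration.integrable_sum iij)
  show "(\<integral>x. (\<Sum>i\<in>I. f (x i))\<^sup>2 \<partial>?P) = card I * (\<integral>x. (f x)\<^sup>2 \<partial>M)"
    unfolding sq using iij
    by (simp add: eij Bochner_Integration.integral_sum' integrable_sum sum.delta' \<open>finite I\<close> cong: sum.cong)
qed

lemma distr_PiM_map:
  assumes "finite I" "prob_space M" and c[measurable]: "c \<in> M \<rightarrow>\<^sub>M N"
  shows "distr (\<Pi>\<^sub>M i\<in>I. M) (\<Pi>\<^sub>M i\<in>I. N) (\<lambda>x. \<lambda>i\<in>I. c (x i)) = (\<Pi>\<^sub>M i\<in>I. distr M N c)"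
proof -
  interpret M: prob_space M by fact
  show ?thesis
    using distr_PiM_finite_prob_space'[OF \<open>finite I\<close>, of "\<lambda>_. M" "\<lambda>_. distr M N c" c]
    by (simp add: compose_def M.prob_space_axioms M.prob_space_distr[OF c] cong: distr_cong sets_PiM_cong)
qed

lemma sqrt_exp_minus_one_tendsto_0:
  fixes f :: "'a \<Rightarrow> real"
  assumes "(f \<longlongrightarrow> 0) F"
  shows "((\<lambda>x. sqrt (exp (f x) - 1)) \<longlongrightarrow> 0) F"
  using tendsto_real_sqrt[OF tendsto_diff[OF tendsto_exp[OF assms] tendsto_const[of 1]]] by simp

text \<open>Comparison with \<open>(1 - l / n) ^ n\<close>: for \<open>a\<close> and
  \<open>b\<close> of modulus at most one, \<open>a ^ n\<close> and \<open>b ^ n\<close> differ by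
  at most \<open>n\<close> times the distance of \<open>a\<close> and \<open>b\<close>.\<close>

lemma tendsto_one_minus_power:
  fixes u :: "nat \<Rightarrow> real"
  assumes u: "(\<lambda>n. real n * u n) \<longlonglongrightarrow> l" and nn: "eventually (\<lambda>n. 0 \<le> u n) sequentially"
  shows "(\<lambda>n. (1 - u n) ^ n) \<longlonglongrightarrow> exp (- l)"
proof -
  have l: "0 \<le> l"
    using nn by (intro tendsto_lowerbound[OF u]) (auto elim: eventually_mono)
  have "(\<lambda>n. real n * u n * (1 / real n)) \<longlonglongrightarrow> l * 0" by (intro tendsto_mult u lim_1_over_n)
  then have u0: "eventually (\<lambda>n. real n * u n * (1 / real n) < 1) sequentially"
    by (rule order_tendstoD) simp
  have "(\<lambda>n. l / real n) \<longlonglongrightarrow> 0" by (rule lim_const_over_n)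
  then have l0: "eventually (\<lambda>n. l / real n < 1) sequentially" by (rule order_tendstoD) simp
  have "(\<lambda>n. (1 - u n) ^ n - (1 + (- l) / real n) ^ n) \<longlonglongrightarrow> 0"
  proof (rule Lim_null_comparison)
    show "eventually (\<lambda>n. norm ((1 - u n) ^ n - (1 + (- l) / real n) ^ n) \<le> \<bar>real n * u n - l\<bar>) sequentially"
      using u0 l0 nn eventually_gt_at_top[of 0]
    proof eventually_elim
      case (elim n)
      have 1: "norm (1 - u n) \<le> 1" using elim by simp
      have 2: "norm (1 + (- l) / real n) \<le> 1" using elim l by simp
      have "real n * norm ((1 - u n) - (1 + (- l) / real n)) = \<bar>real n * u n - l\<bar>"
      proof -
        have "real n * norm ((1 - u n) - (1 + (- l) / real n)) = \<bar>real n * ((1 - u n) - (1 + (- l) / real n))\<bar>"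
          by (simp only: abs_mult real_norm_def abs_of_nat)
        also have "real n * ((1 - u n) - (1 + (- l) / real n)) = l - real n * u n"
          using elim by (simp add: right_diff_distrib)
        finally show ?thesis by (simp add: abs_minus_commute)
      qed
      then show ?case using norm_power_diff[OF 1 2, of n] by simp
    qed
    show "(\<lambda>n. \<bar>real n * u n - l\<bar>) \<longlonglongrightarrow> 0"
      using tendsto_rabs[OF tendsto_diff[OF u tendsto_const[of l]]] by simp
  qed
  from tendsto_add[OF this tendsto_exp_limit_sequentially[of "- l"]] show ?thesis by simp
qed

section \<open>Two-sided \<open>p\<close>-values and the mixture marginal\<close>

lemma real_distribution_normal_law: "real_distribution (normal_law m)"
  using prob_space_normal_law[of m] by (auto simp: real_distribution_def real_distribution_axioms_def)

interpretation normal: real_distribution "normal_law m" for m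
  by (rule real_distribution_normal_law)

abbreviation N01 :: "real measure" where "N01 \<equiv> normal_law 0"

lemma measure_normal_law:
  assumes "A \<in> sets borel"
  shows "integrable lborel (\<lambda>x. normal_density m 1 x * indicator A x)" (is ?c1)
    "measure (normal_law m) A = (\<integral>x. normal_density m 1 x * indicator A x \<partial>lborel)" (is ?c2)
proof -
  show ?c1
    using assms by (intro integrable_real_mult_indicator) auto
  have "measure (normal_law m) A = (\<integral>x. indicator A x \<partial>normal_law m)"
    using assms by simp
  also have "\<dots> = (\<integral>x. normal_density m 1 x * indicator A x \<partial>lborel)"
    unfolding normal_law_def using assms by (subst integral_density) auto
  finally show ?c2 .
qed

lemma measure_normal_law_singleton [simp]: "measure (normal_law m) {x} = 0"
proof -
  have "emeasure (normal_law m) {x} = (\<integral>\<^sup>+y. ennreal (normal_density m 1 y) * indicator {x} y \<partial>lborel)"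
    unfolding normal_law_def by (subst emeasure_density) auto
  also have "\<dots> = (\<integral>\<^sup>+(y::real). 0 \<partial>lborel)"
  proof (rule nn_integral_cong_AE)
    show "AE y in lborel. ennreal (normal_density m 1 y) * indicator {x} y = 0"
      using AE_lborel_singleton[of x] by eventually_elim simp
  qed
  finally show ?thesis by (simp add: measure_def)
qed

lemma normal_law_translate: "normal_law m = distr N01 borel (\<lambda>z. m + z)"
proof -
  have "distributed N01 lborel (\<lambda>x. x) (normal_density 0 1)"
    by (simp add: distributed_def distr_id2 normal_law_def)
  from normal.normal_density_affine[OF this, of 1 m]
  have "normal_law m = distr N01 lborel (\<lambda>z. m + z)"
    by (simp add: distributed_def normal_law_def)
  also have "\<dots> = distr N01 borel (\<lambda>z. m + z)" by (rule distr_cong) auto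
  finally show ?thesis .
qed

lemma measure_normal_law_translate:
  assumes "A \<in> sets borel"
  shows "measure (normal_law m) A = measure N01 {z. m + z \<in> A}"
  by (subst normal_law_translate, subst measure_distr) (auto simp: assms vimage_def)

lemma p_value_abs [simp]: "p_value \<bar>x\<bar> = p_value x"
  by (simp add: p_value_def)

text \<open>This form transfers the continuity of the normal distribution function to
  \<open>p_value\<close>. A difference of distribution functions belongs to a half-open interval;
  the extra endpoint is a null set.\<close>

lemma p_value_cdf: "p_value x = 1 - (cdf N01 \<bar>x\<bar> - cdf N01 (- \<bar>x\<bar>))"
proof (cases "x = 0")
  case True
  show ?thesis using True normal.prob_space by (simp add: p_value_def)
next
  case False
  have "p_value x = measure N01 (UNIV - ({- \<bar>x\<bar><..\<bar>x\<bar>} - {\<bar>x\<bar>}))"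
    unfolding p_value_def by (rule arg_cong[where f="measure _"]) auto
  also have "\<dots> = 1 - measure N01 ({- \<bar>x\<bar><..\<bar>x\<bar>} - {\<bar>x\<bar>})"
    using normal.prob_compl[of "{- \<bar>x\<bar><..\<bar>x\<bar>} - {\<bar>x\<bar>}"] by simp
  also have "measure N01 ({- \<bar>x\<bar><..\<bar>x\<bar>} - {\<bar>x\<bar>}) = measure N01 {- \<bar>x\<bar><..\<bar>x\<bar>}"
    using False by (subst normal.finite_measure_Diff) auto
  also have "\<dots> = cdf N01 \<bar>x\<bar> - cdf N01 (- \<bar>x\<bar>)"
    using False by (intro normal.cdf_diff_eq[symmetric]) auto
  finally show ?thesis .
qed

lemma isCont_p_value: "isCont p_value x"
proof -
  have c: "isCont (cdf N01) y" for y by (simp add: normal.isCont_cdf)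
  have "isCont (\<lambda>x. 1 - (cdf N01 \<bar>x\<bar> - cdf N01 (- \<bar>x\<bar>))) x"
    by (intro continuous_intros isCont_o2[OF _ c])
  then show ?thesis by (simp add: p_value_cdf[abs_def])
qed

lemma measurable_p_value [measurable]: "p_value \<in> borel_measurable borel"
  using isCont_p_value by (intro borel_measurable_continuous_onI continuous_at_imp_continuous_on) auto

lemma p_value_le_1: "p_value x \<le> 1" and p_value_nonneg: "0 \<le> p_value x" and p_value_0 [simp]: "p_value 0 = 1"
proof -
  show "p_value x \<le> 1" "0 \<le> p_value x" by (auto simp: p_value_def)
  show "p_value 0 = 1" using normal.prob_space by (simp add: p_value_def)
qed

lemma measure_normal_law_interval_ge:
  assumes "0 \<le> x" "x \<le> y"
  shows "(y - x) * normal_density 0 1 y \<le> measure N01 {x..<y}"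
proof -
  have "(y - x) * normal_density 0 1 y = (\<integral>z. normal_density 0 1 y * indicator {x..<y} z \<partial>lborel)"
    using assms by simp
  also have "\<dots> \<le> (\<integral>z. normal_density 0 1 z * indicator {x..<y} z \<partial>lborel)"
  proof (rule integral_mono)
    show "integrable lborel (\<lambda>z. normal_density 0 1 y * indicator {x..<y} z)"
      using assms by simp
    show "integrable lborel (\<lambda>z. normal_density 0 1 z * indicator {x..<y} z)"
      by (rule measure_normal_law) simp
    show "normal_density 0 1 y * indicator {x..<y} z \<le> normal_density 0 1 z * indicator {x..<y} z" for z
      using assms by (auto simp: normal_density_def divide_right_mono power_mono split: split_indicator)
  qed
  also have "\<dots> = measure N01 {x..<y}"
    by (rule measure_normal_law(2)[symmetric]) simp
  finally show ?thesis .
qed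

text \<open>The interval between \<open>x\<close> and \<open>y\<close> is lost from the tail and
  carries at least its length times the smallest density. This gives strict monotonicity, and for
  \<open>y = x + 1\<close> the lower Gaussian tail bound.\<close>

lemma p_value_diff_ge:
  assumes "0 \<le> x" "x \<le> y"
  shows "p_value y + (y - x) * normal_density 0 1 y \<le> p_value x"
proof -
  have "p_value y + measure N01 {x..<y} = measure N01 ({z. \<bar>y\<bar> \<le> \<bar>z\<bar>} \<union> {x..<y})"
    unfolding p_value_def using assms by (intro normal.finite_measure_Union[symmetric]) auto
  also have "\<dots> \<le> p_value x"
    unfolding p_value_def using assms by (intro normal.finite_measure_mono) auto
  finally show ?thesis using measure_normal_law_interval_ge[OF assms] by linarith
qed

lemma p_value_strict_mono:
  assumes "\<bar>x\<bar> < \<bar>y\<bar>"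
  shows "p_value y < p_value x"
proof -
  have "0 < (\<bar>y\<bar> - \<bar>x\<bar>) * normal_density 0 1 \<bar>y\<bar>"
    using assms normal_density_pos[of 1 0 "\<bar>y\<bar>"] by simp
  moreover have "p_value \<bar>y\<bar> + (\<bar>y\<bar> - \<bar>x\<bar>) * normal_density 0 1 \<bar>y\<bar> \<le> p_value \<bar>x\<bar>"
    using assms by (intro p_value_diff_ge) auto
  ultimately show ?thesis by simp
qed

lemma p_value_le_iff: "p_value x \<le> p_value y \<longleftrightarrow> \<bar>y\<bar> \<le> \<bar>x\<bar>"
proof
  assume "p_value x \<le> p_value y"
  then show "\<bar>y\<bar> \<le> \<bar>x\<bar>" using p_value_strict_mono[of x y] by linarith
next
  assume le: "\<bar>y\<bar> \<le> \<bar>x\<bar>"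
  show "p_value x \<le> p_value y"
  proof (cases "\<bar>y\<bar> = \<bar>x\<bar>")
    case True
    then have "p_value x = p_value y" using p_value_abs by metis
    then show ?thesis by simp
  next
    case False
    then show ?thesis using le p_value_strict_mono[of y x] by simp
  qed
qed

lemma p_value_eq_iff: "p_value x = p_value y \<longleftrightarrow> \<bar>x\<bar> = \<bar>y\<bar>"
  using p_value_le_iff[of x y] p_value_le_iff[of y x] by auto

lemma p_value_ge_density: "0 \<le> x \<Longrightarrow> normal_density 0 1 (x + 1) \<le> p_value x"
  using p_value_diff_ge[of x "x + 1"] p_value_nonneg[of "x + 1"] by simp

lemma p_value_pos: "0 < p_value x"
  using p_value_ge_density[of "\<bar>x\<bar>"] normal_density_pos[of 1 0 "\<bar>x\<bar> + 1"] by simp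

text \<open>For \<open>z\<close> beyond \<open>x\<close>, completing the square bounds the standard
  density by \<open>exp (- x\<^sup>2 / 2)\<close> times the normal density centred at whichever of
  \<open>\<bar>x\<bar>\<close>, \<open>- \<bar>x\<bar>\<close> has the sign of \<open>z\<close>. The
  two shifted densities have total mass 2.\<close>

lemma p_value_le_exp: "p_value x \<le> 2 * exp (- x\<^sup>2 / 2)"
proof -
  let ?t = "\<bar>x\<bar>"
  have "p_value x = (\<integral>z. normal_density 0 1 z * indicator {z. \<bar>x\<bar> \<le> \<bar>z\<bar>} z \<partial>lborel)"
    unfolding p_value_def by (rule measure_normal_law) simp
  also have "\<dots> \<le> (\<integral>z. exp (- x\<^sup>2 / 2) * (normal_density ?t 1 z + normal_density (- ?t) 1 z) \<partial>lborel)"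
  proof (rule integral_mono)
    show "integrable lborel (\<lambda>z. normal_density 0 1 z * indicator {z. \<bar>x\<bar> \<le> \<bar>z\<bar>} z)"
      by (rule measure_normal_law) simp
    show "integrable lborel (\<lambda>z. exp (- x\<^sup>2 / 2) * (normal_density ?t 1 z + normal_density (- ?t) 1 z))"
      by simp
    fix z :: real
    have *: "normal_density 0 1 z \<le> exp (- x\<^sup>2 / 2) * normal_density m 1 z"
      if "m\<^sup>2 = x\<^sup>2" "m\<^sup>2 \<le> m * z" for m
    proof -
      have "exp (- z\<^sup>2 / 2) \<le> exp (- x\<^sup>2 / 2) * exp (- (z - m)\<^sup>2 / 2)"
        using that by (simp add: exp_add[symmetric] power2_eq_square algebra_simps)
      then show ?thesis by (simp add: normal_density_def divide_right_mono)
    qed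
    show "normal_density 0 1 z * indicator {z. \<bar>x\<bar> \<le> \<bar>z\<bar>} z
      \<le> exp (- x\<^sup>2 / 2) * (normal_density ?t 1 z + normal_density (- ?t) 1 z)"
    proof (cases "?t \<le> \<bar>z\<bar>")
      case True
      then have "?t\<^sup>2 \<le> ?t * z \<or> (- ?t)\<^sup>2 \<le> (- ?t) * z"
        using mult_left_mono[of ?t z ?t] mult_left_mono[of ?t "- z" ?t]
        by (cases "0 \<le> z") (auto simp: power2_eq_square)
      then show ?thesis using True *[of ?t] *[of "- ?t"]
        by (auto simp: distrib_left intro: add_increasing add_increasing2)
    qed simp
  qed
  also have "\<dots> = 2 * exp (- x\<^sup>2 / 2)" by simp
  finally show ?thesis .
qed

lemma p_value_tendsto_0: "(p_value \<longlongrightarrow> 0) at_top"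
proof (rule tendsto_sandwich[OF _ _ tendsto_const])
  show "((\<lambda>x. 2 * exp (- x\<^sup>2 / 2)) \<longlongrightarrow> (0::real)) at_top"
    by real_asymp
qed (intro always_eventually allI p_value_nonneg p_value_le_exp)+

lemma p_value_surj:
  assumes "0 < t" "t \<le> 1"
  obtains x where "0 \<le> x" "p_value x = t"
proof -
  have "eventually (\<lambda>x. p_value x < t) at_top"
    using p_value_tendsto_0 assms by (intro order_tendstoD) auto
  then obtain N where N: "\<And>x. N \<le> x \<Longrightarrow> p_value x < t"
    by (auto simp: eventually_at_top_linorder)
  define b where "b = max 0 N"
  have b: "0 \<le> b" "p_value b < t" using N[of b] by (auto simp: b_def)
  have "\<exists>x\<ge>0. x \<le> b \<and> p_value x = t"
    using assms b isCont_p_value IVT2[of p_value b t 0] by simp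
  then show ?thesis using that by blast
qed

text \<open>Every threshold sequence below is specified through its null exceedance probability and
  obtained from here.\<close>

lemma p_value_threshold:
  assumes "\<And>n. 0 < f n" "\<And>n. f n \<le> 1"
  obtains t where "\<And>n. 0 \<le> t n" "\<And>n. p_value (t n) = f n"
proof -
  have "\<forall>n. \<exists>x. 0 \<le> x \<and> p_value x = f n" using p_value_surj[OF assms] by metis
  then show ?thesis using that by metis
qed

lemma measure_normal_law_abs:
  assumes "0 \<le> x"
  shows "measure N01 {z. x < \<bar>z\<bar>} = p_value x" "measure N01 {z. x \<le> \<bar>z\<bar>} = p_value x"
    "measure N01 {z. \<bar>z\<bar> < x} = 1 - p_value x" (is ?c1) "measure N01 {z. \<bar>z\<bar> \<le> x} = 1 - p_value x"
proof -
  show *: "measure N01 {z. x \<le> \<bar>z\<bar>} = p_value x" using assms by (simp add: p_value_def)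
  have "measure N01 {x, - x} = 0"
    using normal.measure_zero_union[of "{x}" 0 "{- x}"] by (simp add: insert_commute)
  moreover have "{z. x < \<bar>z\<bar>} = {z. x \<le> \<bar>z\<bar>} - {x, - x}" using assms by auto
  moreover have "measure N01 ({z. x \<le> \<bar>z\<bar>} - {x, - x}) =
     measure N01 {z. x \<le> \<bar>z\<bar>} - measure N01 {x, - x}"
    using assms by (intro normal.finite_measure_Diff) auto
  ultimately show **: "measure N01 {z. x < \<bar>z\<bar>} = p_value x" using * by simp
  have "{z. \<bar>z\<bar> < x} = UNIV - {z. x \<le> \<bar>z\<bar>}" "{z. \<bar>z\<bar> \<le> x} = UNIV - {z. x < \<bar>z\<bar>}" by auto
  then show ?c1 "measure N01 {z. \<bar>z\<bar> \<le> x} = 1 - p_value x"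
    using normal.prob_compl[of "{z. x \<le> \<bar>z\<bar>}"] normal.prob_compl[of "{z. x < \<bar>z\<bar>}"] by (simp_all add: * **)
qed

lemma measure_p_value_le:
  assumes "0 < t" "t \<le> 1"
  shows "measure N01 {x. p_value x \<le> t} = t"
proof -
  obtain y where y: "0 \<le> y" "p_value y = t" using p_value_surj[OF assms] .
  then have "{x. p_value x \<le> t} = {x. y \<le> \<bar>x\<bar>}"
    using p_value_le_iff[of _ y] by auto
  then show ?thesis using measure_normal_law_abs(2)[OF y(1)] y(2) by simp
qed

section \<open>The marginal law of a single observation\<close>

definition mixture_law :: "real \<Rightarrow> (real \<Rightarrow> real) \<Rightarrow> real measure" where
  "mixture_law p F = sparse_prior p F \<bind> normal_law"

lemma emeasure_normal_law_measurable [measurable]: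
  assumes [measurable]: "B \<in> sets borel"
  shows "(\<lambda>m. emeasure (normal_law m) B) \<in> borel_measurable borel"
  unfolding normal_law_def normal_density_def by (simp add: emeasure_density)

lemma measure_normal_law_measurable [measurable]:
  assumes [measurable]: "B \<in> sets borel"
  shows "(\<lambda>m. measure (normal_law m) B) \<in> borel_measurable borel"
  unfolding measure_def by measurable

lemma normal_law_measurable [measurable]: "normal_law \<in> borel \<rightarrow>\<^sub>M prob_algebra borel"
proof (rule measurable_prob_algebra_generated[of borel UNIV "sets borel"])
  show "sets (borel :: real measure) = sigma_sets UNIV (sets borel)"
    using sets.sigma_sets_eq[of "borel :: real measure"] unfolding space_borel by (simp only:)
qed (auto simp: Int_stable_def prob_space_normal_law)

text \<open>\<open>sparse_prior\<close> is given by its values on sets, so the formula is extended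
  from indicators by induction over nonnegative measurable functions.\<close>

lemma nn_integral_sparse_prior:
  assumes f: "f \<in> borel_measurable borel"
  shows "(\<integral>\<^sup>+x. f x \<partial>sparse_prior p F) = ennreal (1 - p) * f 0 + ennreal p * (\<integral>\<^sup>+x. f x \<partial>interval_measure F)"
  using f
proof (induction rule: borel_measurable_induct)
  case (cong f g)
  then show ?case by simp
next
  case (set A)
  then show ?case by (simp add: emeasure_sparse_prior)
next
  case (mult u c)
  then show ?case by (simp add: nn_integral_cmult algebra_simps)
next
  case (add u v)
  then show ?case by (simp add: nn_integral_add algebra_simps)
next
  case (seq U)
  have i: "(\<lambda>i. U i x) \<longlonglongrightarrow> (SUP i. U i x)" for x
    using seq(3) by (intro LIMSEQ_SUP) (auto simp: incseq_def le_fun_def)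
  have m: "incseq U" by fact
  have "(\<lambda>i. \<integral>\<^sup>+x. U i x \<partial>M) \<longlonglongrightarrow> (\<integral>\<^sup>+x. (SUP i. U i x) \<partial>M)" if "sets M = sets borel" for M :: "real measure"
  proof -
    have "(\<integral>\<^sup>+x. (SUP i. U i x) \<partial>M) = (SUP i. \<integral>\<^sup>+x. U i x \<partial>M)"
      using seq(1) that m by (intro nn_integral_monotone_convergence_SUP) (auto simp: measurable_cong_sets[OF that])
    then show ?thesis
      using m by (auto intro!: LIMSEQ_SUP incseq_SucI nn_integral_mono simp: incseq_def le_fun_def)
  qed
  note lim = this
  have "(\<lambda>i. \<integral>\<^sup>+x. U i x \<partial>sparse_prior p F) \<longlonglongrightarrow> (\<integral>\<^sup>+x. (SUP i. U i x) \<partial>sparse_prior p F)"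
    by (rule lim) simp
  moreover have "(\<lambda>i. \<integral>\<^sup>+x. U i x \<partial>sparse_prior p F) \<longlonglongrightarrow>
     ennreal (1 - p) * (SUP i. U i 0) + ennreal p * (\<integral>\<^sup>+x. (SUP i. U i x) \<partial>interval_measure F)"
    unfolding seq.IH by (intro tendsto_add ennreal_tendsto_cmult i lim) auto
  ultimately show ?case
    using LIMSEQ_unique by (auto simp: SUP_apply image_comp)
qed

lemma sets_mixture_law [simp, measurable_cong]: "sets (mixture_law p F) = sets borel"
proof -
  have "sets (normal_law x) = sets borel" for x by simp
  then show ?thesis
    unfolding mixture_law_def by (subst sets_bind) auto
qed

lemma space_mixture_law [simp]: "space (mixture_law p F) = UNIV"
  using sets_eq_imp_space_eq[OF sets_mixture_law] by simp

lemma normal_law_measurable_subprob: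
  "normal_law \<in> sparse_prior p F \<rightarrow>\<^sub>M subprob_algebra borel"
proof -
  have "normal_law \<in> borel \<rightarrow>\<^sub>M subprob_algebra borel"
    by (rule measurable_prob_algebraD) (rule normal_law_measurable)
  then show ?thesis by (simp cong: measurable_cong_sets)
qed

lemma emeasure_mixture_law_bind:
  assumes "A \<in> sets borel"
  shows "emeasure (mixture_law p F) A = (\<integral>\<^sup>+m. emeasure (normal_law m) A \<partial>sparse_prior p F)"
  unfolding mixture_law_def using assms normal_law_measurable_subprob
  by (intro emeasure_bind[where N=borel]) auto

lemma measure_mixture_law:
  assumes p: "p \<in> {0..1}" and F: "distribution_function F" and A[measurable]: "A \<in> sets borel"
  shows "measure (mixture_law p F) A =
    (1 - p) * measure N01 A + p * (\<integral>m. measure (normal_law m) A \<partial>interval_measure F)"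
proof -
  interpret real_distribution "interval_measure F"
    using F by (rule real_distribution_distribution_function)
  have i: "integrable (interval_measure F) (\<lambda>m. measure (normal_law m) A)"
    by (rule integrable_const_bound[where B=1]) auto
  have "emeasure (mixture_law p F) A = ennreal (1 - p) * ennreal (measure N01 A)
      + ennreal p * (\<integral>\<^sup>+m. ennreal (measure (normal_law m) A) \<partial>interval_measure F)"
    by (simp add: emeasure_mixture_law_bind A nn_integral_sparse_prior normal.emeasure_eq_measure
        flip: normal.emeasure_eq_measure)
  also have "(\<integral>\<^sup>+m. ennreal (measure (normal_law m) A) \<partial>interval_measure F)
    = ennreal (\<integral>m. measure (normal_law m) A \<partial>interval_measure F)"
    by (rule nn_integral_eq_integral[OF i]) simp
  finally show ?thesis
    using p by (simp add: measure_def ennreal_mult'[symmetric] ennreal_plus[symmetric] integral_nonneg_AE del: ennreal_plus)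
qed

lemma prob_space_mixture_law:
  assumes "p \<in> {0..1}" "distribution_function F"
  shows "prob_space (mixture_law p F)"
proof (rule prob_spaceI)
  interpret P: prob_space "sparse_prior p F" using assms by (rule prob_space_sparse_prior)
  have "emeasure (normal_law m) UNIV = 1" for m using normal.emeasure_space_1 by simp
  then show "emeasure (mixture_law p F) (space (mixture_law p F)) = 1"
    using P.emeasure_space_1 by (simp add: emeasure_mixture_law_bind)
qed

text \<open>Given the effects, the probability of a box is a product whose factors depend on
  different coordinates of \<open>\<mu>\<close>; since the effects are independent, integrating them
  out factorizes.\<close>

lemma H1_eq_PiM:
  assumes p: "real n powr (- b) \<in> {0..1}" and F: "distribution_function (Gs n)"
  shows "H1 Gs b n = (\<Pi>\<^sub>M i\<in>{1..n}. mixture_law (real n powr (- b)) (Gs n))"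
proof -
  let ?S = "sparse_prior (real n powr (- b)) (Gs n)" and ?M = "mixture_law (real n powr (- b)) (Gs n)"
  interpret S: prob_space ?S using assms by (rule prob_space_sparse_prior)
  interpret M: prob_space ?M using assms by (rule prob_space_mixture_law)
  interpret PS: product_prob_space "\<lambda>_. ?S" "{1..n}" by (intro product_prob_spaceI S.prob_space_axioms)
  interpret PM: product_prob_space "\<lambda>_. ?M" "{1..n}" by (intro product_prob_spaceI M.prob_space_axioms)
  have sP: "sets (\<Pi>\<^sub>M i\<in>{1..n}. ?S) = sets (\<Pi>\<^sub>M i\<in>{1..n}. borel)" by (intro sets_PiM_cong) auto
  have m: "obs_law n \<in> (\<Pi>\<^sub>M i\<in>{1..n}. ?S) \<rightarrow>\<^sub>M subprob_algebra (\<Pi>\<^sub>M i\<in>{1..n}. borel)"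
    using measurable_prob_algebraD[OF measurable_obs_law[of n]] by (simp add: sP cong: measurable_cong_sets)
  show ?thesis
    unfolding H1_def
  proof (rule PM.PiM_eqI)
    have "sets ((\<Pi>\<^sub>M i\<in>{1..n}. ?S) \<bind> obs_law n) = sets (\<Pi>\<^sub>M i\<in>{1..n}. borel)"
      by (rule sets_bind) (auto simp: PS.P.not_empty)
    also have "\<dots> = sets (\<Pi>\<^sub>M i\<in>{1..n}. ?M)" by (intro sets_PiM_cong) auto
    finally show "sets ((\<Pi>\<^sub>M i\<in>{1..n}. ?S) \<bind> obs_law n) = sets (\<Pi>\<^sub>M i\<in>{1..n}. ?M)" .
  next
    fix A assume "\<And>i. i \<in> {1..n} \<Longrightarrow> A i \<in> sets ?M"
    then have A: "\<And>i. i \<in> {1..n} \<Longrightarrow> A i \<in> sets borel" by simp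
    have "emeasure ((\<Pi>\<^sub>M i\<in>{1..n}. ?S) \<bind> obs_law n) (Pi\<^sub>E {1..n} A)
      = (\<integral>\<^sup>+\<mu>. emeasure (obs_law n \<mu>) (Pi\<^sub>E {1..n} A) \<partial>(\<Pi>\<^sub>M i\<in>{1..n}. ?S))"
      using A by (intro emeasure_bind[OF _ m]) (auto intro!: sets_PiM_I_finite simp: PS.P.not_empty)
    also have "\<dots> = (\<integral>\<^sup>+\<mu>. (\<Prod>i\<in>{1..n}. emeasure (normal_law (\<mu> i)) (A i)) \<partial>(\<Pi>\<^sub>M i\<in>{1..n}. ?S))"
    proof (rule nn_integral_cong)
      fix \<mu>
      interpret PN: product_prob_space "\<lambda>i. normal_law (\<mu> i)" "{1..n}"
        by (intro product_prob_spaceI prob_space_normal_law)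
      show "emeasure (obs_law n \<mu>) (Pi\<^sub>E {1..n} A) = (\<Prod>i\<in>{1..n}. emeasure (normal_law (\<mu> i)) (A i))"
        unfolding obs_law_def using A by (intro PN.emeasure_PiM) auto
    qed
    also have "\<dots> = (\<Prod>i\<in>{1..n}. \<integral>\<^sup>+m. emeasure (normal_law m) (A i) \<partial>?S)"
    proof (rule PS.product_nn_integral_prod)
      fix i assume "i \<in> {1..n}"
      from emeasure_normal_law_measurable[OF A[OF this]]
      show "(\<lambda>m. emeasure (normal_law m) (A i)) \<in> borel_measurable ?S"
        by (simp cong: measurable_cong_sets)
    qed simp
    also have "\<dots> = (\<Prod>i\<in>{1..n}. emeasure ?M (A i))"
      using A by (intro prod.cong refl) (simp add: emeasure_mixture_law_bind)
    finally show "emeasure ((\<Pi>\<^sub>M i\<in>{1..n}. ?S) \<bind> obs_law n) (Pi\<^sub>E {1..n} A) = (\<Prod>i\<in>{1..n}. emeasure ?M (A i))" .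
  qed simp
qed

lemma H0_eq_PiM: "H0 n = (\<Pi>\<^sub>M i\<in>{1..n}. N01)"
  by (simp add: H0_def obs_law_def)

lemma prob_space_H0: "prob_space (H0 n)"
  unfolding H0_def by (rule prob_space_obs_law)

lemma sets_H0: "sets (H0 n) = sets (\<Pi>\<^sub>M i\<in>{1..n}. borel)"
  by (simp add: H0_def)

lemma space_H0: "space (H0 n) = space (\<Pi>\<^sub>M i\<in>{1..n}. borel)"
  by (rule sets_eq_imp_space_eq[OF sets_H0])

section \<open>Trimming and the likelihood ratio\<close>

text \<open>For \<open>\<tau> \<ge> 0\<close> the value \<tau> + 1 lies outside the range that is
  kept, so a trimmed observation still records that the threshold was exceeded, but neither its size
  nor its sign.\<close>

definition trim :: "real \<Rightarrow> real \<Rightarrow> real" where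
  "trim \<tau> x = (if \<bar>x\<bar> \<le> \<tau> then x else \<tau> + 1)"

lemma trim_measurable [measurable]: "trim \<tau> \<in> borel_measurable borel"
  unfolding trim_def by measurable

text \<open>The likelihood ratio of \<open>trim \<tau> X\<close> between effect \<open>m\<close> and
  effect zero, equivalently the conditional expectation under the null of the full ratio given the
  trimmed observation.\<close>

definition trimmed_ratio :: "real \<Rightarrow> real \<Rightarrow> real \<Rightarrow> real" where
  "trimmed_ratio \<tau> m x =
    (if \<bar>x\<bar> \<le> \<tau> then exp (m * x - m\<^sup>2 / 2) else measure (normal_law m) {z. \<tau> < \<bar>z\<bar>} / p_value \<tau>)"

lemma trimmed_ratio_measurable [measurable]:
  "(\<lambda>(m, x). trimmed_ratio \<tau> m x) \<in> borel_measurable (borel \<Otimes>\<^sub>M borel)"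
  unfolding trimmed_ratio_def by measurable

lemma trimmed_ratio_measurable1 [measurable]: "trimmed_ratio \<tau> m \<in> borel_measurable borel"
  unfolding trimmed_ratio_def by measurable

lemma trimmed_ratio_nonneg: "0 \<le> trimmed_ratio \<tau> m x"
  using p_value_pos[of \<tau>] by (simp add: trimmed_ratio_def)

lemma normal_density_ratio: "normal_density m 1 x = exp (m * x - m\<^sup>2 / 2) * normal_density 0 1 x"
proof -
  have "exp (- (x - m)\<^sup>2 / 2) = exp (m * x - m\<^sup>2 / 2) * exp (- x\<^sup>2 / 2)"
    by (simp add: exp_add[symmetric] power2_eq_square algebra_simps diff_divide_distrib add_divide_distrib)
  then show ?thesis by (simp add: normal_density_def)
qed

lemma normal_law_density: "normal_law m = density N01 (\<lambda>x. ennreal (exp (m * x - m\<^sup>2 / 2)))"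
  unfolding normal_law_def
  by (subst density_density_eq)
     (auto intro!: density_cong simp: normal_density_ratio[of m] ennreal_mult'[symmetric] mult.commute)

lemma emeasure_trimmed_ratio:
  assumes \<tau>: "0 \<le> \<tau>" and X[measurable]: "X \<in> sets borel"
  shows "(\<integral>\<^sup>+x. ennreal (trimmed_ratio \<tau> m x) * indicator X (trim \<tau> x) \<partial>N01)
    = emeasure (normal_law m) (trim \<tau> -` X)"
proof -
  let ?T = "{x. \<bar>x\<bar> \<le> \<tau>}" and ?S = "{x. \<tau> < \<bar>x\<bar>}"
  let ?c = "ennreal (measure (normal_law m) ?S / p_value \<tau>) * indicator X (\<tau> + 1)"
  have sX: "{x \<in> X. \<bar>x\<bar> \<le> \<tau>} \<in> sets borel" by measurable
  have "(\<integral>\<^sup>+x. ennreal (trimmed_ratio \<tau> m x) * indicator X (trim \<tau> x) \<partial>N01)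
    = (\<integral>\<^sup>+x. (ennreal (exp (m * x - m\<^sup>2 / 2)) * indicator {x \<in> X. \<bar>x\<bar> \<le> \<tau>} x
      + ?c * indicator ?S x) \<partial>N01)"
    by (intro nn_integral_cong) (auto simp: trimmed_ratio_def trim_def split: split_indicator)
  also have "\<dots> = (\<integral>\<^sup>+x. ennreal (exp (m * x - m\<^sup>2 / 2)) * indicator {x \<in> X. \<bar>x\<bar> \<le> \<tau>} x \<partial>N01)
    + (\<integral>\<^sup>+x. ?c * indicator ?S x \<partial>N01)"
    using sX by (intro nn_integral_add) auto
  also have "(\<integral>\<^sup>+x. ennreal (exp (m * x - m\<^sup>2 / 2)) * indicator {x \<in> X. \<bar>x\<bar> \<le> \<tau>} x \<partial>N01)
    = emeasure (normal_law m) {x \<in> X. \<bar>x\<bar> \<le> \<tau>}"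
    unfolding normal_law_density[of m] using sX by (subst emeasure_density) auto
  also have "(\<integral>\<^sup>+x. ?c * indicator ?S x \<partial>N01)
    = ?c * emeasure N01 ?S"
    by (subst nn_integral_cmult) auto
  also have "\<dots> = ennreal (measure (normal_law m) ?S) * indicator X (\<tau> + 1)"
  proof -
    have "ennreal (measure (normal_law m) ?S / p_value \<tau>) * ennreal (p_value \<tau>) = ennreal (measure (normal_law m) ?S)"
      using p_value_pos[of \<tau>] by (subst ennreal_mult[symmetric]) auto
    then show ?thesis
      using \<tau> by (simp add: normal.emeasure_eq_measure measure_normal_law_abs split: split_indicator)
  qed
  also have "\<dots> = emeasure (normal_law m) (if \<tau> + 1 \<in> X then ?S else {})"
    by (simp add: normal.emeasure_eq_measure)
  also have "emeasure (normal_law m) {x \<in> X. \<bar>x\<bar> \<le> \<tau>} + emeasure (normal_law m) (if \<tau> + 1 \<in> X then ?S else {})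
    = emeasure (normal_law m) ({x \<in> X. \<bar>x\<bar> \<le> \<tau>} \<union> (if \<tau> + 1 \<in> X then ?S else {}))"
    using sX by (intro plus_emeasure) auto
  also have "{x \<in> X. \<bar>x\<bar> \<le> \<tau>} \<union> (if \<tau> + 1 \<in> X then ?S else {}) = trim \<tau> -` X"
    by (auto simp: trim_def split: if_splits)
  finally show ?thesis .
qed

lemma integral_exp_ratio_square:
  "integrable N01 (\<lambda>x. (exp (m * x - m\<^sup>2 / 2))\<^sup>2)" (is ?c1)
  "(\<integral>x. (exp (m * x - m\<^sup>2 / 2))\<^sup>2 \<partial>N01) = exp (m\<^sup>2)" (is ?c2)
proof -
  have eq: "normal_density 0 1 x * (exp (m * x - m\<^sup>2 / 2))\<^sup>2 = exp (m\<^sup>2) * normal_density (2 * m) 1 x" for x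
    unfolding normal_density_ratio[of "2 * m"]
    by (simp add: exp_add[symmetric] power2_eq_square algebra_simps exp_double[symmetric] del: exp_double)
  show ?c1
    unfolding normal_law_def by (subst integrable_density) (auto simp: eq)
  show ?c2
    unfolding normal_law_def by (subst integral_density) (auto simp: eq)
qed

text \<open>A conditional expectation does not increase second moments, and
  \<open>exp (m\<^sup>2)\<close> is the second moment of the full ratio.\<close>

lemma nn_integral_trimmed_ratio_square:
  assumes \<tau>: "0 \<le> \<tau>"
  shows "(\<integral>\<^sup>+x. ennreal ((trimmed_ratio \<tau> m x)\<^sup>2) \<partial>N01) \<le> ennreal (exp (m\<^sup>2))"
proof -
  let ?S = "{x. \<tau> < \<bar>x\<bar>}" and ?u = "\<lambda>x. exp (m * x - m\<^sup>2 / 2)"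
  define r where "r = measure (normal_law m) ?S / p_value \<tau>"
  have r: "0 \<le> r" "r * p_value \<tau> = measure (normal_law m) ?S"
    using p_value_pos[of \<tau>] by (auto simp: r_def)
  \<comment> \<open>On \<open>?S\<close> the bound \<open>r\<^sup>2 \<le> ?h\<close> is
    \<open>(u - r)\<^sup>2 \<ge> 0\<close> rewritten. The correction terms integrate to zero,
    because \<open>r\<close> is the mean of \<open>?u\<close> over \<open>?S\<close>.\<close>
  let ?h = "\<lambda>x. (?u x)\<^sup>2 - 2 * r * (?u x * indicator ?S x) + 2 * r\<^sup>2 * indicator ?S x"
  note u2 = integral_exp_ratio_square[of m]
  have iS: "integrable N01 (indicator ?S :: real \<Rightarrow> real)"
    by (intro integrable_real_indicator) (auto simp: normal.emeasure_eq_measure)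
  have iu: "integrable N01 ?u"
    by (rule normal.square_integrable_imp_integrable[OF _ u2(1)]) auto
  have iuS: "integrable N01 (\<lambda>x. ?u x * indicator ?S x)"
    by (rule integrable_real_mult_indicator[OF _ iu]) auto
  have EuS: "(\<integral>x. ?u x * indicator ?S x \<partial>N01) = measure (normal_law m) ?S"
  proof -
    have "measure (normal_law m) ?S = (\<integral>x. indicator ?S x \<partial>normal_law m)" by simp
    also have "\<dots> = (\<integral>x. ?u x * indicator ?S x \<partial>N01)"
      unfolding normal_law_density[of m] by (subst integral_density) auto
    finally show ?thesis by simp
  qed
  have ES: "(\<integral>x. indicator ?S x \<partial>N01) = p_value \<tau>"
    using measure_normal_law_abs(1)[OF \<tau>] by simp
  have le: "(trimmed_ratio \<tau> m x)\<^sup>2 \<le> ?h x" for x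
    using sum_squares_ge_zero[of "?u x - r" 0]
    by (auto simp: trimmed_ratio_def r_def[symmetric] power2_eq_square algebra_simps split: split_indicator)
  have "(\<integral>\<^sup>+x. ennreal ((trimmed_ratio \<tau> m x)\<^sup>2) \<partial>N01)
    \<le> (\<integral>\<^sup>+x. ennreal (?h x) \<partial>N01)"
    by (intro nn_integral_mono ennreal_leI le)
  also have "\<dots> = ennreal (\<integral>x. ?h x \<partial>N01)"
    using u2 iuS iS le
    by (intro nn_integral_eq_integral AE_I2 order_trans[OF zero_le_power2 le]) auto
  also have "(\<integral>x. ?h x \<partial>N01)
     = exp (m\<^sup>2) - 2 * r * (r * p_value \<tau>) + 2 * r\<^sup>2 * p_value \<tau>"
    using u2 iuS iS by (simp add: EuS ES r(2) del: Bochner_Integration.integral_indicator)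
  also have "\<dots> = exp (m\<^sup>2)" by (simp add: power2_eq_square)
  finally show ?thesis .
qed

text \<open>An upper bound for \<open>trimmed_ratio\<close> uniform in the effect:
  \<open>m * x - m\<^sup>2 / 2\<close> is largest at \<open>m = x\<close>, and in the tail the
  numerator is a probability.\<close>

definition ratio_envelope :: "real \<Rightarrow> real \<Rightarrow> real" where
  "ratio_envelope \<tau> x = (if \<bar>x\<bar> \<le> \<tau> then exp (x\<^sup>2 / 2) else 1 / p_value \<tau>)"

lemma ratio_envelope_measurable [measurable]: "ratio_envelope \<tau> \<in> borel_measurable borel"
  unfolding ratio_envelope_def by measurable

lemma trimmed_ratio_le_envelope: "trimmed_ratio \<tau> m x \<le> ratio_envelope \<tau> x"
proof -
  have "m * x - m\<^sup>2 / 2 \<le> x\<^sup>2 / 2"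
    using zero_le_power2[of "x - m"] by (simp add: power2_eq_square algebra_simps)
  then show ?thesis
    using p_value_pos[of \<tau>] normal.prob_le_1
    by (auto simp: trimmed_ratio_def ratio_envelope_def divide_right_mono)
qed

text \<open>Inside the threshold the integrand grows like \<open>exp (x\<^sup>2 / 2)\<close> and is
  dominated by \<open>exp (\<tau>\<^sup>2 / 2)\<close> times the normal densities centred at \<tau>
  and -\<tau>. Their total \<open>2 * exp (\<tau>\<^sup>2 / 2)\<close> is at most
  \<open>4 / p_value \<tau>\<close> by the Gaussian tail bound; the outside adds
  \<open>1 / p_value \<tau>\<close>.\<close>

lemma nn_integral_envelope_square:
  assumes \<tau>: "0 \<le> \<tau>"
  shows "(\<integral>\<^sup>+x. ennreal ((ratio_envelope \<tau> x)\<^sup>2) \<partial>N01) \<le> ennreal (5 / p_value \<tau>)"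
proof -
  let ?S = "{x. \<tau> < \<bar>x\<bar>}"
  let ?g = "\<lambda>x. exp (\<tau>\<^sup>2 / 2) * (normal_density \<tau> 1 x + normal_density (- \<tau>) 1 x)"
  let ?h = "\<lambda>x. ?g x + (1 / (p_value \<tau>)\<^sup>2) * (normal_density 0 1 x * indicator ?S x)"
  have p: "0 < p_value \<tau>" by (rule p_value_pos)
  have le: "normal_density 0 1 x * (ratio_envelope \<tau> x)\<^sup>2 \<le> ?h x" for x
  proof (cases "\<bar>x\<bar> \<le> \<tau>")
    case True
    have *: "exp (x\<^sup>2 / 2) \<le> exp (\<tau>\<^sup>2 / 2) * exp (- (x - m)\<^sup>2 / 2)" if "m\<^sup>2 = \<tau>\<^sup>2" "x\<^sup>2 \<le> x * m" for m
    proof -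
      have "x\<^sup>2 / 2 \<le> \<tau>\<^sup>2 / 2 + (- (x - m)\<^sup>2 / 2)"
        using that by (simp add: power2_diff field_simps)
      then show ?thesis by (simp add: exp_add[symmetric])
    qed
    have "x\<^sup>2 \<le> x * \<tau> \<or> x\<^sup>2 \<le> x * (- \<tau>)"
      using True mult_left_mono[of x \<tau> x] mult_left_mono[of "- x" \<tau> "- x"]
      by (cases "0 \<le> x") (auto simp: power2_eq_square)
    then have "exp (x\<^sup>2 / 2) \<le> exp (\<tau>\<^sup>2 / 2) * (exp (- (x - \<tau>)\<^sup>2 / 2) + exp (- (x - (- \<tau>))\<^sup>2 / 2))"
      using *[of \<tau>] *[of "- \<tau>"] by (auto simp: distrib_left intro: add_increasing add_increasing2)
    then have "(1 / sqrt (2 * pi)) * exp (x\<^sup>2 / 2)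
       \<le> (1 / sqrt (2 * pi)) * (exp (\<tau>\<^sup>2 / 2) * (exp (- (x - \<tau>)\<^sup>2 / 2) + exp (- (x - (- \<tau>))\<^sup>2 / 2)))"
      by (rule mult_left_mono) simp
    also have "\<dots> = ?g x" by (simp add: normal_density_def algebra_simps)
    also have "(1 / sqrt (2 * pi)) * exp (x\<^sup>2 / 2) = normal_density 0 1 x * (ratio_envelope \<tau> x)\<^sup>2"
    proof -
      have "exp (x\<^sup>2 / 2) = exp (- x\<^sup>2 / 2) * (exp (x\<^sup>2 / 2))\<^sup>2"
        by (simp add: power2_eq_square exp_add[symmetric])
      then show ?thesis using True by (simp add: normal_density_def ratio_envelope_def)
    qed
    finally show ?thesis using True by simp
  next
    case False
    then show ?thesis by (simp add: ratio_envelope_def power_divide)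
  qed
  have iS: "integrable lborel (\<lambda>x. normal_density 0 1 x * indicator ?S x)"
    by (rule measure_normal_law) simp
  have ES: "(\<integral>x. normal_density 0 1 x * indicator ?S x \<partial>lborel) = p_value \<tau>"
    using measure_normal_law(2)[of ?S 0] measure_normal_law_abs(1)[OF \<tau>] by simp
  have "(\<integral>\<^sup>+x. ennreal ((ratio_envelope \<tau> x)\<^sup>2) \<partial>N01)
    = (\<integral>\<^sup>+x. ennreal (normal_density 0 1 x * (ratio_envelope \<tau> x)\<^sup>2) \<partial>lborel)"
    unfolding normal_law_def by (subst nn_integral_density) (auto simp: ennreal_mult')
  also have "\<dots> \<le> (\<integral>\<^sup>+x. ennreal (?h x) \<partial>lborel)"
    by (intro nn_integral_mono ennreal_leI le)
  also have "\<dots> = ennreal (\<integral>x. ?h x \<partial>lborel)"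
    using iS by (intro nn_integral_eq_integral AE_I2) auto
  also have "(\<integral>x. ?h x \<partial>lborel)
    = exp (\<tau>\<^sup>2 / 2) * 2 + (1 / (p_value \<tau>)\<^sup>2) * p_value \<tau>"
    using iS by (subst Bochner_Integration.integral_add) (auto simp: ES)
  also have "ennreal (exp (\<tau>\<^sup>2 / 2) * 2 + (1 / (p_value \<tau>)\<^sup>2) * p_value \<tau>) \<le> ennreal (5 / p_value \<tau>)"
  proof (rule ennreal_leI)
    have "p_value \<tau> * exp (\<tau>\<^sup>2 / 2) \<le> 2 * exp (- \<tau>\<^sup>2 / 2) * exp (\<tau>\<^sup>2 / 2)"
      by (rule mult_right_mono[OF p_value_le_exp]) simp
    also have "\<dots> = 2" by (simp add: exp_add[symmetric])
    finally have "exp (\<tau>\<^sup>2 / 2) * 2 \<le> 4 / p_value \<tau>" using p by (simp add: field_simps)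
    moreover have "(1 / (p_value \<tau>)\<^sup>2) * p_value \<tau> = 1 / p_value \<tau>" using p by (simp add: power2_eq_square)
    moreover have "5 / p_value \<tau> = 4 / p_value \<tau> + 1 / p_value \<tau>" by (simp add: add_divide_distrib[symmetric])
    ultimately show "exp (\<tau>\<^sup>2 / 2) * 2 + (1 / (p_value \<tau>)\<^sup>2) * p_value \<tau> \<le> 5 / p_value \<tau>" by linarith
  qed
  finally show ?thesis .
qed

section \<open>Chi-square distance of the trimmed mixture to the trimmed null\<close>

definition trimmed_density :: "real \<Rightarrow> real \<Rightarrow> (real \<Rightarrow> real) \<Rightarrow> real \<Rightarrow> real" where
  "trimmed_density \<tau> p F x = (1 - p) + p * (\<integral>m. trimmed_ratio \<tau> m x \<partial>interval_measure F)"

context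
  fixes p :: real and F :: "real \<Rightarrow> real" and \<tau> :: real
  assumes p: "p \<in> {0..1}" and F: "distribution_function F" and \<tau>: "0 \<le> \<tau>"
begin

interpretation GM: real_distribution "interval_measure F"
  using F by (rule real_distribution_distribution_function)

interpretation pair_sigma_finite "interval_measure F" "N01" ..

lemma integrable_trimmed_ratio: "integrable (interval_measure F) (\<lambda>m. trimmed_ratio \<tau> m x)"
  using trimmed_ratio_le_envelope[of \<tau> _ x] trimmed_ratio_nonneg[of \<tau> _ x]
  by (intro GM.integrable_const_bound[where B="ratio_envelope \<tau> x"]) auto

lemma trimmed_density_measurable [measurable]: "trimmed_density \<tau> p F \<in> borel_measurable borel"
proof -
  have "(\<lambda>x. \<integral>m. trimmed_ratio \<tau> m x \<partial>interval_measure F) \<in> borel_measurable borel"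
    by (rule GM.borel_measurable_lebesgue_integral) measurable
  then show ?thesis unfolding trimmed_density_def[abs_def] by measurable
qed

lemma trimmed_density_nonneg: "0 \<le> trimmed_density \<tau> p F x"
  using p trimmed_ratio_nonneg by (auto simp: trimmed_density_def intro!: add_nonneg_nonneg integral_nonneg_AE)

lemma trimmed_density_ennreal:
  "ennreal (trimmed_density \<tau> p F x) =
    ennreal (1 - p) + ennreal p * (\<integral>\<^sup>+m. ennreal (trimmed_ratio \<tau> m x) \<partial>interval_measure F)"
  using p trimmed_ratio_nonneg[of \<tau> _ x]
  by (subst nn_integral_eq_integral[OF integrable_trimmed_ratio])
     (auto simp: trimmed_density_def ennreal_mult' integral_nonneg_AE)

lemma nn_integral_trimmed_density:
  assumes X[measurable]: "X \<in> sets borel"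
  shows "(\<integral>\<^sup>+x. ennreal (trimmed_density \<tau> p F x) * indicator X (trim \<tau> x) \<partial>N01)
    = emeasure (mixture_law p F) (trim \<tau> -` X)"
proof -
  let ?l = "trimmed_density \<tau> p F"
  have vX[measurable]: "trim \<tau> -` X \<in> sets borel"
    using measurable_sets[OF trim_measurable X, of \<tau>] by simp
  have ind: "indicator X (trim \<tau> x) = indicator (trim \<tau> -` X) x" for x :: real
    by (simp add: indicator_def)
  have "(\<integral>\<^sup>+x. ennreal (?l x) * indicator X (trim \<tau> x) \<partial>N01)
    = (\<integral>\<^sup>+x. ennreal (1 - p) * indicator (trim \<tau> -` X) x +
        ennreal p * (\<integral>\<^sup>+m. ennreal (trimmed_ratio \<tau> m x) * indicator X (trim \<tau> x) \<partial>interval_measure F) \<partial>N01)"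
    by (intro nn_integral_cong)
       (auto simp: trimmed_density_ennreal distrib_right ind nn_integral_multc mult.assoc)
  also have "\<dots> = ennreal (1 - p) * emeasure N01 (trim \<tau> -` X) +
     ennreal p * (\<integral>\<^sup>+x. \<integral>\<^sup>+m. ennreal (trimmed_ratio \<tau> m x) * indicator X (trim \<tau> x) \<partial>interval_measure F \<partial>N01)"
    by (subst nn_integral_add) (auto simp: nn_integral_cmult)
  also have "(\<integral>\<^sup>+x. \<integral>\<^sup>+m. ennreal (trimmed_ratio \<tau> m x) * indicator X (trim \<tau> x) \<partial>interval_measure F \<partial>N01)
    = (\<integral>\<^sup>+m. \<integral>\<^sup>+x. ennreal (trimmed_ratio \<tau> m x) * indicator X (trim \<tau> x) \<partial>N01 \<partial>interval_measure F)"
    by (rule Fubini') measurable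
  also have "\<dots> = (\<integral>\<^sup>+m. emeasure (normal_law m) (trim \<tau> -` X) \<partial>interval_measure F)"
    by (simp add: emeasure_trimmed_ratio[OF \<tau> X])
  also have "ennreal (1 - p) * emeasure N01 (trim \<tau> -` X) + ennreal p * \<dots>
    = emeasure (mixture_law p F) (trim \<tau> -` X)"
    by (simp add: emeasure_mixture_law_bind nn_integral_sparse_prior)
  finally show ?thesis .
qed

lemma nn_integral_trimmed_density_1: "(\<integral>\<^sup>+x. ennreal (trimmed_density \<tau> p F x) \<partial>N01) = 1"
proof -
  interpret M: prob_space "mixture_law p F" using p F by (rule prob_space_mixture_law)
  show ?thesis using nn_integral_trimmed_density[of UNIV] M.emeasure_space_1 by simp
qed

text \<open>The tilted null law on the left stands in for the mixture: it has a square integrable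
  density, and the two agree once observations are trimmed.\<close>

lemma distr_trimmed_density:
  "distr (density N01 (\<lambda>x. ennreal (trimmed_density \<tau> p F x))) borel (trim \<tau>) =
    distr (mixture_law p F) borel (trim \<tau>)"
proof (rule measure_eqI)
  let ?Q = "density N01 (\<lambda>x. ennreal (trimmed_density \<tau> p F x))"
  fix X assume "X \<in> sets (distr (?Q) borel (trim \<tau>))"
  then have X[measurable]: "X \<in> sets borel" by simp
  have ind: "indicator X (trim \<tau> x) = indicator (trim \<tau> -` X) x" for x :: real
    by (simp add: indicator_def)
  have vX[measurable]: "trim \<tau> -` X \<in> sets borel"
    using measurable_sets[OF trim_measurable X, of \<tau>] by simp
  show "emeasure (distr (?Q) borel (trim \<tau>)) X =
    emeasure (distr (mixture_law p F) borel (trim \<tau>)) X"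
    using nn_integral_trimmed_density[OF X]
    by (simp add: emeasure_distr emeasure_density ind)
qed simp

text \<open>Effects at most \<open>a\<close> enter through their exponential second moment; larger effects are rare, and
  there the trimming keeps the envelope of the likelihood ratio square integrable.\<close>

lemma trimmed_density_chi2:
  fixes a :: real
  assumes a: "0 \<le> a"
  defines "D \<equiv> measure (interval_measure F) {m. a < \<bar>m\<bar>}"
  defines "c \<equiv> 3 * p\<^sup>2 * (1 + exp (a\<^sup>2) + 5 * D\<^sup>2 / p_value \<tau>)"
  shows "integrable N01 (\<lambda>x. (trimmed_density \<tau> p F x - 1)\<^sup>2)"
    "(\<integral>x. (trimmed_density \<tau> p F x - 1)\<^sup>2 \<partial>N01) \<le> c"
proof -
  let ?l = "trimmed_density \<tau> p F"
  let ?N = "N01"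
  let ?G = "interval_measure F" and ?B = "{m. a < \<bar>m\<bar>}" and ?C = "{m. \<bar>m\<bar> \<le> a}"
  have c0: "0 \<le> c" using p_value_pos[of \<tau>] by (auto simp: c_def intro!: mult_nonneg_nonneg add_nonneg_nonneg)
  define k1 where "k1 x = (\<integral>m. trimmed_ratio \<tau> m x * indicator ?C m \<partial>?G)" for x
  define k2 where "k2 x = (\<integral>m. trimmed_ratio \<tau> m x * indicator ?B m \<partial>?G)" for x
  define K where "K x = (\<integral>\<^sup>+m. ennreal ((trimmed_ratio \<tau> m x)\<^sup>2) * indicator ?C m \<partial>?G)" for x
  have i1: "integrable ?G (\<lambda>m. trimmed_ratio \<tau> m x * indicator ?C m)" for x
    by (intro integrable_real_mult_indicator integrable_trimmed_ratio) auto
  have i2: "integrable ?G (\<lambda>m. trimmed_ratio \<tau> m x * indicator ?B m)" for x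
    by (intro integrable_real_mult_indicator integrable_trimmed_ratio) auto
  have split: "(\<integral>m. trimmed_ratio \<tau> m x \<partial>?G) = k1 x + k2 x" for x
    unfolding k1_def k2_def
    by (subst Bochner_Integration.integral_add[OF i1 i2, symmetric])
       (auto intro!: Bochner_Integration.integral_cong split: split_indicator)
  \<comment> \<open>The envelope does not depend on \<open>m\<close> and leaves the integral, so
    that large effects enter through their mass \<open>D\<close> alone.\<close>
  have k2: "0 \<le> k2 x" "k2 x \<le> ratio_envelope \<tau> x * D" for x
  proof -
    show "0 \<le> k2 x" unfolding k2_def
      by (intro integral_nonneg_AE AE_I2) (auto simp: trimmed_ratio_nonneg)
    have "k2 x \<le> (\<integral>m. ratio_envelope \<tau> x * indicator ?B m \<partial>?G)"
      unfolding k2_def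
      by (intro integral_mono i2 integrable_mult_right integrable_real_indicator)
         (auto simp: GM.emeasure_eq_measure trimmed_ratio_le_envelope split: split_indicator)
    then show "k2 x \<le> ratio_envelope \<tau> x * D" by (simp add: D_def)
  qed
  \<comment> \<open>Jensen's inequality for the effect distribution, in the form of a nonnegative
    variance. Squaring inside the integral lets Fubini reduce the second moment to one effect at a
    time.\<close>
  have k1: "ennreal ((k1 x)\<^sup>2) \<le> K x" for x
  proof -
    have m: "(\<lambda>m. trimmed_ratio \<tau> m x * indicator ?C m) \<in> borel_measurable ?G" by measurable
    have sqi: "integrable ?G (\<lambda>m. (trimmed_ratio \<tau> m x * indicator ?C m)\<^sup>2)"
      using trimmed_ratio_le_envelope[of \<tau> _ x] trimmed_ratio_nonneg[of \<tau> _ x]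
      by (intro GM.integrable_const_bound[where B="(ratio_envelope \<tau> x)\<^sup>2"])
         (auto intro!: power_mono split: split_indicator)
    have "(k1 x)\<^sup>2 \<le> (\<integral>m. (trimmed_ratio \<tau> m x * indicator ?C m)\<^sup>2 \<partial>?G)"
      using GM.variance_eq[OF i1 sqi] GM.variance_positive[of "\<lambda>m. trimmed_ratio \<tau> m x * indicator ?C m"]
      unfolding k1_def by simp
    then have "ennreal ((k1 x)\<^sup>2) \<le> ennreal (\<integral>m. (trimmed_ratio \<tau> m x * indicator ?C m)\<^sup>2 \<partial>?G)"
      by (rule ennreal_leI)
    also have "\<dots> = (\<integral>\<^sup>+m. ennreal ((trimmed_ratio \<tau> m x * indicator ?C m)\<^sup>2) \<partial>?G)"
      by (rule nn_integral_eq_integral[OF sqi, symmetric]) simp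
    also have "\<dots> = K x"
      unfolding K_def by (intro nn_integral_cong) (auto split: split_indicator)
    finally show ?thesis .
  qed
  have K[measurable]: "K \<in> borel_measurable borel"
    unfolding K_def[abs_def] by measurable
  have EK: "(\<integral>\<^sup>+x. K x \<partial>?N) \<le> ennreal (exp (a\<^sup>2))"
  proof -
    have "(\<integral>\<^sup>+x. K x \<partial>?N)
      = (\<integral>\<^sup>+m. \<integral>\<^sup>+x. ennreal ((trimmed_ratio \<tau> m x)\<^sup>2) * indicator ?C m \<partial>?N \<partial>?G)"
      unfolding K_def by (rule Fubini') measurable
    also have "\<dots> \<le> (\<integral>\<^sup>+m. ennreal (exp (a\<^sup>2)) \<partial>?G)"
    proof (intro nn_integral_mono)
      fix m :: real
      show "(\<integral>\<^sup>+x. ennreal ((trimmed_ratio \<tau> m x)\<^sup>2) * indicator ?C m \<partial>?N) \<le> ennreal (exp (a\<^sup>2))"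
      proof (cases "\<bar>m\<bar> \<le> a")
        case True
        then have "m\<^sup>2 \<le> a\<^sup>2" by (simp add: abs_le_square_iff[symmetric])
        then show ?thesis using True nn_integral_trimmed_ratio_square[OF \<tau>, of m]
          by (auto intro: order_trans ennreal_leI)
      qed simp
    qed
    also have "\<dots> = ennreal (exp (a\<^sup>2))" using GM.emeasure_space_1 by simp
    finally show ?thesis .
  qed
  have pt: "ennreal ((?l x - 1)\<^sup>2) \<le>
    ennreal (3 * p\<^sup>2) * (1 + K x + ennreal (D\<^sup>2) * ennreal ((ratio_envelope \<tau> x)\<^sup>2))" for x
  proof -
    have sq3: "(u + v - 1)\<^sup>2 \<le> 3 * (1 + u\<^sup>2 + v\<^sup>2)" for u v :: real
      using zero_le_power2[of "u - v"] zero_le_power2[of "u + 1"] zero_le_power2[of "v + 1"]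
      by (simp add: power2_eq_square algebra_simps)
    have "(?l x - 1)\<^sup>2 = p\<^sup>2 * (k1 x + k2 x - 1)\<^sup>2"
      by (simp add: trimmed_density_def split power2_eq_square algebra_simps)
    also have "\<dots> \<le> p\<^sup>2 * (3 * (1 + (k1 x)\<^sup>2 + (k2 x)\<^sup>2))"
      by (intro mult_left_mono sq3) simp
    also have "\<dots> \<le> p\<^sup>2 * (3 * (1 + (k1 x)\<^sup>2 + (ratio_envelope \<tau> x * D)\<^sup>2))"
      using k2[of x] by (intro mult_left_mono add_left_mono power_mono) auto
    also have "\<dots> = 3 * p\<^sup>2 * (1 + (k1 x)\<^sup>2 + D\<^sup>2 * (ratio_envelope \<tau> x)\<^sup>2)"
      by (simp add: power_mult_distrib)
    finally have "ennreal ((?l x - 1)\<^sup>2) \<le>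
       ennreal (3 * p\<^sup>2 * (1 + (k1 x)\<^sup>2 + D\<^sup>2 * (ratio_envelope \<tau> x)\<^sup>2))"
      by (rule ennreal_leI)
    also have "\<dots> = ennreal (3 * p\<^sup>2) * (1 + ennreal ((k1 x)\<^sup>2) + ennreal (D\<^sup>2) * ennreal ((ratio_envelope \<tau> x)\<^sup>2))"
      by (simp add: ennreal_mult)
    also have "\<dots> \<le> ennreal (3 * p\<^sup>2) * (1 + K x + ennreal (D\<^sup>2) * ennreal ((ratio_envelope \<tau> x)\<^sup>2))"
      using k1[of x] by (intro mult_left_mono add_right_mono add_left_mono) auto
    finally show ?thesis .
  qed
  have "(\<integral>\<^sup>+x. ennreal ((?l x - 1)\<^sup>2) \<partial>?N)
    \<le> (\<integral>\<^sup>+x. ennreal (3 * p\<^sup>2) * (1 + K x + ennreal (D\<^sup>2) * ennreal ((ratio_envelope \<tau> x)\<^sup>2)) \<partial>?N)"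
    by (intro nn_integral_mono pt)
  also have "\<dots> = ennreal (3 * p\<^sup>2) * (1 + (\<integral>\<^sup>+x. K x \<partial>?N)
      + ennreal (D\<^sup>2) * (\<integral>\<^sup>+x. ennreal ((ratio_envelope \<tau> x)\<^sup>2) \<partial>?N))"
    using normal.emeasure_space_1 by (simp add: nn_integral_cmult nn_integral_add)
  also have "\<dots> \<le> ennreal (3 * p\<^sup>2) * (1 + ennreal (exp (a\<^sup>2)) + ennreal (D\<^sup>2) * ennreal (5 / p_value \<tau>))"
    using EK nn_integral_envelope_square[OF \<tau>]
    by (intro mult_left_mono add_mono order_refl) auto
  also have "\<dots> = ennreal c"
    using p_value_pos[of \<tau>] by (simp add: c_def ennreal_mult'[symmetric] ennreal_plus[symmetric] ennreal_1[symmetric] mult.commute del: ennreal_plus ennreal_1)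
  finally have le: "(\<integral>\<^sup>+x. ennreal ((?l x - 1)\<^sup>2) \<partial>?N) \<le> ennreal c" .
  show i: "integrable ?N (\<lambda>x. (?l x - 1)\<^sup>2)"
  proof (rule integrableI_bounded)
    show "(\<integral>\<^sup>+x. ennreal (norm ((?l x - 1)\<^sup>2)) \<partial>?N) < \<infinity>"
      using le by (simp add: le_less_trans)
  qed measurable
  have "ennreal (\<integral>x. (?l x - 1)\<^sup>2 \<partial>?N) \<le> ennreal c"
    using le by (subst nn_integral_eq_integral[OF i, symmetric]) auto
  then show "(\<integral>x. (?l x - 1)\<^sup>2 \<partial>?N) \<le> c"
    using c0 by simp
qed

text \<open>An invariant event has the same probability under a product law and under its trimmed
  image. The mixture may thus be replaced by the tilted null law, to which the tensorized chi-square
  bound applies.\<close>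

lemma trimmed_prob_diff_le:
  fixes a :: real and I :: "'i set"
  assumes a: "0 \<le> a" and I: "finite I" and E: "E \<in> sets (\<Pi>\<^sub>M i\<in>I. borel)"
    and inv: "\<And>x. x \<in> space (\<Pi>\<^sub>M i\<in>I. borel) \<Longrightarrow> (\<lambda>i\<in>I. trim \<tau> (x i)) \<in> E \<longleftrightarrow> x \<in> E"
  shows "\<bar>measure (\<Pi>\<^sub>M i\<in>I. mixture_law p F) E - measure (\<Pi>\<^sub>M i\<in>I. N01) E\<bar>
    \<le> sqrt (exp (card I * (3 * p\<^sup>2 * (1 + exp (a\<^sup>2) +
        5 * (measure (interval_measure F) {m. a < \<bar>m\<bar>})\<^sup>2 / p_value \<tau>))) - 1)"
proof -
  let ?Q = "density N01 (\<lambda>x. ennreal (trimmed_density \<tau> p F x))"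
  interpret M: prob_space "mixture_law p F" using p F by (rule prob_space_mixture_law)
  interpret Q: prob_space ?Q
    using nn_integral_trimmed_density_1 by (intro prob_spaceI) (simp add: emeasure_density cong: nn_integral_cong)
  have *: "measure (\<Pi>\<^sub>M i\<in>I. P) E = measure (\<Pi>\<^sub>M i\<in>I. distr P borel (trim \<tau>)) E"
    if P: "prob_space P" "sets P = sets borel" for P
  proof -
    have sP: "sets (\<Pi>\<^sub>M i\<in>I. P) = sets (\<Pi>\<^sub>M i\<in>I. borel)" using that by (intro sets_PiM_cong) auto
    have t[measurable]: "trim \<tau> \<in> P \<rightarrow>\<^sub>M borel" by (simp add: that cong: measurable_cong_sets)
    have m: "(\<lambda>x. \<lambda>i\<in>I. trim \<tau> (x i)) \<in> (\<Pi>\<^sub>M i\<in>I. P) \<rightarrow>\<^sub>M (\<Pi>\<^sub>M i\<in>I. borel)" by measurable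
    have "measure (\<Pi>\<^sub>M i\<in>I. distr P borel (trim \<tau>)) E
      = measure (distr (\<Pi>\<^sub>M i\<in>I. P) (\<Pi>\<^sub>M i\<in>I. borel) (\<lambda>x. \<lambda>i\<in>I. trim \<tau> (x i))) E"
      by (subst distr_PiM_map[OF I P(1) t]) simp
    also have "\<dots> = measure (\<Pi>\<^sub>M i\<in>I. P) ((\<lambda>x. \<lambda>i\<in>I. trim \<tau> (x i)) -` E \<inter> space (\<Pi>\<^sub>M i\<in>I. P))"
      by (rule measure_distr[OF m E])
    also have "(\<lambda>x. \<lambda>i\<in>I. trim \<tau> (x i)) -` E \<inter> space (\<Pi>\<^sub>M i\<in>I. P) = E"
      using inv sets.sets_into_space[OF E] sets_eq_imp_space_eq[OF sP] by auto
    finally show ?thesis by simp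
  qed
  have "measure (\<Pi>\<^sub>M i\<in>I. mixture_law p F) E = measure (\<Pi>\<^sub>M i\<in>I. distr (mixture_law p F) borel (trim \<tau>)) E"
    by (rule *) (auto simp: M.prob_space_axioms)
  also have "\<dots> = measure (\<Pi>\<^sub>M i\<in>I. ?Q) E"
    unfolding distr_trimmed_density[symmetric] by (rule *[symmetric]) (auto simp: Q.prob_space_axioms)
  finally have eq: "measure (\<Pi>\<^sub>M i\<in>I. mixture_law p F) E = measure (\<Pi>\<^sub>M i\<in>I. ?Q) E" .
  have "sets (\<Pi>\<^sub>M i\<in>I. N01) = sets (\<Pi>\<^sub>M i\<in>I. borel :: real measure)" by (intro sets_PiM_cong) auto
  with E have E': "E \<in> sets (\<Pi>\<^sub>M i\<in>I. N01)" by simp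
  show ?thesis
    unfolding eq
    by (rule PiM_density_prob_diff_le[OF I prob_space_normal_law _ trimmed_density_nonneg
          nn_integral_trimmed_density_1 trimmed_density_chi2[OF a] E']) measurable
qed

end

section \<open>The maximum and the tails of the mixture\<close>

abbreviation samples :: "nat \<Rightarrow> (nat \<Rightarrow> real) measure" where
  "samples n \<equiv> \<Pi>\<^sub>M i\<in>{1..n}. borel"

lemma measure_PiM_all:
  assumes P: "prob_space P" and sP: "sets P = sets borel" and A: "A \<in> sets borel" and I: "finite I"
  shows "{x \<in> space (\<Pi>\<^sub>M i\<in>I. P). \<forall>i\<in>I. x i \<in> A} \<in> sets (\<Pi>\<^sub>M i\<in>I. P)" (is ?c1)
    "measure (\<Pi>\<^sub>M i\<in>I. P) {x \<in> space (\<Pi>\<^sub>M i\<in>I. P). \<forall>i\<in>I. x i \<in> A} = measure P A ^ card I" (is ?c2)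
proof -
  interpret P: prob_space P by fact
  interpret PP: product_prob_space "\<lambda>_. P" I by (intro product_prob_spaceI P.prob_space_axioms)
  have eq: "{x \<in> space (\<Pi>\<^sub>M i\<in>I. P). \<forall>i\<in>I. x i \<in> A} = Pi\<^sub>E I (\<lambda>_. A)"
    using sets_eq_imp_space_eq[OF sP] by (auto simp: space_PiM PiE_iff extensional_def)
  show ?c1
    unfolding eq using I A sP by (intro sets_PiM_I_finite) auto
  show ?c2
    unfolding eq using PP.measure_PiM_emb[of I "\<lambda>_. A"] I A sP
      prod_emb_PiE_same_index[of I "\<lambda>_. A" "\<lambda>_. P"] sets_eq_imp_space_eq[OF sP] by simp
qed

lemma max_stat_le_iff: "1 \<le> n \<Longrightarrow> max_stat n x \<le> y \<longleftrightarrow> (\<forall>i\<in>{1..n}. \<bar>x i\<bar> \<le> y)"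
  unfolding max_stat_def by (subst Max_le_iff) auto

lemma max_stat_prob:
  assumes n: "1 \<le> n" and P: "prob_space P" and sP: "sets P = sets borel"
  shows "measure (\<Pi>\<^sub>M i\<in>{1..n}. P) {x \<in> space (\<Pi>\<^sub>M i\<in>{1..n}. P). max_stat n x \<le> y} = measure P {z. \<bar>z\<bar> \<le> y} ^ n"
    "{x \<in> space (\<Pi>\<^sub>M i\<in>{1..n}. P). y < max_stat n x} \<in> sets (samples n)"
    "measure (\<Pi>\<^sub>M i\<in>{1..n}. P) {x \<in> space (\<Pi>\<^sub>M i\<in>{1..n}. P). y < max_stat n x} =
       1 - (1 - measure P {z. y < \<bar>z\<bar>}) ^ n"
proof -
  let ?P = "\<Pi>\<^sub>M i\<in>{1..n}. P"
  interpret P: prob_space P by fact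
  interpret PP: prob_space "\<Pi>\<^sub>M i\<in>{1..n}. P" by (intro prob_space_PiM P.prob_space_axioms)
  have sPP: "sets ?P = sets (samples n)" using sP by (intro sets_PiM_cong) auto
  have eq: "{x \<in> space ?P. max_stat n x \<le> y} =
    {x \<in> space ?P. \<forall>i\<in>{1..n}. x i \<in> {z. \<bar>z\<bar> \<le> y}}"
    using max_stat_le_iff[OF n] by auto
  show *: "measure ?P {x \<in> space ?P. max_stat n x \<le> y} = measure P {z. \<bar>z\<bar> \<le> y} ^ n"
    unfolding eq by (subst measure_PiM_all(2)[OF P sP]) auto
  have ev: "{x \<in> space ?P. max_stat n x \<le> y} \<in> PP.events"
    unfolding eq by (rule measure_PiM_all(1)[OF P sP]) auto
  have "{x \<in> space ?P. y < max_stat n x} =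
      space ?P - {x \<in> space ?P. max_stat n x \<le> y}" by auto
  moreover have "measure P {z. \<bar>z\<bar> \<le> y} = 1 - measure P {z. y < \<bar>z\<bar>}"
  proof -
    have "{z. \<bar>z\<bar> \<le> y} = space P - {z. y < \<bar>z\<bar>}"
      using sets_eq_imp_space_eq[OF sP] by auto
    then show ?thesis by (simp add: P.prob_compl sP)
  qed
  ultimately show "{x \<in> space ?P. y < max_stat n x} \<in> sets (samples n)"
    "measure ?P {x \<in> space ?P. y < max_stat n x} =
       1 - (1 - measure P {z. y < \<bar>z\<bar>}) ^ n"
    using ev * PP.prob_compl[OF ev] by (auto simp: sPP[symmetric] simp del: One_nat_def)
qed

text \<open>The null distribution function of the maximum is strictly increasing on the nonnegative
  half-line and, since \<open>n \<ge> 1\<close>, zero below it. Hence the set in the definition of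
  the quantile is exactly \<open>{m..}\<close>.\<close>

lemma quantile_max_stat:
  assumes n: "1 \<le> n" and m: "0 \<le> m" and q: "(1 - p_value m) ^ n = q" "0 < q"
  shows "quantile (H0 n) (max_stat n) q = m"
proof -
  have F: "measure (H0 n) {x \<in> space (H0 n). max_stat n x \<le> y} = measure N01 {z. \<bar>z\<bar> \<le> y} ^ n" for y
    unfolding H0_eq_PiM by (rule max_stat_prob[OF n prob_space_normal_law]) simp
  have "q \<le> measure (H0 n) {x \<in> space (H0 n). max_stat n x \<le> y} \<longleftrightarrow> m \<le> y" for y
  proof (cases "0 \<le> y")
    case True
    have "q \<le> (1 - p_value y) ^ n \<longleftrightarrow> 1 - p_value m \<le> 1 - p_value y"
      unfolding q(1)[symmetric] using n p_value_le_1[of m] p_value_le_1[of y]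
      by (subst power_mono_iff) auto
    also have "\<dots> \<longleftrightarrow> m \<le> y" using True m p_value_le_iff[of y m] by auto
    finally show ?thesis using True by (simp add: F measure_normal_law_abs)
  next
    case False
    then have "{z. \<bar>z\<bar> \<le> y} = {}" by auto
    then show ?thesis using False q m n unfolding F by (simp add: power_0_left)
  qed
  then have "{x. q \<le> measure (H0 n) {\<omega> \<in> space (H0 n). max_stat n \<omega> \<le> x}} = {m..}" by auto
  then show ?thesis by (simp add: quantile_def)
qed

text \<open>The density at \<open>t + 1\<close> and the exponential bound squeeze the tail
  probability. The shift by one and all constants are negligible relative to
  \<open>sqrt (2 * ln n)\<close>.\<close>

lemma threshold_asymp:
  assumes t: "\<And>n. 0 \<le> t n" and lim: "(\<lambda>n. real n * p_value (t n)) \<longlonglongrightarrow> l" and l: "0 < l"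
  shows "(\<lambda>n. t n / sqrt (2 * ln (real n))) \<longlonglongrightarrow> 1"
proof (rule tendsto_sandwich)
  have e: "eventually (\<lambda>n. real n * p_value (t n) < 2 * l) sequentially"
    "eventually (\<lambda>n. l / 2 < real n * p_value (t n)) sequentially"
    using l by (intro order_tendstoD[OF lim]; simp)+
  show "eventually (\<lambda>n. (sqrt (2 * ln (real n / (2 * l * sqrt (2 * pi)))) - 1) / sqrt (2 * ln (real n)) \<le> t n / sqrt (2 * ln (real n))) sequentially"
    using e(1) eventually_ge_at_top[of 2]
  proof eventually_elim
    case (elim n)
    have "exp (- (t n + 1)\<^sup>2 / 2) / sqrt (2 * pi) \<le> p_value (t n)"
      using p_value_ge_density[OF t[of n]] by (simp add: normal_density_def)
    also have "\<dots> \<le> 2 * l / real n" using elim by (simp add: field_simps)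
    finally have "exp (- (t n + 1)\<^sup>2 / 2) \<le> 2 * l * sqrt (2 * pi) / real n"
      by (simp add: field_simps)
    then have "real n / (2 * l * sqrt (2 * pi)) \<le> exp ((t n + 1)\<^sup>2 / 2)"
      using l elim by (simp add: exp_minus field_simps)
    then have "ln (real n / (2 * l * sqrt (2 * pi))) \<le> ln (exp ((t n + 1)\<^sup>2 / 2))"
      using l elim by (subst ln_le_cancel_iff) auto
    then have "sqrt (2 * ln (real n / (2 * l * sqrt (2 * pi)))) \<le> t n + 1"
      using t[of n] by (intro real_le_lsqrt) auto
    then show ?case using elim by (intro divide_right_mono) auto
  qed
  show "eventually (\<lambda>n. t n / sqrt (2 * ln (real n)) \<le> sqrt (2 * ln (4 * real n / l)) / sqrt (2 * ln (real n))) sequentially"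
    using e(2) eventually_ge_at_top[of 2]
  proof eventually_elim
    case (elim n)
    have "l / (2 * real n) \<le> p_value (t n)" using elim by (simp add: field_simps)
    also have "\<dots> \<le> 2 * exp (- (t n)\<^sup>2 / 2)" by (rule p_value_le_exp)
    finally have "exp ((t n)\<^sup>2 / 2) \<le> 4 * real n / l"
      using l elim by (simp add: exp_minus field_simps)
    then have "(t n)\<^sup>2 / 2 \<le> ln (4 * real n / l)"
      using l elim by (subst ln_ge_iff) auto
    then have "t n \<le> sqrt (2 * ln (4 * real n / l))" by (intro real_le_rsqrt) simp
    then show ?case using elim by (intro divide_right_mono) auto
  qed
  show "(\<lambda>n. (sqrt (2 * ln (real n / (2 * l * sqrt (2 * pi)))) - 1) / sqrt (2 * ln (real n))) \<longlonglongrightarrow> 1"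
  proof -
    define k where "k = 2 * l * sqrt (2 * pi)"
    have "0 < k" using l by (simp add: k_def)
    then show ?thesis unfolding k_def[symmetric] by real_asymp
  qed
  show "(\<lambda>n. sqrt (2 * ln (4 * real n / l)) / sqrt (2 * ln (real n))) \<longlonglongrightarrow> 1"
    using l by real_asymp
qed

section \<open>Tails of the effect distribution and of the mixture\<close>

definition tail :: "(real \<Rightarrow> real) \<Rightarrow> real \<Rightarrow> real" where
  "tail F s = 1 - F s + F (- s)"

text \<open>\<open>tail\<close> is written with values of \<open>F\<close>, to which the assumed
  limits apply, and so counts an atom at \<open>- s\<close> but not one at \<open>s\<close>. The
  strict and the weak exceedance enclose it.\<close>

lemma tail_bounds:
  assumes F: "distribution_function F" and s: "0 \<le> s"
  shows "measure (interval_measure F) {m. s < \<bar>m\<bar>} \<le> tail F s" (is ?c1)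
    "tail F s \<le> measure (interval_measure F) {m. s \<le> \<bar>m\<bar>}" (is ?c2)
proof -
  interpret real_distribution "interval_measure F"
    using F by (rule real_distribution_distribution_function)
  have c: "measure (interval_measure F) {..x} = F x" for x
    using real_distribution_distribution_function(2)[OF F] by (simp add: cdf_def2 flip: cdf_def2)
  have "measure (interval_measure F) {s<..} = 1 - F s"
  proof -
    have "{s<..} = UNIV - {..s}" by auto
    then show ?thesis using prob_compl[of "{..s}"] by (simp add: c)
  qed
  then have "tail F s = measure (interval_measure F) {..- s} + measure (interval_measure F) {s<..}"
    by (simp add: tail_def c)
  also have "\<dots> = measure (interval_measure F) ({..- s} \<union> {s<..})"
    using s by (intro finite_measure_Union[symmetric]) auto
  finally have *: "tail F s = measure (interval_measure F) ({..- s} \<union> {s<..})" .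
  show ?c1
    unfolding * by (intro finite_measure_mono) auto
  show ?c2
    unfolding * using s by (intro finite_measure_mono) auto
qed

definition mixed_tail :: "(real \<Rightarrow> real) \<Rightarrow> real \<Rightarrow> real" where
  "mixed_tail F t = (\<integral>m. measure (normal_law m) {z. t < \<bar>z\<bar>} \<partial>interval_measure F)"

text \<open>Below, \<open>d\<close> is the size of the noise that is allowed to bridge the gap between an effect and the threshold.\<close>

lemma mixed_tail_bounds:
  assumes F: "distribution_function F" and d: "0 \<le> d" "d \<le> t" and s: "0 \<le> s" "s \<le> 1"
  shows "tail F (t + d) * (1 - p_value d) \<le> mixed_tail F t"
    "mixed_tail F t
       \<le> tail F (t - d) + tail F (s * t) * p_value d + p_value ((1 - s) * t)"
unfolding mixed_tail_def
proof -
  interpret real_distribution "interval_measure F"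
    using F by (rule real_distribution_distribution_function)
  let ?M = "interval_measure F"
  have t: "0 \<le> t" using d by simp
  have i: "integrable ?M (\<lambda>m. measure (normal_law m) {z. t < \<bar>z\<bar>})"
    by (rule integrable_const_bound[where B=1]) auto
  have tr: "measure (normal_law m) {z. t < \<bar>z\<bar>} = measure N01 {z. t < \<bar>m + z\<bar>}" for m
    by (subst measure_normal_law_translate) auto
  have ind: "integrable ?M (indicator A :: real \<Rightarrow> real)" if "A \<in> sets borel" for A
    using that by (intro integrable_real_indicator) (auto simp: emeasure_eq_measure)
  have "tail F (t + d) * (1 - p_value d) \<le> measure ?M {m. t + d \<le> \<bar>m\<bar>} * (1 - p_value d)"
    using tail_bounds(2)[OF F, of "t + d"] t d p_value_le_1[of d] by (intro mult_right_mono) auto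
  also have "\<dots> = (\<integral>m. (1 - p_value d) * indicator {m. t + d \<le> \<bar>m\<bar>} m \<partial>?M)" by simp
  also have "\<dots> \<le> (\<integral>m. measure (normal_law m) {z. t < \<bar>z\<bar>} \<partial>?M)"
  proof (intro integral_mono i integrable_mult_right ind)
    fix m :: real
    show "(1 - p_value d) * indicator {m. t + d \<le> \<bar>m\<bar>} m \<le> measure (normal_law m) {z. t < \<bar>z\<bar>}"
    proof (cases "t + d \<le> \<bar>m\<bar>")
      case True
      then have "measure N01 {z. \<bar>z\<bar> < d} \<le> measure N01 {z. t < \<bar>m + z\<bar>}"
        by (intro normal.finite_measure_mono) auto
      then show ?thesis using True d by (simp add: tr measure_normal_law_abs)
    qed simp
  qed simp
  finally show "tail F (t + d) * (1 - p_value d) \<le> (\<integral>m. measure (normal_law m) {z. t < \<bar>z\<bar>} \<partial>?M)" .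
  \<comment> \<open>Three ranges of effects: beyond \<open>t - d\<close> the bound is 1, between
    \<open>s * t\<close> and \<open>t - d\<close> the noise must exceed \<open>d\<close>, and below
    \<open>s * t\<close> it must exceed \<open>(1 - s) * t\<close>.\<close>
  have "(\<integral>m. measure (normal_law m) {z. t < \<bar>z\<bar>} \<partial>?M) \<le>
    (\<integral>m. indicator {m. t - d < \<bar>m\<bar>} m + indicator {m. s * t < \<bar>m\<bar>} m * p_value d + p_value ((1 - s) * t) \<partial>?M)"
  proof (intro integral_mono i Bochner_Integration.integrable_add ind integrable_mult_left)
    fix m :: real
    have le1: "measure (normal_law m) {z. t < \<bar>z\<bar>} \<le> p_value e" if "0 \<le> e" "\<bar>m\<bar> + e \<le> t" for e
    proof -
      have "measure N01 {z. t < \<bar>m + z\<bar>} \<le> measure N01 {z. e < \<bar>z\<bar>}"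
        using that by (intro normal.finite_measure_mono) auto
      then show ?thesis using that by (simp add: tr measure_normal_law_abs)
    qed
    have nn: "0 \<le> p_value d" "0 \<le> p_value ((1 - s) * t)" by (rule p_value_nonneg)+
    show "measure (normal_law m) {z. t < \<bar>z\<bar>} \<le>
      indicator {m. t - d < \<bar>m\<bar>} m + indicator {m. s * t < \<bar>m\<bar>} m * p_value d + p_value ((1 - s) * t)"
    proof (cases "t - d < \<bar>m\<bar>")
      case True
      then show ?thesis using nn
        by (intro order_trans[OF normal.prob_le_1]) (auto split: split_indicator)
    next
      case False
      note 1 = this
      show ?thesis
      proof (cases "s * t < \<bar>m\<bar>")
        case True
        then show ?thesis using 1 le1[of d] d nn by auto
      next
        case False
        then show ?thesis using 1 le1[of "(1 - s) * t"] s t nn mult_right_mono[of s 1 t] by (auto simp: algebra_simps)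
      qed
    qed
  qed auto
  also have "\<dots> = measure ?M {m. t - d < \<bar>m\<bar>} + measure ?M {m. s * t < \<bar>m\<bar>} * p_value d + p_value ((1 - s) * t)"
    using prob_space by (simp add: ind)
  also have "\<dots> \<le> tail F (t - d) + tail F (s * t) * p_value d + p_value ((1 - s) * t)"
    using d s t p_value_nonneg by (intro add_mono mult_right_mono tail_bounds[OF F] order_refl) auto
  finally show "(\<integral>m. measure (normal_law m) {z. t < \<bar>z\<bar>} \<partial>?M)
       \<le> tail F (t - d) + tail F (s * t) * p_value d + p_value ((1 - s) * t)" .
qed

lemma tv_dist_bounds:
  assumes "prob_space P" "prob_space Q"
  shows "A \<in> sets P \<Longrightarrow> \<bar>measure P A - measure Q A\<bar> \<le> tv_dist P Q"
    and "0 \<le> tv_dist P Q" and "tv_dist P Q \<le> 1"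
    and "(\<And>A. A \<in> sets P \<Longrightarrow> \<bar>measure P A - measure Q A\<bar> \<le> e) \<Longrightarrow> tv_dist P Q \<le> e"
proof -
  interpret P: prob_space P by fact
  interpret Q: prob_space Q by fact
  have le: "\<bar>measure P A - measure Q A\<bar> \<le> 1" for A
    using P.prob_le_1[of A] Q.prob_le_1[of A] measure_nonneg[of P A] measure_nonneg[of Q A] by linarith
  have bdd: "bdd_above ((\<lambda>A. \<bar>measure P A - measure Q A\<bar>) ` sets P)"
    using le by (intro bdd_aboveI[where M=1]) auto
  show *: "A \<in> sets P \<Longrightarrow> \<bar>measure P A - measure Q A\<bar> \<le> tv_dist P Q" for A
    unfolding tv_dist_def by (rule cSUP_upper[OF _ bdd])
  show "0 \<le> tv_dist P Q" using *[of "{}"] by simp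
  show "tv_dist P Q \<le> 1" unfolding tv_dist_def using le by (intro cSUP_least) auto
  show "(\<And>A. A \<in> sets P \<Longrightarrow> \<bar>measure P A - measure Q A\<bar> \<le> e) \<Longrightarrow> tv_dist P Q \<le> e"
    unfolding tv_dist_def by (intro cSUP_least) auto
qed

section \<open>Asymptotics under the scaled effect distributions\<close>

locale heavy_tailed_effects =
  fixes G :: "real \<Rightarrow> real" and \<nu> C r \<beta> :: real
  assumes \<nu>: "\<nu> > 0" and C: "C > 0" and r: "r > 0" and \<beta>: "1 / 2 < \<beta>" "\<beta> < 1"
    and G: "distribution_function G"
    and upper_tail: "((\<lambda>\<mu>. (1 - G \<mu>) * \<mu> powr \<nu>) \<longlongrightarrow> C) at_top"
    and lower_tail: "((\<lambda>\<mu>. G (- \<mu>) * \<mu> powr \<nu>) \<longlongrightarrow> C) at_top"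
begin

abbreviation Gs :: "nat \<Rightarrow> real \<Rightarrow> real" where "Gs \<equiv> scaled_seq G \<nu> \<beta> r"

abbreviation L :: "nat \<Rightarrow> real" where "L n \<equiv> sqrt (2 * ln (real n))"

text \<open>As \<open>ln 1 = 0\<close>, the scale vanishes at \<open>n = 1\<close>; facts about
  \<open>Gs n\<close> therefore start at 2.\<close>

lemma scale_pos: "2 \<le> n \<Longrightarrow> 0 < scale \<nu> \<beta> r n"
  using r by (simp add: scale_def)

lemma L_at_top: "filterlim L at_top sequentially"
  by real_asymp

lemma distribution_function_Gs:
  assumes "2 \<le> n"
  shows "distribution_function (Gs n)"
proof -
  define s where "s = scale \<nu> \<beta> r n"
  have s: "0 < s" using scale_pos[OF assms] by (simp add: s_def)
  have G': "mono G" "\<And>x. continuous (at_right x) G" "(G \<longlongrightarrow> 0) at_bot" "(G \<longlongrightarrow> 1) at_top"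
    using G by (auto simp: distribution_function_def)
  have "mono (\<lambda>x. G (x / s))"
    using s by (intro monoI monoD[OF G'(1)] divide_right_mono) auto
  moreover have "continuous (at_right x) (\<lambda>x. G (x / s))" for x
  proof -
    have "filterlim (\<lambda>y. y / s) (at_right (x / s)) (at_right x)"
      using s by (auto simp: filterlim_at eventually_at_filter divide_strict_right_mono intro!: tendsto_intros)
    then show ?thesis
      using G'(2)[of "x / s"] unfolding continuous_within by (rule filterlim_compose[rotated])
  qed
  moreover have "((\<lambda>x. G (x / s)) \<longlongrightarrow> 0) at_bot"
    using s by (intro filterlim_compose[OF G'(3)]) (real_asymp)
  moreover have "((\<lambda>x. G (x / s)) \<longlongrightarrow> 1) at_top"
    using s by (intro filterlim_compose[OF G'(4)]) (real_asymp)
  ultimately show ?thesis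
    unfolding distribution_function_def scaled_seq_def s_def by auto
qed

lemma sparsity_range: "1 \<le> n \<Longrightarrow> 0 \<le> b \<Longrightarrow> real n powr (- b) \<in> {0..1}"
  using powr_mono[of "- b" 0 "real n"] by simp

abbreviation marginal :: "real \<Rightarrow> nat \<Rightarrow> real measure" where
  "marginal b n \<equiv> mixture_law (real n powr (- b)) (Gs n)"

lemma H1_Gs_eq: "2 \<le> n \<Longrightarrow> 0 \<le> b \<Longrightarrow> H1 Gs b n = (\<Pi>\<^sub>M i\<in>{1..n}. marginal b n)"
  using distribution_function_Gs[of n] sparsity_range[of n b] by (intro H1_eq_PiM) auto

lemma prob_space_marginal: "2 \<le> n \<Longrightarrow> 0 \<le> b \<Longrightarrow> prob_space (marginal b n)"
  using distribution_function_Gs[of n] sparsity_range[of n b] by (intro prob_space_mixture_law) auto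

lemma prob_space_H1: "2 \<le> n \<Longrightarrow> 0 \<le> b \<Longrightarrow> prob_space (H1 Gs b n)"
  by (simp add: H1_Gs_eq del: atLeastAtMost_iff) (intro prob_space_PiM prob_space_marginal)

lemma sets_H1: "2 \<le> n \<Longrightarrow> 0 \<le> b \<Longrightarrow> sets (H1 Gs b n) = sets (samples n)"
  by (simp only: H1_Gs_eq) (intro sets_PiM_cong, auto)

text \<open>In units of the scale, \<open>x * L n\<close> equals
  \<open>x / r * n powr ((1 - \<beta>) / \<nu>)\<close>, and a two-sided tail of
  \<open>2 * C * u powr (- \<nu>)\<close> at this point has order
  \<open>n powr (\<beta> - 1)\<close>. Continuity in \<open>x\<close> admits every threshold with
  the right ratio to \<open>L n\<close>.\<close>

lemma tail_asymp:
  assumes a: "(\<lambda>n. a n / L n) \<longlonglongrightarrow> x" and x: "0 < x"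
  shows "(\<lambda>n. real n powr (1 - \<beta>) * tail (Gs n) (a n)) \<longlonglongrightarrow> 2 * C * (r / x) powr \<nu>"
proof -
  define u where "u n = a n / scale \<nu> \<beta> r n" for n
  have u_eq: "u n = (a n / L n) * (real n powr ((1 - \<beta>) / \<nu>) / r)" if "2 \<le> n" for n
    using that r by (simp add: u_def scale_def field_simps)
  have "filterlim (\<lambda>n. real n powr ((1 - \<beta>) / \<nu>) / r) at_top sequentially"
  proof -
    define e where "e = (1 - \<beta>) / \<nu>"
    have "0 < e" using \<beta> \<nu> by (simp add: e_def)
    then show ?thesis unfolding e_def[symmetric] using r by real_asymp
  qed
  then have "filterlim (\<lambda>n. (a n / L n) * (real n powr ((1 - \<beta>) / \<nu>) / r)) at_top sequentially"
    by (rule filterlim_tendsto_pos_mult_at_top[OF a x])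
  then have u: "filterlim u at_top sequentially"
    by (rule filterlim_mono_eventually) (auto intro: eventually_mono[OF eventually_ge_at_top[of 2]] simp: u_eq)
  have "(\<lambda>n. (1 - G (u n)) * u n powr \<nu> + G (- u n) * u n powr \<nu>) \<longlonglongrightarrow> C + C"
    by (intro tendsto_add filterlim_compose[OF upper_tail u] filterlim_compose[OF lower_tail u])
  moreover have "(\<lambda>n. (r / (a n / L n)) powr \<nu>) \<longlonglongrightarrow> (r / x) powr \<nu>"
    using x r by (intro tendsto_powr tendsto_divide a tendsto_const) auto
  ultimately have "(\<lambda>n. ((1 - G (u n)) * u n powr \<nu> + G (- u n) * u n powr \<nu>) * (r / (a n / L n)) powr \<nu>)
    \<longlonglongrightarrow> (C + C) * (r / x) powr \<nu>"
    by (rule tendsto_mult)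
  moreover have "eventually (\<lambda>n. ((1 - G (u n)) * u n powr \<nu> + G (- u n) * u n powr \<nu>) * (r / (a n / L n)) powr \<nu>
     = real n powr (1 - \<beta>) * tail (Gs n) (a n)) sequentially"
    using order_tendstoD(1)[OF a x] eventually_ge_at_top[of 2]
  proof eventually_elim
    case (elim n)
    define y where "y = a n / L n"
    have y: "0 < y" using elim by (simp add: y_def)
    have "u n powr \<nu> * (r / y) powr \<nu> = (u n * (r / y)) powr \<nu>"
      using y r elim by (subst powr_mult) (auto simp: u_eq y_def[symmetric])
    also have "u n * (r / y) = real n powr ((1 - \<beta>) / \<nu>)"
      using y r elim by (simp add: u_eq y_def[symmetric])
    also have "\<dots> powr \<nu> = real n powr (1 - \<beta>)" using \<nu> by (simp add: powr_powr)
    finally have eq: "u n powr \<nu> * (r / y) powr \<nu> = real n powr (1 - \<beta>)" .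
    have "((1 - G (u n)) * u n powr \<nu> + G (- u n) * u n powr \<nu>) * (r / y) powr \<nu>
      = (1 - G (u n) + G (- u n)) * (u n powr \<nu> * (r / y) powr \<nu>)" by (simp add: algebra_simps)
    also have "\<dots> = real n powr (1 - \<beta>) * tail (Gs n) (a n)"
      unfolding eq by (simp add: tail_def scaled_seq_def u_def)
    finally show ?case by (simp add: y_def)
  qed
  ultimately show ?thesis
    using Lim_transform_eventually by fastforce
qed

text \<open>The allowance \<open>d = sqrt (t n)\<close> for the noise tends to infinity, so the
  noise rarely exceeds it, but is negligible relative to \<open>L n\<close>, so shifting the
  threshold by it does not change the limit.\<close>

lemma mixed_tail_lower:
  assumes t: "\<And>n. 0 \<le> t n" and lim: "(\<lambda>n. t n / L n) \<longlonglongrightarrow> x" and x: "0 < x"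
  shows "filterlim t at_top sequentially" "(\<lambda>n. sqrt (t n) / L n) \<longlonglongrightarrow> 0"
    "(\<lambda>n. p_value (sqrt (t n))) \<longlonglongrightarrow> 0"
    "(\<lambda>n. real n powr (1 - \<beta>) * (tail (Gs n) (t n + sqrt (t n)) * (1 - p_value (sqrt (t n)))))
      \<longlonglongrightarrow> 2 * C * (r / x) powr \<nu>" (is ?c1)
    "eventually (\<lambda>n. tail (Gs n) (t n + sqrt (t n)) * (1 - p_value (sqrt (t n)))
      \<le> mixed_tail (Gs n) (t n)) sequentially" (is ?c2)
proof -
  have "filterlim (\<lambda>n. t n / L n * L n) at_top sequentially"
    by (rule filterlim_tendsto_pos_mult_at_top[OF lim x L_at_top])
  then show t_top: "filterlim t at_top sequentially"
    by (rule filterlim_mono_eventually) (auto intro!: eventually_mono[OF eventually_ge_at_top[of 2]])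
  have sq_top: "filterlim (\<lambda>n. sqrt (t n)) at_top sequentially"
    by (rule filterlim_compose[OF sqrt_at_top t_top])
  show pv: "(\<lambda>n. p_value (sqrt (t n))) \<longlonglongrightarrow> 0"
    by (rule filterlim_compose[OF p_value_tendsto_0 sq_top])
  have "(\<lambda>n. sqrt (t n / L n) * sqrt (1 / L n)) \<longlonglongrightarrow> sqrt x * sqrt 0"
    by (intro tendsto_mult tendsto_real_sqrt lim) real_asymp
  moreover have "eventually (\<lambda>n. sqrt (t n / L n) * sqrt (1 / L n) = sqrt (t n) / L n) sequentially"
    using eventually_ge_at_top[of 2]
  proof eventually_elim
    case (elim n)
    then have "0 < L n" by simp
    then show ?case by (simp add: real_sqrt_divide)
  qed
  ultimately show sq: "(\<lambda>n. sqrt (t n) / L n) \<longlonglongrightarrow> 0"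
    using Lim_transform_eventually by fastforce
  have "(\<lambda>n. t n / L n + sqrt (t n) / L n) \<longlonglongrightarrow> x + 0" by (intro tendsto_add lim sq)
  then have "(\<lambda>n. (t n + sqrt (t n)) / L n) \<longlonglongrightarrow> x" by (simp add: add_divide_distrib)
  from tendsto_mult[OF tail_asymp[OF this x] tendsto_diff[OF tendsto_const[of 1] pv]]
  show ?c1 by (simp add: mult.assoc)
  have "eventually (\<lambda>n. 1 \<le> t n) sequentially"
    using t_top by (simp add: filterlim_at_top)
  then show ?c2
    using eventually_ge_at_top[of 2]
  proof eventually_elim
    case (elim n)
    have "sqrt (t n) \<le> sqrt ((t n)\<^sup>2)"
      using elim by (intro real_sqrt_le_mono) (auto simp: power2_eq_square)
    then have "sqrt (t n) \<le> t n" using elim by simp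
    then show ?case
      using t by (intro mixed_tail_bounds(1)[OF distribution_function_Gs[OF elim(2)], of _ _ 0]) auto
  qed
qed

lemma mixed_tail_asymp:
  assumes t: "\<And>n. 0 \<le> t n" and lim: "(\<lambda>n. t n / L n) \<longlonglongrightarrow> 1"
  shows "(\<lambda>n. real n powr (1 - \<beta>) * mixed_tail (Gs n) (t n))
    \<longlonglongrightarrow> 2 * C * r powr \<nu>"
proof (rule tendsto_sandwich)
  note lower = mixed_tail_lower[OF t lim zero_less_one]
  show "(\<lambda>n. real n powr (1 - \<beta>) * (tail (Gs n) (t n + sqrt (t n)) * (1 - p_value (sqrt (t n)))))
      \<longlonglongrightarrow> 2 * C * r powr \<nu>"
    using lower(4) by simp
  show "eventually (\<lambda>n. real n powr (1 - \<beta>) * (tail (Gs n) (t n + sqrt (t n)) * (1 - p_value (sqrt (t n))))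
      \<le> real n powr (1 - \<beta>) * mixed_tail (Gs n) (t n)) sequentially"
    using lower(5) by eventually_elim (simp add: mult_left_mono)
  \<comment> \<open>\<open>(1 - s)\<^sup>2 = 1 - \<beta> / 2\<close> lies strictly between
    \<open>1 - \<beta>\<close> and 1. The noise thus lifts effects below \<open>s * t\<close> over
    the threshold with probability about \<open>n powr (\<beta> / 2 - 1)\<close>, smaller than
    \<open>n powr (\<beta> - 1)\<close> by a power of \<open>n\<close>.\<close>
  define s where "s = 1 - sqrt (1 - \<beta> / 2)"
  have sq: "(1 - s)\<^sup>2 = 1 - \<beta> / 2" using \<beta> by (simp add: s_def)
  have s: "0 < s" "s < 1"
    using \<beta> real_sqrt_less_mono[of "1 - \<beta> / 2" 1] by (auto simp: s_def)
  have "(\<lambda>n. t n / L n - sqrt (t n) / L n) \<longlonglongrightarrow> 1 - 0" by (intro tendsto_diff lim lower(2))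
  then have "(\<lambda>n. (t n - sqrt (t n)) / L n) \<longlonglongrightarrow> 1" by (simp add: diff_divide_distrib)
  from tail_asymp[OF this]
  have 1: "(\<lambda>n. real n powr (1 - \<beta>) * tail (Gs n) (t n - sqrt (t n))) \<longlonglongrightarrow> 2 * C * r powr \<nu>" by simp
  \<comment> \<open>The effects of the middle range have mass of the same order as those beyond the
    threshold; only the vanishing factor \<open>p_value (sqrt (t n))\<close> makes them
    negligible.\<close>
  have "(\<lambda>n. s * (t n / L n)) \<longlonglongrightarrow> s * 1" by (intro tendsto_mult lim tendsto_const)
  then have "(\<lambda>n. (s * t n) / L n) \<longlonglongrightarrow> s" by simp
  from tendsto_mult[OF tail_asymp[OF this s(1)] lower(3)]
  have 2: "(\<lambda>n. real n powr (1 - \<beta>) * tail (Gs n) (s * t n) * p_value (sqrt (t n))) \<longlonglongrightarrow> 0" by simp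
  define w where "w n = (1 - \<beta>) - (1 - \<beta> / 2) * (t n / L n)\<^sup>2" for n
  have 3: "(\<lambda>n. real n powr (1 - \<beta>) * p_value ((1 - s) * t n)) \<longlonglongrightarrow> 0"
  proof (rule tendsto_sandwich[OF _ _ tendsto_const])
    show "eventually (\<lambda>n. 0 \<le> real n powr (1 - \<beta>) * p_value ((1 - s) * t n)) sequentially"
      using p_value_nonneg by (intro always_eventually) auto
    show "eventually (\<lambda>n. real n powr (1 - \<beta>) * p_value ((1 - s) * t n)
        \<le> 2 * exp (w n * ln (real n))) sequentially"
      using eventually_ge_at_top[of 2]
    proof eventually_elim
      case (elim n)
      have "(t n)\<^sup>2 / 2 = (t n / L n)\<^sup>2 * ln (real n)" using elim by (simp add: power_divide)
      then have e: "((1 - s) * t n)\<^sup>2 / 2 = (1 - \<beta> / 2) * (t n / L n)\<^sup>2 * ln (real n)"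
        using sq by (simp add: power_mult_distrib)
      have "real n powr (1 - \<beta>) * p_value ((1 - s) * t n) \<le> real n powr (1 - \<beta>) * (2 * exp (- ((1 - s) * t n)\<^sup>2 / 2))"
        by (intro mult_left_mono p_value_le_exp) simp
      also have "\<dots> = 2 * (exp ((1 - \<beta>) * ln (real n)) * exp (- ((1 - \<beta> / 2) * (t n / L n)\<^sup>2 * ln (real n))))"
        using elim e by (simp add: powr_def)
      also have "\<dots> = 2 * exp (w n * ln (real n))"
        by (simp add: exp_add[symmetric] w_def algebra_simps)
      finally show ?case .
    qed
    have "(\<lambda>n. w n) \<longlonglongrightarrow> (1 - \<beta>) - (1 - \<beta> / 2) * 1\<^sup>2"
      unfolding w_def by (intro tendsto_intros lim)
    from tendsto_minus[OF this]
    have "(\<lambda>n. - w n) \<longlonglongrightarrow> \<beta> / 2"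
      by (simp add: field_simps)
    then have "filterlim (\<lambda>n. - w n * ln (real n)) at_top sequentially"
      using \<beta> by (intro filterlim_tendsto_pos_mult_at_top) (auto, real_asymp)
    then have "filterlim (\<lambda>n. w n * ln (real n)) at_bot sequentially"
      unfolding filterlim_uminus_at_bot by (simp only: mult_minus_left)
    then have "(\<lambda>n. exp (w n * ln (real n))) \<longlonglongrightarrow> 0"
      by (rule filterlim_compose[OF exp_at_bot])
    then show "(\<lambda>n. 2 * exp (w n * ln (real n))) \<longlonglongrightarrow> 0"
      by (intro tendsto_mult_right_zero)
  qed
  from tendsto_add[OF tendsto_add[OF 1 2] 3]
  show "(\<lambda>n. real n powr (1 - \<beta>) * (tail (Gs n) (t n - sqrt (t n)) + tail (Gs n) (s * t n) * p_value (sqrt (t n)) + p_value ((1 - s) * t n)))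
    \<longlonglongrightarrow> 2 * C * r powr \<nu>" by (simp add: algebra_simps)
  have "eventually (\<lambda>n. 1 \<le> t n) sequentially"
    using lower(1) by (simp add: filterlim_at_top)
  then show "eventually (\<lambda>n. real n powr (1 - \<beta>) * mixed_tail (Gs n) (t n) \<le>
    real n powr (1 - \<beta>) * (tail (Gs n) (t n - sqrt (t n)) + tail (Gs n) (s * t n) * p_value (sqrt (t n)) + p_value ((1 - s) * t n))) sequentially"
    using eventually_ge_at_top[of 2]
  proof eventually_elim
    case (elim n)
    have "sqrt (t n) \<le> sqrt ((t n)\<^sup>2)"
      using elim by (intro real_sqrt_le_mono) (auto simp: power2_eq_square)
    then have "sqrt (t n) \<le> t n" using elim by simp
    then show ?case
      using t s by (intro mult_left_mono mixed_tail_bounds(2)[OF distribution_function_Gs[OF elim(2)]]) auto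
  qed
qed

end

section \<open>The max test and the critical sparsity level\<close>

definition trim_invariant :: "nat \<Rightarrow> real \<Rightarrow> (nat \<Rightarrow> real) set \<Rightarrow> bool" where
  "trim_invariant n \<tau> E \<longleftrightarrow> E \<in> sets (samples n) \<and>
    (\<forall>x\<in>space (samples n). (\<lambda>i\<in>{1..n}. trim \<tau> (x i)) \<in> E \<longleftrightarrow> x \<in> E)"

context heavy_tailed_effects
begin

text \<open>Null exceedances and large effects superpose: the expected number of exceedances tends
  to \<open>l + 2 * C * r powr \<nu>\<close> with \<open>l = - ln (1 - \<alpha>)\<close>, and the
  probability of none tends to the exponential of its negative.\<close>

lemma max_test_power_limit:
  assumes \<alpha>: "0 < \<alpha>" "\<alpha> < 1"
  shows "max_test_power Gs \<beta> \<alpha> \<longlonglongrightarrow> 1 - exp (- 2 * C * r powr \<nu> + ln (1 - \<alpha>))"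
proof -
  define l where "l = - ln (1 - \<alpha>)"
  have l: "0 < l" using \<alpha> by (simp add: l_def)
  \<comment> \<open>Chosen so that \<open>(1 - p_value (t n)) ^ n\<close> is exactly
    \<open>1 - \<alpha>\<close>, which makes \<open>t n\<close> the exact quantile for
    \<open>n \<ge> 1\<close>. Without \<open>max 1 n\<close> the required probability would be zero
    at \<open>n = 0\<close>.\<close>
  obtain t where t: "\<And>n. 0 \<le> t n" and pt: "\<And>n. p_value (t n) = 1 - exp (- l / real (max 1 n))"
    using p_value_threshold[of "\<lambda>n. 1 - exp (- l / real (max 1 n))"] l by auto
  have "(\<lambda>n. real n * (1 - exp (- l / real n))) \<longlonglongrightarrow> l"
    using l by real_asymp
  then have np: "(\<lambda>n. real n * p_value (t n)) \<longlonglongrightarrow> l"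
    by (rule Lim_transform_eventually)
       (auto intro!: eventually_mono[OF eventually_ge_at_top[of 1]] simp: pt max_def)
  have tL: "(\<lambda>n. t n / L n) \<longlonglongrightarrow> 1" by (rule threshold_asymp[OF t np l])
  define u where "u n = (1 - real n powr (- \<beta>)) * p_value (t n) + real n powr (- \<beta>) * mixed_tail (Gs n) (t n)" for n
  have J: "(\<lambda>n. real n powr (1 - \<beta>) * mixed_tail (Gs n) (t n)) \<longlonglongrightarrow> 2 * C * r powr \<nu>"
    by (rule mixed_tail_asymp[OF t tL])
  have "(\<lambda>n. 1 - real n powr (- \<beta>)) \<longlonglongrightarrow> 1" using \<beta> by real_asymp
  from tendsto_add[OF tendsto_mult[OF this np] J]
  have "(\<lambda>n. (1 - real n powr (- \<beta>)) * (real n * p_value (t n)) + real n powr (1 - \<beta>) * mixed_tail (Gs n) (t n))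
    \<longlonglongrightarrow> l + 2 * C * r powr \<nu>" by simp
  then have nu: "(\<lambda>n. real n * u n) \<longlonglongrightarrow> l + 2 * C * r powr \<nu>"
  proof (rule Lim_transform_eventually)
    show "eventually (\<lambda>n. (1 - real n powr (- \<beta>)) * (real n * p_value (t n)) + real n powr (1 - \<beta>) * mixed_tail (Gs n) (t n) = real n * u n) sequentially"
      using eventually_ge_at_top[of 1]
    proof eventually_elim
      case (elim n)
      have "real n powr (1 - \<beta>) = real n * real n powr (- \<beta>)" using elim by (simp add: powr_diff powr_minus field_simps)
      then show ?case by (simp add: u_def algebra_simps)
    qed
  qed
  have u_eq: "measure (marginal \<beta> n) {z. t n < \<bar>z\<bar>} = u n" if "2 \<le> n" for n
    using that sparsity_range[of n \<beta>] \<beta> t[of n]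
    by (subst measure_mixture_law[OF _ distribution_function_Gs]) (auto simp: u_def mixed_tail_def measure_normal_law_abs)
  have "eventually (\<lambda>n. 0 \<le> u n) sequentially"
    using eventually_ge_at_top[of 2] by eventually_elim (simp flip: u_eq)
  from tendsto_diff[OF tendsto_const[of 1] tendsto_one_minus_power[OF nu this]]
  have "(\<lambda>n. 1 - (1 - u n) ^ n) \<longlonglongrightarrow> 1 - exp (- 2 * C * r powr \<nu> + ln (1 - \<alpha>))"
    by (simp add: l_def algebra_simps)
  then show ?thesis
  proof (rule Lim_transform_eventually)
    show "eventually (\<lambda>n. 1 - (1 - u n) ^ n = max_test_power Gs \<beta> \<alpha> n) sequentially"
      using eventually_ge_at_top[of 2]
    proof eventually_elim
      case (elim n)
      have "(1 - p_value (t n)) ^ n = exp (- l / real n) ^ n" using elim by (simp add: pt max_def)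
      also have "\<dots> = exp (- l)" using elim by (simp add: exp_of_nat_mult[symmetric])
      also have "\<dots> = 1 - \<alpha>" using \<alpha> by (simp add: l_def)
      finally have q: "quantile (H0 n) (max_stat n) (1 - \<alpha>) = t n"
        using elim \<alpha> by (intro quantile_max_stat t) auto
      have "prob_space (marginal \<beta> n)"
        using elim \<beta> by (intro prob_space_marginal) auto
      then show ?case
        unfolding max_test_power_def rejection_prob_def q
        using elim \<beta> by (subst (1 2) H1_Gs_eq) (auto simp: max_stat_prob(3) u_eq simp del: One_nat_def)
    qed
  qed
qed

lemma tv_dist_tendsto_1:
  assumes b: "0 \<le> b" "b < \<beta>"
  shows "(\<lambda>n. tv_dist (H0 n) (H1 Gs b n)) \<longlonglongrightarrow> 1"
proof -
  \<comment> \<open>The factor exceeds 1, so the null puts at most \<open>2 / n\<close> observations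
    in expectation beyond \<open>t\<close>, while the number of effects beyond it is still of order
    \<open>n powr (\<beta> - b)\<close> and tends to infinity. The event that the maximum exceeds
    \<open>t\<close> separates the two laws.\<close>
  define t where "t n = sqrt 2 * L n" for n
  have t: "0 \<le> t n" for n
    by (cases "n = 0") (auto simp: t_def)
  have tL: "(\<lambda>n. t n / L n) \<longlonglongrightarrow> sqrt 2"
    by (intro tendsto_eventually eventually_mono[OF eventually_ge_at_top[of 2]]) (simp add: t_def)
  define u where "u n = measure (marginal b n) {z. t n < \<bar>z\<bar>}" for n
  note lower = mixed_tail_lower[OF t tL, simplified]
  let ?T = "\<lambda>n. tail (Gs n) (t n + sqrt (t n)) * (1 - p_value (sqrt (t n)))"
  have "filterlim (\<lambda>n. real n powr (\<beta> - b)) at_top sequentially"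
    using b by real_asymp
  moreover have "0 < 2 * C * (r / sqrt 2) powr \<nu>" using C r by simp
  ultimately have big: "filterlim (\<lambda>n. (real n powr (1 - \<beta>) * ?T n) * real n powr (\<beta> - b)) at_top sequentially"
    using lower(4) by (intro filterlim_tendsto_pos_mult_at_top[OF lower(4)]) auto
  have nu: "filterlim (\<lambda>n. real n * u n) at_top sequentially"
  proof (rule filterlim_at_top_mono[OF big])
    show "eventually (\<lambda>n. (real n powr (1 - \<beta>) * ?T n) * real n powr (\<beta> - b) \<le> real n * u n) sequentially"
      using lower(5) eventually_ge_at_top[of 2]
    proof eventually_elim
      case (elim n)
      have "real n powr (- b) * ?T n \<le> real n powr (- b) * mixed_tail (Gs n) (t n)"
        using elim by (intro mult_left_mono) auto
      also have "\<dots> \<le> u n"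
        unfolding u_def using elim sparsity_range[of n b] b
        by (subst measure_mixture_law[OF _ distribution_function_Gs]) (auto simp: mixed_tail_def)
      finally have "real n * (real n powr (- b) * ?T n) \<le> real n * u n" by (intro mult_left_mono) auto
      moreover have "(real n powr (1 - \<beta>) * ?T n) * real n powr (\<beta> - b) = real n * (real n powr (- b) * ?T n)"
      proof -
        have "real n powr (1 - \<beta>) * real n powr (\<beta> - b) = real n * real n powr (- b)"
          using elim by (simp add: powr_add[symmetric] powr_mult_base)
        then show ?thesis by (metis mult.assoc mult.commute)
      qed
      ultimately show ?case by (simp only:)
    qed
  qed
  have H1lim: "(\<lambda>n. (1 - u n) ^ n) \<longlonglongrightarrow> 0"
  proof (rule tendsto_sandwich[OF _ _ tendsto_const])
    have u01: "0 \<le> u n \<and> u n \<le> 1" if "2 \<le> n" for n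
    proof -
      interpret prob_space "marginal b n"
        using that b by (intro prob_space_marginal)
      show ?thesis by (auto simp: u_def)
    qed
    show "eventually (\<lambda>n. 0 \<le> (1 - u n) ^ n) sequentially"
      using eventually_ge_at_top[of 2] by eventually_elim (use u01 in auto)
    show "eventually (\<lambda>n. (1 - u n) ^ n \<le> exp (- (real n * u n))) sequentially"
      using eventually_ge_at_top[of 2]
    proof eventually_elim
      case (elim n)
      have "(1 - u n) ^ n \<le> exp (- u n) ^ n"
        using u01[OF elim] exp_ge_add_one_self[of "- u n"] by (intro power_mono) auto
      then show ?case by (simp add: exp_of_nat_mult[symmetric])
    qed
    show "(\<lambda>n. exp (- (real n * u n))) \<longlonglongrightarrow> 0"
      by (rule filterlim_compose[OF exp_at_bot]) (use nu in \<open>simp add: filterlim_uminus_at_bot\<close>)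
  qed
  have "(\<lambda>n. real n * p_value (t n)) \<longlonglongrightarrow> 0"
  proof (rule tendsto_sandwich[OF _ _ tendsto_const])
    show "eventually (\<lambda>n. 0 \<le> real n * p_value (t n)) sequentially"
      using p_value_nonneg by (intro always_eventually) auto
    show "eventually (\<lambda>n. real n * p_value (t n) \<le> real n * (2 * exp (- 2 * ln (real n)))) sequentially"
      using eventually_ge_at_top[of 2]
    proof eventually_elim
      case (elim n)
      have "(t n)\<^sup>2 / 2 = 2 * ln (real n)" using elim by (simp add: t_def power_mult_distrib)
      then show ?case using p_value_le_exp[of "t n"] by (intro mult_left_mono) auto
    qed
    show "(\<lambda>n. real n * (2 * exp (- 2 * ln (real n)))) \<longlonglongrightarrow> 0" by real_asymp
  qed
  from tendsto_one_minus_power[OF this] p_value_nonneg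
  have H0lim: "(\<lambda>n. (1 - p_value (t n)) ^ n) \<longlonglongrightarrow> 1" by simp
  show ?thesis
  proof (rule tendsto_sandwich[OF _ _ _ tendsto_const])
    from tendsto_diff[OF H0lim H1lim]
    show "(\<lambda>n. (1 - p_value (t n)) ^ n - (1 - u n) ^ n) \<longlonglongrightarrow> 1" by simp
    show "eventually (\<lambda>n. tv_dist (H0 n) (H1 Gs b n) \<le> 1) sequentially"
      using eventually_ge_at_top[of 2]
      by eventually_elim (use b in \<open>auto intro!: tv_dist_bounds(3) prob_space_H0 prob_space_H1\<close>)
    show "eventually (\<lambda>n. (1 - p_value (t n)) ^ n - (1 - u n) ^ n \<le> tv_dist (H0 n) (H1 Gs b n)) sequentially"
      using eventually_ge_at_top[of 2]
    proof eventually_elim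
      case (elim n)
      let ?E = "{x \<in> space (H0 n). t n < max_stat n x}"
      have sp: "space (H1 Gs b n) = space (H0 n)"
        using sets_eq_imp_space_eq[of "H1 Gs b n" "H0 n"] sets_H0 sets_H1 elim b by simp
      have E: "?E \<in> sets (H0 n)"
        unfolding sets_H0 unfolding H0_eq_PiM using elim
        by (intro max_stat_prob(2)) (auto simp: prob_space_normal_law)
      have "measure (H0 n) ?E = 1 - (1 - p_value (t n)) ^ n"
        unfolding H0_eq_PiM using elim t
        by (subst max_stat_prob(3)) (auto simp: prob_space_normal_law measure_normal_law_abs)
      moreover have "measure (H1 Gs b n) ?E = 1 - (1 - u n) ^ n"
        unfolding sp[symmetric] using elim b prob_space_marginal[OF elim b(1)]
        by (subst (1 2) H1_Gs_eq) (auto simp: max_stat_prob(3) u_def simp del: One_nat_def)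
      moreover have "\<bar>measure (H0 n) ?E - measure (H1 Gs b n) ?E\<bar> \<le> tv_dist (H0 n) (H1 Gs b n)"
        using elim b by (intro tv_dist_bounds(1) prob_space_H0 prob_space_H1 E) auto
      ultimately show ?case by simp
    qed
  qed
qed

text \<open>The error \<open>e\<close> is the same for all invariant events. This uniformity is what
  a bound on the total variation distance and events with a data-independent but unknown critical
  value require.\<close>

lemma trimmed_tv_tendsto_0:
  assumes b: "\<beta> \<le> b" "b \<le> 1" and \<tau>: "\<And>n. 0 \<le> \<tau> n"
    and lim: "(\<lambda>n. real n powr (2 * (\<beta> - b)) / (real n * p_value (\<tau> n))) \<longlonglongrightarrow> 0"
  shows "\<exists>e. e \<longlonglongrightarrow> 0 \<and> (\<forall>n E. 2 \<le> n \<longrightarrow> trim_invariant n (\<tau> n) E \<longrightarrow>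
    \<bar>measure (H1 Gs b n) E - measure (H0 n) E\<bar> \<le> e n)"
proof -
  \<comment> \<open>With this cutoff \<open>exp ((a n)\<^sup>2)\<close> is
    \<open>n powr (b - 1 / 2)\<close>. Times \<open>n\<close> and the squared sparsity it gives
    \<open>n powr (1 / 2 - b)\<close>, which vanishes because
    \<open>b \<ge> \<beta> > 1 / 2\<close>.\<close>
  define s where "s = sqrt ((b - 1 / 2) / 2)"
  have s: "0 < s" "s\<^sup>2 = (b - 1 / 2) / 2" using b \<beta> by (auto simp: s_def)
  define a where "a n = s * L n" for n
  have a: "0 \<le> a n" for n using s by (cases "n = 0") (auto simp: a_def)
  have aL: "(\<lambda>n. a n / L n) \<longlonglongrightarrow> s"
    by (intro tendsto_eventually eventually_mono[OF eventually_ge_at_top[of 2]]) (simp add: a_def)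
  define D where "D n = measure (interval_measure (Gs n)) {m. a n < \<bar>m\<bar>}" for n
  define c where "c n = 3 * (real n powr (- b))\<^sup>2 * (1 + exp ((a n)\<^sup>2) + 5 * (D n)\<^sup>2 / p_value (\<tau> n))" for n
  let ?T = "\<lambda>n. real n powr (1 - \<beta>) * tail (Gs n) (a n)"
  \<comment> \<open>The summands come from the constant, from effects at most \<open>a n\<close>,
    and from the envelope. In the last one the squared mass of large effects, of order
    \<open>n powr (2 * \<beta> - 2)\<close>, produces the ratio assumed to vanish.\<close>
  let ?d = "\<lambda>n. 3 * real n powr (1 - 2 * b) + 3 * real n powr (1 / 2 - b) +
      15 * ((?T n)\<^sup>2 * (real n powr (2 * (\<beta> - b)) / (real n * p_value (\<tau> n))))"
  have "(\<lambda>n. real n * c n) \<longlonglongrightarrow> 0"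
  proof (rule tendsto_sandwich[OF _ _ tendsto_const])
    show "eventually (\<lambda>n. 0 \<le> real n * c n) sequentially"
      using p_value_nonneg by (intro always_eventually) (auto simp: c_def intro!: mult_nonneg_nonneg add_nonneg_nonneg divide_nonneg_nonneg)
    show "eventually (\<lambda>n. real n * c n \<le> ?d n) sequentially"
      using eventually_ge_at_top[of 2]
    proof eventually_elim
      case (elim n)
      have p: "0 < p_value (\<tau> n)" by (rule p_value_pos)
      have "D n \<le> tail (Gs n) (a n)"
        unfolding D_def by (rule tail_bounds(1)[OF distribution_function_Gs[OF elim] a])
      then have D: "(D n)\<^sup>2 \<le> (tail (Gs n) (a n))\<^sup>2" by (intro power_mono) (auto simp: D_def)
      have "(a n)\<^sup>2 = (b - 1 / 2) * ln (real n)"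
        using elim s(2) by (simp add: a_def power_mult_distrib)
      then have ea: "exp ((a n)\<^sup>2) = real n powr (b - 1 / 2)" using elim by (simp add: powr_def)
      have n2: "real n * (real n powr (- b))\<^sup>2 = real n powr (1 - 2 * b)"
        using elim by (simp add: power2_eq_square powr_add[symmetric] powr_mult_base)
      have "real n * c n = 3 * real n powr (1 - 2 * b) * (1 + exp ((a n)\<^sup>2) + 5 * (D n)\<^sup>2 / p_value (\<tau> n))"
        by (simp add: c_def n2[symmetric])
      also have "\<dots> \<le> 3 * real n powr (1 - 2 * b) * (1 + exp ((a n)\<^sup>2) + 5 * (tail (Gs n) (a n))\<^sup>2 / p_value (\<tau> n))"
        using D p by (intro mult_left_mono add_left_mono divide_right_mono) auto
      also have "\<dots> = 3 * real n powr (1 - 2 * b) + 3 * (real n powr (1 - 2 * b) * real n powr (b - 1 / 2))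
         + 15 * (real n powr (1 - 2 * b) * (tail (Gs n) (a n))\<^sup>2 / p_value (\<tau> n))"
        by (simp add: ea algebra_simps)
      also have "real n powr (1 - 2 * b) * real n powr (b - 1 / 2) = real n powr (1 / 2 - b)"
        by (simp add: powr_add[symmetric])
      also have "real n powr (1 - 2 * b) * (tail (Gs n) (a n))\<^sup>2 / p_value (\<tau> n)
        = (?T n)\<^sup>2 * (real n powr (2 * (\<beta> - b)) / (real n * p_value (\<tau> n)))"
      proof -
        have "(real n powr (1 - \<beta>))\<^sup>2 * real n powr (2 * (\<beta> - b)) = real n powr (1 + (1 - 2 * b))"
          by (simp add: power2_eq_square powr_add[symmetric] algebra_simps)
        also have "\<dots> = real n * real n powr (1 - 2 * b)"
          using elim by (subst powr_add) simp
        finally have "real n powr (1 - 2 * b) = (real n powr (1 - \<beta>))\<^sup>2 * real n powr (2 * (\<beta> - b)) / real n"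
          using elim by simp
        then show ?thesis by (simp add: power_mult_distrib)
      qed
      finally show ?case .
    qed
    have "(\<lambda>n. 3 * real n powr (1 - 2 * b)) \<longlonglongrightarrow> 0" using b \<beta> by real_asymp
    moreover have "(\<lambda>n. 3 * real n powr (1 / 2 - b)) \<longlonglongrightarrow> 0" using b \<beta> by real_asymp
    moreover have "(\<lambda>n. (?T n)\<^sup>2 * (real n powr (2 * (\<beta> - b)) / (real n * p_value (\<tau> n))))
        \<longlonglongrightarrow> (2 * C * (r / s) powr \<nu>)\<^sup>2 * 0"
      by (intro tendsto_mult tendsto_power tail_asymp aL s lim)
    ultimately have "?d \<longlonglongrightarrow> 0 + 0 + 15 * ((2 * C * (r / s) powr \<nu>)\<^sup>2 * 0)"
      by (intro tendsto_add tendsto_mult[OF tendsto_const])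
    then show "?d \<longlonglongrightarrow> 0" by simp
  qed
  then have lim0: "(\<lambda>n. sqrt (exp (real n * c n) - 1)) \<longlonglongrightarrow> 0" by (rule sqrt_exp_minus_one_tendsto_0)
  show ?thesis
  proof (intro exI conjI allI impI, rule lim0)
    fix n E
    assume n: "2 \<le> n" and "trim_invariant n (\<tau> n) E"
    then have E: "E \<in> sets (samples n)"
      and inv: "\<And>x. x \<in> space (samples n) \<Longrightarrow> (\<lambda>i\<in>{1..n}. trim (\<tau> n) (x i)) \<in> E \<longleftrightarrow> x \<in> E"
      by (auto simp: trim_invariant_def)
    have b0: "0 \<le> b" using b \<beta> by simp
    show "\<bar>measure (H1 Gs b n) E - measure (H0 n) E\<bar> \<le> sqrt (exp (real n * c n) - 1)"
    proof -
      have "\<bar>measure (\<Pi>\<^sub>M i\<in>{1..n}. marginal b n) E - measure (\<Pi>\<^sub>M i\<in>{1..n}. N01) E\<bar>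
        \<le> sqrt (exp (card {1..n} * (3 * (real n powr (- b))\<^sup>2 * (1 + exp ((a n)\<^sup>2) +
          5 * (measure (interval_measure (Gs n)) {m. a n < \<bar>m\<bar>})\<^sup>2 / p_value (\<tau> n)))) - 1)"
        using n b0 by (intro trimmed_prob_diff_le sparsity_range distribution_function_Gs \<tau> a E inv) auto
      then show ?thesis by (simp add: H1_Gs_eq[OF n b0] H0_eq_PiM c_def D_def del: One_nat_def)
    qed
  qed
qed

lemma tv_dist_tendsto_0:
  assumes b: "\<beta> < b" "b \<le> 1"
  shows "(\<lambda>n. tv_dist (H0 n) (H1 Gs b n)) \<longlonglongrightarrow> 0"
proof -
  have b0: "0 \<le> b" using b \<beta> by simp
  \<comment> \<open>This null tail probability makes the expected number of trimmed null
    observations \<open>n powr (\<beta> - b)\<close>. It tends to zero, yet dominates its own square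
    \<open>n powr (2 * (\<beta> - b))\<close>, as the chi-square bound demands.\<close>
  have "real (max 1 n) powr (\<beta> - b - 1) \<le> 1" for n
    using b powr_mono[of "\<beta> - b - 1" 0 "real (max 1 n)"] by simp
  then obtain \<tau> where \<tau>: "\<And>n. 0 \<le> \<tau> n" and p\<tau>: "\<And>n. p_value (\<tau> n) = real (max 1 n) powr (\<beta> - b - 1)"
    using p_value_threshold[of "\<lambda>n. real (max 1 n) powr (\<beta> - b - 1)"] by auto
  have np: "real n * p_value (\<tau> n) = real n powr (\<beta> - b)" if "1 \<le> n" for n
    using that by (simp add: p\<tau> max_def powr_mult_base)
  have lim1: "(\<lambda>n. real n powr (\<beta> - b)) \<longlonglongrightarrow> 0" using b by real_asymp
  then have lim2: "(\<lambda>n. real n powr (2 * (\<beta> - b)) / (real n * p_value (\<tau> n))) \<longlonglongrightarrow> 0"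
    by (rule Lim_transform_eventually)
       (auto intro!: eventually_mono[OF eventually_ge_at_top[of 1]] simp: np powr_diff[symmetric])
  obtain e where e: "e \<longlonglongrightarrow> 0"
    and inv: "\<And>n E. 2 \<le> n \<Longrightarrow> trim_invariant n (\<tau> n) E \<Longrightarrow>
      \<bar>measure (H1 Gs b n) E - measure (H0 n) E\<bar> \<le> e n"
    using trimmed_tv_tendsto_0[OF less_imp_le[OF b(1)] b(2) \<tau> lim2] by blast
  show ?thesis
  proof (rule tendsto_sandwich[OF _ _ tendsto_const])
    show "eventually (\<lambda>n. 0 \<le> tv_dist (H0 n) (H1 Gs b n)) sequentially"
      using eventually_ge_at_top[of 2]
      by eventually_elim (use b0 in \<open>auto intro!: tv_dist_bounds(2) prob_space_H0 prob_space_H1\<close>)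
    show "(\<lambda>n. 2 * e n + 2 * real n powr (\<beta> - b)) \<longlonglongrightarrow> 0"
      using tendsto_add[OF tendsto_mult[OF tendsto_const e] tendsto_mult[OF tendsto_const lim1], of 2 2] by simp
    show "eventually (\<lambda>n. tv_dist (H0 n) (H1 Gs b n) \<le> 2 * e n + 2 * real n powr (\<beta> - b)) sequentially"
      using eventually_ge_at_top[of 2]
    proof eventually_elim
      case (elim n)
      interpret P0: prob_space "H0 n" by (rule prob_space_H0)
      interpret P1: prob_space "H1 Gs b n" using elim b0 by (intro prob_space_H1)
      have s1: "sets (H1 Gs b n) = sets (samples n)" using elim b0 by (intro sets_H1)
      have sp: "space (samples n) = space (H0 n)"
        by (rule sets_eq_imp_space_eq[OF sets_H0[symmetric]])
      let ?S = "{x \<in> space (H0 n). \<tau> n < max_stat n x}"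
      have max_le: "max_stat n x \<le> y \<longleftrightarrow> (\<forall>i\<in>{1..n}. \<bar>x i\<bar> \<le> y)" for x y
        using elim by (intro max_stat_le_iff) auto
      have S: "?S \<in> sets (samples n)"
        unfolding H0_eq_PiM using elim by (intro max_stat_prob(2)) (auto simp: prob_space_normal_law)
      have tspace: "(\<lambda>i\<in>{1..n}. trim (\<tau> n) (x i)) \<in> space (H0 n)" for x
        unfolding sp[symmetric] by (auto simp: space_PiM)
      have tri: "\<bar>trim (\<tau> n) y\<bar> \<le> \<tau> n \<longleftrightarrow> \<bar>y\<bar> \<le> \<tau> n" for y using \<tau>[of n] by (auto simp: trim_def)
      have trm: "max_stat n (\<lambda>i\<in>{1..n}. trim (\<tau> n) (x i)) \<le> \<tau> n \<longleftrightarrow> max_stat n x \<le> \<tau> n" for x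
        by (simp add: max_le tri)
      have trx: "(\<lambda>i\<in>{1..n}. trim (\<tau> n) (x i)) = x" if "x \<in> space (H0 n)" "max_stat n x \<le> \<tau> n" for x
        using that unfolding sp[symmetric] max_le by (auto simp: space_PiM trim_def fun_eq_iff PiE_iff extensional_def restrict_def)
      have m0S: "measure (H0 n) ?S \<le> real n powr (\<beta> - b)"
      proof -
        have "measure (H0 n) ?S = 1 - (1 - p_value (\<tau> n)) ^ n"
          unfolding H0_eq_PiM using elim \<tau>
          by (subst max_stat_prob(3)) (auto simp: prob_space_normal_law measure_normal_law_abs)
        also have "\<dots> \<le> real n * p_value (\<tau> n)"
          using Bernoulli_inequality[of "- p_value (\<tau> n)" n] p_value_le_1[of "\<tau> n"] by simp
        finally show ?thesis using elim by (simp add: np)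
      qed
      \<comment> \<open>Whether anything is trimmed can be read off from the trimmed sample. So
        \<open>?S\<close>, rare under the null, is rare under the alternative as well.\<close>
      have dS: "\<bar>measure (H1 Gs b n) ?S - measure (H0 n) ?S\<bar> \<le> e n"
        using elim S trm tspace by (intro inv) (auto simp: trim_invariant_def sp not_le[symmetric] simp del: One_nat_def)
      show ?case
      proof (rule tv_dist_bounds(4)[OF P0.prob_space_axioms P1.prob_space_axioms])
        fix A assume "A \<in> sets (H0 n)"
        then have A: "A \<in> sets (samples n)" by (simp add: sets_H0)
        \<comment> \<open>Off \<open>?S\<close> trimming is the identity, so any measurable event
          becomes invariant after removing \<open>?S\<close>.\<close>
        have d: "\<bar>measure (H1 Gs b n) (A - ?S) - measure (H0 n) (A - ?S)\<bar> \<le> e n"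
        proof (rule inv[OF elim], unfold trim_invariant_def, intro conjI ballI)
          show "A - ?S \<in> sets (samples n)" using A S by auto
          fix x assume "x \<in> space (samples n)"
          then have x: "x \<in> space (H0 n)" by (simp only: sp)
          show "(\<lambda>i\<in>{1..n}. trim (\<tau> n) (x i)) \<in> A - ?S \<longleftrightarrow> x \<in> A - ?S"
            using x tspace[of x] trm[of x] trx[of x] by (auto simp: not_le[symmetric] simp del: One_nat_def)
        qed
        have "measure (H0 n) A = measure (H0 n) (A - ?S) + measure (H0 n) (A \<inter> ?S)"
          using A S by (subst P0.finite_measure_Union[symmetric]) (auto simp: sets_H0 intro!: arg_cong[where f="measure _"])
        moreover have "measure (H1 Gs b n) A = measure (H1 Gs b n) (A - ?S) + measure (H1 Gs b n) (A \<inter> ?S)"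
          using A S by (subst P1.finite_measure_Union[symmetric]) (auto simp: s1 intro!: arg_cong[where f="measure _"])
        moreover have "measure (H0 n) (A \<inter> ?S) \<le> measure (H0 n) ?S"
          using S by (intro P0.finite_measure_mono) (auto simp: sets_H0)
        moreover have "measure (H1 Gs b n) (A \<inter> ?S) \<le> measure (H1 Gs b n) ?S"
          using S by (intro P1.finite_measure_mono) (auto simp: s1)
        ultimately show "\<bar>measure (H0 n) A - measure (H1 Gs b n) A\<bar> \<le> 2 * e n + 2 * real n powr (\<beta> - b)"
          using d dS m0S measure_nonneg[of "H0 n" "A \<inter> ?S"] measure_nonneg[of "H1 Gs b n" "A \<inter> ?S"]
            measure_nonneg[of "H0 n" ?S] by linarith
      qed
    qed
  qed
qed

text \<open>The limits are known for every \<open>b\<close> other than \<beta> and exclude each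
  other. Hence the two sets of levels contain everything on their side of \<beta> and nothing beyond
  it, whatever happens at \<beta>.\<close>

lemma critical_sparsity_level: "is_critical_sparsity_level Gs \<beta>"
proof -
  let ?S1 = "{b \<in> {0..1}. (\<lambda>n. tv_dist (H0 n) (H1 Gs b n)) \<longlonglongrightarrow> 1}"
  let ?S0 = "{b \<in> {0..1}. (\<lambda>n. tv_dist (H0 n) (H1 Gs b n)) \<longlonglongrightarrow> 0}"
  have sub1: "b \<in> ?S1" if "0 \<le> b" "b < \<beta>" for b
    using that tv_dist_tendsto_1[of b] \<beta> by auto
  have sub0: "b \<in> ?S0" if "\<beta> < b" "b \<le> 1" for b
    using that tv_dist_tendsto_0[of b] \<beta> by auto
  have disj: "b \<notin> ?S0" if "b \<in> ?S1" for b
    using that LIMSEQ_unique[of "\<lambda>n. tv_dist (H0 n) (H1 Gs b n)" 0 1] by auto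
  have S1: "?S1 \<subseteq> {..\<beta>}" using sub0 disj by (force simp: not_le[symmetric])
  have S0: "?S0 \<subseteq> {\<beta>..}" using sub1 disj by (force simp: not_le[symmetric])
  have "0 \<in> ?S1" "1 \<in> ?S0" using \<beta> by (intro sub1 sub0; simp)+
  then have ne: "?S1 \<noteq> {}" "?S0 \<noteq> {}" by blast+
  have "Sup ?S1 = \<beta>"
  proof (rule cSup_eq_non_empty[OF ne(1)])
    show "b \<le> \<beta>" if "b \<in> ?S1" for b using S1 that by auto
    show "\<beta> \<le> y" if "\<And>b. b \<in> ?S1 \<Longrightarrow> b \<le> y" for y
    proof (rule dense_le_bounded[of 0])
      show "b \<le> y" if "0 < b" "b < \<beta>" for b using sub1[of b] that \<open>\<And>b. b \<in> ?S1 \<Longrightarrow> b \<le> y\<close> by auto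
    qed (use \<beta> in auto)
  qed
  moreover have "Inf ?S0 = \<beta>"
  proof (rule cInf_eq_non_empty[OF ne(2)])
    show "\<beta> \<le> b" if "b \<in> ?S0" for b using S0 that by auto
    show "y \<le> \<beta>" if "\<And>b. b \<in> ?S0 \<Longrightarrow> y \<le> b" for y
    proof (rule dense_ge_bounded[of \<beta> 1])
      show "y \<le> b" if "\<beta> < b" "b < 1" for b using sub0[of b] that \<open>\<And>b. b \<in> ?S0 \<Longrightarrow> y \<le> b\<close> by auto
    qed (use \<beta> in auto)
  qed
  ultimately show ?thesis
    by (simp only: is_critical_sparsity_level_def lower_critical_level_def upper_critical_level_def Let_def ne if_False simp_thms)
qed

end

section \<open>Modified higher criticism\<close>

text \<open>For a statistic with atoms the level \<open>q\<close> lies between the strict and the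
  weak distribution function at the quantile; both bounds are needed to control the size of the
  test. The last claim makes the critical values diverge.\<close>

lemma quantile_properties:
  assumes P: "prob_space P" and T[measurable]: "T \<in> borel_measurable P" and q: "0 < q" "q < 1"
  shows "q \<le> measure P {\<omega> \<in> space P. T \<omega> \<le> quantile P T q}" (is ?c1)
    and "measure P {\<omega> \<in> space P. T \<omega> < quantile P T q} \<le> q" (is ?c2)
    and "\<And>x. measure P {\<omega> \<in> space P. T \<omega> \<le> x} < q \<Longrightarrow> x \<le> quantile P T q"
proof -
  interpret P: prob_space P by fact
  interpret D: real_distribution "distr P borel T" using T by (rule P.real_distribution_distr)
  define F where "F = cdf (distr P borel T)"
  have F: "measure P {\<omega> \<in> space P. T \<omega> \<le> x} = F x" for x
    by (simp add: F_def cdf_def2 measure_distr vimage_def Int_def conj_commute)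
  have Fl: "measure P {\<omega> \<in> space P. T \<omega> < x} = measure (distr P borel T) {..<x}" for x
    by (simp add: measure_distr vimage_def Int_def conj_commute)
  let ?S = "{x. q \<le> F x}"
  have Q: "quantile P T q = Inf ?S" by (simp add: quantile_def F)
  have mono: "x \<le> y \<Longrightarrow> F x \<le> F y" for x y unfolding F_def by (rule D.cdf_nondecreasing)
  have "eventually (\<lambda>x. q < F x) at_top"
    using D.cdf_lim_at_top_prob q unfolding F_def by (intro order_tendstoD) auto
  then obtain u where "q < F u" by (metis eventually_happens trivial_limit_at_top_linorder)
  then have ne: "?S \<noteq> {}" by (auto intro: exI[of _ u])
  have below: "x \<le> y" if "F x < q" "y \<in> ?S" for x y
    using that mono[of y x] by (metis leD le_less_trans linear mem_Collect_eq)
  have "eventually (\<lambda>x. F x < q) at_bot"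
    using D.cdf_lim_at_bot q unfolding F_def by (intro order_tendstoD) auto
  then obtain l where "F l < q" by (metis eventually_happens trivial_limit_at_bot_linorder)
  then have bdd: "bdd_below ?S" using below by (intro bdd_belowI[of _ l]) auto
  have c: "x \<le> Inf ?S" if "F x < q" for x
    using below[OF that] by (intro cInf_greatest ne) auto
  then show "\<And>x. measure P {\<omega> \<in> space P. T \<omega> \<le> x} < q \<Longrightarrow> x \<le> quantile P T q"
    by (simp add: F Q)
  show ?c1
  proof (rule ccontr)
    assume "\<not> ?thesis"
    then have "F (Inf ?S) < q" by (simp add: F Q)
    then have "eventually (\<lambda>x. F x < q) (at_right (Inf ?S))"
      using D.cdf_is_right_cont[of "Inf ?S"] unfolding F_def continuous_within
      by (intro order_tendstoD) auto
    then have "eventually (\<lambda>x. F x < q \<and> Inf ?S < x) (at_right (Inf ?S))"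
      by (intro eventually_conj eventually_at_right_less)
    then obtain x where "F x < q" "Inf ?S < x"
      by (metis (mono_tags, lifting) eventually_happens trivial_limit_at_right_real)
    then show False using c[of x] by simp
  qed
  have "(F \<longlongrightarrow> measure (distr P borel T) {..<Inf ?S}) (at_left (Inf ?S))"
    unfolding F_def by (rule D.cdf_at_left)
  moreover have "eventually (\<lambda>x. F x \<le> q) (at_left (Inf ?S))"
  proof (rule eventually_mono)
    show "eventually (\<lambda>x. x < Inf ?S) (at_left (Inf ?S))" by (simp add: eventually_at_filter)
    fix x assume "x < Inf ?S"
    then have "x \<notin> ?S" using cInf_lower[OF _ bdd] by (meson leD)
    then show "F x \<le> q" by simp
  qed
  ultimately have "measure (distr P borel T) {..<Inf ?S} \<le> q"
    by (rule tendsto_upperbound) simp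
  then show ?c2
    by (simp add: Fl Q)
qed

section \<open>Exceedance events of the higher criticism process\<close>

definition hc :: "nat \<Rightarrow> (nat \<Rightarrow> real) \<Rightarrow> real \<Rightarrow> real" where
  "hc n x t = sqrt (real n) * (p_value_ecdf n x t - t) / sqrt (t * (1 - t))"

lemma mHC_stat_eq: "mHC_stat n x = (SUP t\<in>{1 / real n..1 / 2}. hc n x t)"
  by (simp add: mHC_stat_def hc_def)

lemma p_value_ecdf_count: "p_value_ecdf n x t = card {i\<in>{1..n}. p_value (x i) \<le> t} / real n"
  by (simp add: p_value_ecdf_def of_bool_def sum.If_cases Int_def)

lemma p_value_ecdf_mono: "s \<le> t \<Longrightarrow> p_value_ecdf n x s \<le> p_value_ecdf n x t"
  unfolding p_value_ecdf_count by (intro divide_right_mono) (auto intro!: card_mono)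

lemma p_value_ecdf_le_1: "p_value_ecdf n x t \<le> 1"
proof -
  have "card {i\<in>{1..n}. p_value (x i) \<le> t} \<le> card {1..n}" by (rule card_mono) auto
  then show ?thesis unfolding p_value_ecdf_count by (cases "n = 0") (simp_all add: divide_le_eq_1)
qed

text \<open>Without an upper bound the \<open>SUP\<close> in \<open>mHC_stat\<close> on the reals
  would not be a meaningful supremum.\<close>

lemma hc_bdd_above:
  assumes "0 < a"
  shows "bdd_above (hc n x ` {a..1 / 2})"
proof (rule bdd_aboveI2)
  fix t assume t: "t \<in> {a..1 / 2}"
  have "a * (1 / 2) \<le> t * (1 - t)" using t assms by (intro mult_mono) auto
  then have s: "sqrt (a / 2) \<le> sqrt (t * (1 - t))" by simp
  have "hc n x t \<le> sqrt (real n) * 1 / sqrt (t * (1 - t))"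
    unfolding hc_def using t assms p_value_ecdf_le_1[of n x t]
    by (intro divide_right_mono mult_left_mono) auto
  also have "\<dots> \<le> sqrt (real n) * 1 / sqrt (a / 2)"
    using s assms t by (intro divide_left_mono) (auto intro!: mult_pos_pos)
  finally show "hc n x t \<le> sqrt (real n) * 1 / sqrt (a / 2)" .
qed

lemma less_mHC_stat_iff:
  assumes "2 \<le> n"
  shows "q < mHC_stat n x \<longleftrightarrow> (\<exists>t\<in>{1 / real n..1 / 2}. q < hc n x t)"
  unfolding mHC_stat_eq using assms hc_bdd_above[of "1 / real n" n x]
  by (subst less_cSUP_iff) (auto simp: field_simps)

definition exceed_event :: "nat \<Rightarrow> real \<Rightarrow> real \<Rightarrow> (nat \<Rightarrow> real) set" where
  "exceed_event n a q = {x \<in> space (samples n). \<exists>t\<in>{a..1 / 2}. q < hc n x t}"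

lemma p_value_ecdf_measurable [measurable]:
  "(\<lambda>x. p_value_ecdf n x t) \<in> borel_measurable (samples n)"
  unfolding p_value_ecdf_def of_bool_def by measurable

text \<open>To the right of \<open>t\<close> the empirical distribution function does not fall and
  the remaining terms are continuous, so an exceedance at \<open>t\<close> persists at a nearby
  rational. Only the right endpoint, which has no room, is added by hand.\<close>

lemma exceed_event_sets:
  assumes a: "0 < a" "a \<le> 1 / 2"
  shows "exceed_event n a q \<in> sets (samples n)"
proof -
  let ?R = "insert (1 / 2) (\<rat> \<inter> {a..1 / 2})"
  have "(\<exists>t\<in>{a..1 / 2}. q < hc n x t) \<longleftrightarrow> (\<exists>t\<in>?R. q < hc n x t)" for x
  proof
    assume "\<exists>t\<in>{a..1 / 2}. q < hc n x t"
    then obtain t where t: "a \<le> t" "t \<le> 1 / 2" "q < hc n x t" by auto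
    show "\<exists>t\<in>?R. q < hc n x t"
    proof (cases "t = 1 / 2")
      case True
      have "q < hc n x (1 / 2)" using t(3) unfolding True .
      then show ?thesis by blast
    next
      case False
      define f where "f s = sqrt (real n) * (p_value_ecdf n x t - s) / sqrt (s * (1 - s))" for s
      have "isCont f t"
        unfolding f_def using t a by (intro continuous_intros) auto
      then have "(f \<longlongrightarrow> f t) (at_right t)"
        by (auto simp: isCont_def intro: filterlim_mono at_le)
      moreover have "q < f t" using t by (simp add: f_def hc_def)
      ultimately have "eventually (\<lambda>s. q < f s) (at_right t)" by (rule order_tendstoD)
      then obtain b where b: "t < b" "\<And>s. t < s \<Longrightarrow> s < b \<Longrightarrow> q < f s"
        by (auto simp: eventually_at_right_field)
      obtain s where s: "s \<in> \<rat>" "t < s" "s < min b (1 / 2)"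
        using Rats_dense_in_real[of t "min b (1 / 2)"] b False t by auto
      have "f s \<le> hc n x s"
        unfolding f_def hc_def using s t a p_value_ecdf_mono[of t s n x]
        by (intro divide_right_mono mult_left_mono) auto
      then show ?thesis using b(2)[of s] s t by (intro bexI[of _ s]) auto
    qed
  qed (use a in auto)
  then have "exceed_event n a q = (\<Union>t\<in>?R. {x \<in> space (samples n). q < hc n x t})"
    unfolding exceed_event_def by auto
  also have "\<dots> \<in> sets (samples n)"
  proof (rule sets.countable_UN'')
    show "countable ?R" by (simp add: countable_rat countable_Int1)
    show "{x \<in> space (samples n). q < hc n x t} \<in> sets (samples n)" for t
      unfolding hc_def by measurable
  qed
  finally show ?thesis .
qed

lemma mHC_stat_measurable:
  assumes "2 \<le> n"
  shows "mHC_stat n \<in> borel_measurable (samples n)"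
proof (rule borel_measurableI_greater)
  fix q
  have "{x \<in> space (samples n). q < mHC_stat n x} = exceed_event n (1 / real n) q"
    using less_mHC_stat_iff[OF assms] by (auto simp: exceed_event_def)
  also have "\<dots> \<in> sets (samples n)"
    using assms by (intro exceed_event_sets) (auto simp: field_simps)
  finally show "{x \<in> space (samples n). q < mHC_stat n x} \<in> sets (samples n)" .
qed

definition many_small :: "nat \<Rightarrow> real \<Rightarrow> real \<Rightarrow> (nat \<Rightarrow> real) set" where
  "many_small n a y = {x \<in> space (samples n). y < real n * p_value_ecdf n x a}"

lemma many_small_sets: "many_small n a y \<in> sets (samples n)"
  unfolding many_small_def by measurable

text \<open>For \<open>1 / n \<le> t \<le> 1 / 2\<close> the standard deviation of the count exceeds
  1/2, so \<open>q\<close> standard deviations above the mean are more than \<open>q / 2\<close>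
  observations. This is where the lower end \<open>1 / n\<close> of the range enters.\<close>

lemma hc_large_imp_many_small:
  assumes n: "2 \<le> n" and t: "1 / real n \<le> t" "t \<le> a" "t \<le> 1 / 2" and q: "0 < q" "q \<le> hc n x t"
  shows "q / 2 < real n * p_value_ecdf n x a"
proof -
  have nt: "1 \<le> real n * t" using t n by (simp add: field_simps)
  have t0: "0 < t" using t n by (smt (verit) divide_pos_pos of_nat_0_less_iff zero_less_numeral order_less_le_trans)
  have "1 * (1 / 2) \<le> real n * t * (1 - t)" using nt t by (intro mult_mono) auto
  then have "sqrt ((1 / 2)\<^sup>2) < sqrt (real n * t * (1 - t))" by (intro real_sqrt_less_mono) (auto simp: power2_eq_square)
  then have s: "1 / 2 < sqrt (real n * t * (1 - t))" by simp
  have pos: "0 < sqrt (t * (1 - t))" using t0 t by simp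
  have "q * sqrt (t * (1 - t)) \<le> sqrt (real n) * (p_value_ecdf n x t - t)"
    using q(2) pos unfolding hc_def by (simp add: pos_le_divide_eq)
  then have "sqrt (real n) * (q * sqrt (t * (1 - t))) \<le> sqrt (real n) * (sqrt (real n) * (p_value_ecdf n x t - t))"
    by (rule mult_left_mono) simp
  also have "\<dots> = real n * (p_value_ecdf n x t - t)" by (simp add: mult.assoc[symmetric])
  also have "sqrt (real n) * (q * sqrt (t * (1 - t))) = q * sqrt (real n * t * (1 - t))"
    by (simp add: real_sqrt_mult)
  finally have "q * sqrt (real n * t * (1 - t)) \<le> real n * p_value_ecdf n x t - real n * t"
    by (simp add: algebra_simps)
  moreover have "q / 2 < q * sqrt (real n * t * (1 - t))" using s q by simp
  moreover have "real n * p_value_ecdf n x t \<le> real n * p_value_ecdf n x a"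
    using t by (intro mult_left_mono p_value_ecdf_mono) auto
  ultimately show ?thesis using nt by linarith
qed

lemma exceed_event_split:
  assumes n: "2 \<le> n" and a: "1 / real n \<le> a" and q: "0 < q"
  shows "exceed_event n a q \<subseteq> exceed_event n (1 / real n) q" (is ?c1)
    "exceed_event n (1 / real n) q \<subseteq> exceed_event n a q \<union> many_small n a (q / 2)" (is ?c2)
proof -
  show ?c1
    using a by (force simp: exceed_event_def)
  show ?c2
  proof
    fix x assume "x \<in> exceed_event n (1 / real n) q"
    then obtain t where x: "x \<in> space (samples n)" and t: "1 / real n \<le> t" "t \<le> 1 / 2" "q < hc n x t"
      by (auto simp: exceed_event_def)
    show "x \<in> exceed_event n a q \<union> many_small n a (q / 2)"
    proof (cases "a \<le> t")
      case True
      then show ?thesis using x t by (auto simp: exceed_event_def)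
    next
      case False
      then have "q / 2 < real n * p_value_ecdf n x a"
        using t q by (intro hc_large_imp_many_small[OF n, of t]) auto
      then show ?thesis using x by (auto simp: many_small_def)
    qed
  qed
qed

lemma p_value_trim_le_iff:
  assumes "0 \<le> \<tau>" "p_value \<tau> \<le> t"
  shows "p_value (trim \<tau> y) \<le> t \<longleftrightarrow> p_value y \<le> t"
proof (cases "\<bar>y\<bar> \<le> \<tau>")
  case False
  then have "p_value y \<le> p_value \<tau>" "p_value (\<tau> + 1) \<le> p_value \<tau>"
    using assms by (auto simp: p_value_le_iff)
  then show ?thesis using False assms by (auto simp: trim_def)
qed (simp add: trim_def)

lemma p_value_ecdf_trim:
  assumes "0 \<le> \<tau>" "p_value \<tau> \<le> t"
  shows "p_value_ecdf n (\<lambda>i\<in>{1..n}. trim \<tau> (x i)) t = p_value_ecdf n x t"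
  unfolding p_value_ecdf_def by (simp add: p_value_trim_le_iff[OF assms])

lemma trim_invariant_events:
  assumes "0 \<le> \<tau>" "p_value \<tau> = a" "a \<le> 1 / 2"
  shows "trim_invariant n \<tau> (exceed_event n a q)" "trim_invariant n \<tau> (many_small n a y)"
proof -
  have sp: "(\<lambda>i\<in>{1..n}. trim \<tau> (x i)) \<in> space (samples n)" for x
    by (auto simp: space_PiM)
  have a: "0 < a" using p_value_pos[of \<tau>] assms by simp
  show "trim_invariant n \<tau> (exceed_event n a q)"
    unfolding trim_invariant_def using exceed_event_sets[OF a assms(3), of n q] sp assms
    by (simp add: exceed_event_def hc_def p_value_ecdf_trim del: One_nat_def)
  show "trim_invariant n \<tau> (many_small n a y)"
    unfolding trim_invariant_def using many_small_sets[of n a y] sp assms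
    by (simp add: many_small_def p_value_ecdf_trim del: One_nat_def)
qed

section \<open>Fluctuations of the counts and the atom at the critical value\<close>

lemma count_Chebyshev:
  fixes t d :: real
  assumes P: "prob_space P" and sP: "sets P = sets borel" and d: "0 < d"
  defines "\<rho> \<equiv> measure P {z. p_value z \<le> t}"
  shows "measure (\<Pi>\<^sub>M i\<in>{1..n}. P) {x \<in> space (\<Pi>\<^sub>M i\<in>{1..n}. P).
    d \<le> \<bar>real n * p_value_ecdf n x t - real n * \<rho>\<bar>} \<le> real n * \<rho> / d\<^sup>2"
proof -
  interpret P: prob_space P by fact
  interpret PP: prob_space "\<Pi>\<^sub>M i\<in>{1..n}. P" by (intro prob_space_PiM P)
  have [measurable]: "p_value \<in> borel_measurable P"
    using measurable_p_value by (simp add: sP cong: measurable_cong_sets)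
  have spP: "space P = UNIV" using sets_eq_imp_space_eq[OF sP] by simp
  define f where "f z = indicator {z. p_value z \<le> t} z - \<rho>" for z
  have S: "{z. p_value z \<le> t} \<in> sets P" by (simp add: sP)
  have fm: "f \<in> borel_measurable P" unfolding f_def using S by measurable
  have iS: "integrable P (indicator {z. p_value z \<le> t} :: real \<Rightarrow> real)"
    using S by (intro integrable_real_indicator) (auto simp: P.emeasure_eq_measure)
  have f2: "(f z)\<^sup>2 = (1 - 2 * \<rho>) * indicator {z. p_value z \<le> t} z + \<rho>\<^sup>2" for z
    by (auto simp: f_def power2_eq_square algebra_simps split: split_indicator)
  have if2: "integrable P (\<lambda>z. (f z)\<^sup>2)" unfolding f2 using iS by auto
  have E0: "(\<integral>z. f z \<partial>P) = 0" unfolding f_def using iS S by (simp add: \<rho>_def P.prob_space[unfolded spP] spP)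
  \<comment> \<open>The Bernoulli variance is bounded by its mean, with little loss when \<rho> is
    small.\<close>
  have E2: "(\<integral>z. (f z)\<^sup>2 \<partial>P) \<le> \<rho>"
  proof -
    have "(\<integral>z. (f z)\<^sup>2 \<partial>P) = (1 - 2 * \<rho>) * \<rho> + \<rho>\<^sup>2"
      unfolding f2 using iS S by (simp add: \<rho>_def[symmetric] P.prob_space[unfolded spP] spP)
    also have "\<dots> \<le> \<rho>" by (simp add: power2_eq_square algebra_simps)
    finally show ?thesis .
  qed
  note V = PiM_variance_sum[OF finite_atLeastAtMost P fm if2 E0, of 1 n]
  have sum: "real n * p_value_ecdf n x t - real n * \<rho> = (\<Sum>i\<in>{1..n}. f (x i))" for x
    by (simp add: p_value_ecdf_def f_def sum_subtractf indicator_def of_bool_def)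
  have "measure (\<Pi>\<^sub>M i\<in>{1..n}. P) {x \<in> space (\<Pi>\<^sub>M i\<in>{1..n}. P). d \<le> \<bar>real n * p_value_ecdf n x t - real n * \<rho>\<bar>}
    = measure (\<Pi>\<^sub>M i\<in>{1..n}. P) {x \<in> space (\<Pi>\<^sub>M i\<in>{1..n}. P). d\<^sup>2 \<le> (\<Sum>i\<in>{1..n}. f (x i))\<^sup>2}"
    unfolding sum using d by (simp add: abs_le_square_iff[symmetric])
  also have "\<dots> \<le> (\<integral>x. (\<Sum>i\<in>{1..n}. f (x i))\<^sup>2 \<partial>(\<Pi>\<^sub>M i\<in>{1..n}. P)) / d\<^sup>2"
    using d by (intro integral_Markov_inequality_measure[OF V(1)]) auto
  also have "\<dots> \<le> real n * \<rho> / d\<^sup>2"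
    unfolding V(2) using E2 d by (intro divide_right_mono) (auto intro!: mult_left_mono)
  finally show ?thesis .
qed

text \<open>Moving \<open>t\<close> down to the preceding jump of the empirical distribution function only increases a positive \<open>hc\<close>.\<close>

lemma mHC_stat_attained:
  assumes n: "2 \<le> n" and q: "0 < q" "mHC_stat n x = q"
  shows "hc n x (1 / real n) = q \<or>
    (\<exists>i\<in>{1..n}. p_value (x i) \<in> {1 / real n..1 / 2} \<and> hc n x (p_value (x i)) = q)"
proof -
  define T where "T = insert (1 / real n) {p_value (x i) |i. i \<in> {1..n} \<and> p_value (x i) \<in> {1 / real n..1 / 2}}"
  have n0: "0 < 1 / real n" "1 / real n \<le> 1 / 2" using n by (auto simp: field_simps)
  have finT: "finite T" unfolding T_def by simp
  have subT: "T \<subseteq> {1 / real n..1 / 2}" unfolding T_def using n0 by auto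
  have jump: "\<exists>s\<in>T. hc n x t \<le> hc n x s" if t: "t \<in> {1 / real n..1 / 2}" "0 < hc n x t" for t
  proof -
    define T' where "T' = {s\<in>T. s \<le> t}"
    have T': "finite T'" "T' \<noteq> {}" using finT t by (auto simp: T'_def T_def)
    define s where "s = Max T'"
    have s: "s \<in> T" "s \<le> t" using Max_in[OF T'] by (auto simp: s_def T'_def)
    then have s0: "1 / real n \<le> s" "s \<le> 1 / 2" using subT by auto
    have le: "p_value (x i) \<le> s" if "i \<in> {1..n}" "p_value (x i) \<le> t" for i
    proof (cases "1 / real n \<le> p_value (x i)")
      case True
      then have "p_value (x i) \<in> T'" using that t by (auto simp: T'_def T_def)
      then show ?thesis unfolding s_def using T' by (intro Max_ge) auto
    qed (use s0 in simp)
    \<comment> \<open>No \<open>p\<close>-value lies above \<open>s\<close> and at most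
      \<open>t\<close>, so the empirical distribution function is unchanged, while the subtracted
      mean and, up to 1/2, the variance are smaller at \<open>s\<close>. The sign of the numerator
      is needed to divide by the smaller root.\<close>
    have "p_value_ecdf n x s = p_value_ecdf n x t"
      unfolding p_value_ecdf_def using le s(2)
      by (intro arg_cong[where f="\<lambda>y. 1 / real n * y"] sum.cong refl) (auto simp: of_bool_def)
    moreover have "0 < p_value_ecdf n x t - t"
    proof (rule ccontr)
      assume "\<not> ?thesis"
      moreover have "0 < t" by (rule order_less_le_trans[OF n0(1)]) (use t in simp)
      then have "0 \<le> t * (1 - t)" using t by (intro mult_nonneg_nonneg) auto
      ultimately have "hc n x t \<le> 0"
        unfolding hc_def by (intro divide_nonpos_nonneg mult_nonneg_nonpos) auto
      then show False using t by simp
    qed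
    moreover have "s * (1 - s) \<le> t * (1 - t)"
    proof -
      have "0 \<le> (t - s) * (1 - s - t)" using s s0 t by (intro mult_nonneg_nonneg) auto
      then show ?thesis by (simp add: algebra_simps)
    qed
    moreover have "0 < s * (1 - s)"
      using s0 order_less_le_trans[OF n0(1) s0(1)] by (intro mult_pos_pos) auto
    ultimately have "hc n x t \<le> hc n x s"
      unfolding hc_def using s
      by (intro frac_le mult_left_mono mult_nonneg_nonneg) auto
    with s show ?thesis by auto
  qed
  have ne: "{1 / real n..1 / 2} \<noteq> {}" using n0 by simp
  note bdd = hc_bdd_above[OF n0(1), of n x]
  define m where "m = Max (hc n x ` T)"
  have finm: "finite (hc n x ` T)" "hc n x ` T \<noteq> {}" using finT by (auto simp: T_def)
  have "0 < mHC_stat n x" using q by simp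
  then obtain t0 where t0: "t0 \<in> {1 / real n..1 / 2}" "0 < hc n x t0"
    using less_mHC_stat_iff[OF n] by auto
  have m0: "0 < m"
  proof -
    obtain s where "s \<in> T" "hc n x t0 \<le> hc n x s" using jump[OF t0] by auto
    moreover from this have "hc n x s \<le> m" unfolding m_def using finm by (intro Max_ge) auto
    ultimately show ?thesis using t0 by simp
  qed
  have "q \<le> m"
    unfolding q(2)[symmetric] mHC_stat_eq
  proof (rule cSUP_least[OF ne])
    fix t assume t: "t \<in> {1 / real n..1 / 2}"
    show "hc n x t \<le> m"
    proof (cases "0 < hc n x t")
      case True
      then obtain s where "s \<in> T" "hc n x t \<le> hc n x s" using jump[OF t] by auto
      moreover from this have "hc n x s \<le> m" unfolding m_def using finm by (intro Max_ge) auto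
      ultimately show ?thesis by simp
    qed (use m0 in simp)
  qed
  moreover obtain s where s: "s \<in> T" "hc n x s = m"
    using Max_in[OF finm] unfolding m_def[symmetric] by auto
  moreover have "hc n x s \<le> q"
    unfolding q(2)[symmetric] mHC_stat_eq using s subT by (intro cSUP_upper bdd) auto
  ultimately have "hc n x s = q" by simp
  then show ?thesis using s by (auto simp: T_def)
qed

text \<open>For fixed \<open>y\<close> the numerator strictly decreases in \<open>t\<close> while
  the denominator does not decrease up to 1/2, so a positive level is attained at most once.\<close>

lemma hc_level_unique:
  assumes q: "0 < q" and s: "0 < s" "s < t" "t \<le> 1 / 2" and "0 < (c :: real)"
  shows "c * (y - s) / sqrt (s * (1 - s)) = q \<Longrightarrow> c * (y - t) / sqrt (t * (1 - t)) = q \<Longrightarrow> False"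
proof -
  assume 1: "c * (y - s) / sqrt (s * (1 - s)) = q" and 2: "c * (y - t) / sqrt (t * (1 - t)) = q"
  have ps: "0 < s * (1 - s)" using s by simp
  have pt: "0 < t * (1 - t)" using s by simp
  have "0 \<le> (t - s) * (1 - s - t)" using s by (intro mult_nonneg_nonneg) auto
  then have "s * (1 - s) \<le> t * (1 - t)" by (simp add: algebra_simps)
  then have le: "sqrt (s * (1 - s)) \<le> sqrt (t * (1 - t))" by simp
  have "sqrt (s * (1 - s)) \<noteq> 0" "sqrt (t * (1 - t)) \<noteq> 0"
    using real_sqrt_gt_zero[OF ps] real_sqrt_gt_zero[OF pt] by linarith+
  then have "c * (y - s) = q * sqrt (s * (1 - s))" "c * (y - t) = q * sqrt (t * (1 - t))"
    using 1 2 by (metis nonzero_divide_eq_eq)+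
  moreover have "q * sqrt (s * (1 - s)) \<le> q * sqrt (t * (1 - t))" using le q by simp
  ultimately have "c * (y - s) \<le> c * (y - t)" by simp
  then show False using assms by simp
qed

text \<open>If the supremum is attained at a \<open>p\<close>-value, that \<open>p\<close>-value
  solves one of finitely many equations, a null event. There remains the deterministic point
  \<open>t = 1 / n\<close>, where a genuine atom is possible but forces many small
  \<open>p\<close>-values.\<close>

lemma mHC_stat_atom:
  assumes n: "2 \<le> n" and a: "1 / real n \<le> a" and q: "0 < q"
  shows "\<P>(x in H0 n. mHC_stat n x = q) \<le> measure (H0 n) (many_small n a (q / 2))"
proof -
  interpret P0: prob_space "H0 n" by (rule prob_space_H0)
  \<comment> \<open>The empirical distribution function takes values \<open>j / n\<close> only; for
    each \<open>j\<close>, \<open>V j\<close> collects the points where \<open>hc\<close> would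
    equal \<open>q\<close>.\<close>
  define V where "V j = {v \<in> {1 / real n..1 / 2}. sqrt (real n) * (real j / real n - v) / sqrt (v * (1 - v)) = q}" for j :: nat
  have finV: "finite (V j)" for j
  proof (rule ccontr)
    assume "infinite (V j)"
    then obtain s t where st: "s \<in> V j" "t \<in> V j" "s < t"
      by (metis finite.emptyI finite.insertI finite_subset insertI1 linorder_neqE subsetI)
    have "0 < 1 / real n" using n by simp
    also have "\<dots> \<le> s" using st(1) by (simp add: V_def)
    finally have "0 < s" .
    then show False
      using hc_level_unique[OF q \<open>0 < s\<close> st(3), of "sqrt (real n)" "real j / real n"] n st
      by (auto simp: V_def)
  qed
  have null: "AE z in N01. p_value z \<noteq> v" for v
  proof -
    have "{z. p_value z = v} \<subseteq> {y, - y}" if "p_value y = v" for y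
      using that p_value_eq_iff by (auto simp: abs_eq_iff)
    then have "\<exists>y. {z. p_value z = v} \<subseteq> {y, - y}" by (cases "\<exists>y. p_value y = v") auto
    then obtain y where y: "{z. p_value z = v} \<subseteq> {y, - y}" by auto
    have "measure N01 {z. p_value z = v} \<le> measure N01 ({y} \<union> {- y})"
      using y by (intro normal.finite_measure_mono) auto
    also have "\<dots> \<le> measure N01 {y} + measure N01 {- y}"
      by (rule measure_Un_le) auto
    finally have "measure N01 {z. p_value z = v} = 0"
      by (simp add: measure_le_0_iff)
    then show ?thesis
      by (subst AE_iff_measurable[OF _ refl]) (auto simp: normal.emeasure_eq_measure)
  qed
  have "AE x in H0 n. \<forall>i\<in>{1..n}. \<forall>j\<in>{..n}. \<forall>v\<in>V j. p_value (x i) \<noteq> v"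
  proof (intro eventually_ball_finite ballI; (rule finV | rule finite_atMost | rule finite_atLeastAtMost)?)
    fix i j v assume i: "i \<in> {1..n}"
    show "AE x in H0 n. p_value (x i) \<noteq> v"
      unfolding H0_eq_PiM by (rule AE_PiM_component[OF _ i null]) (rule prob_space_normal_law)
  qed
  moreover have "AE x in H0 n. x \<in> space (H0 n)" by (rule AE_space)
  ultimately have "AE x in H0 n. x \<in> {x \<in> space (H0 n). mHC_stat n x = q} \<longrightarrow> x \<in> many_small n a (q / 2)"
  proof eventually_elim
    case (elim x)
    show ?case
    proof
      assume "x \<in> {x \<in> space (H0 n). mHC_stat n x = q}"
      then have "mHC_stat n x = q" by simp
      from mHC_stat_attained[OF n q this] have "hc n x (1 / real n) = q"
      proof
        assume "\<exists>i\<in>{1..n}. p_value (x i) \<in> {1 / real n..1 / 2} \<and> hc n x (p_value (x i)) = q"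
        then obtain i where i: "i \<in> {1..n}" "p_value (x i) \<in> {1 / real n..1 / 2}" "hc n x (p_value (x i)) = q" by auto
        define k where "k = card {j\<in>{1..n}. p_value (x j) \<le> p_value (x i)}"
        have "k \<le> card {1..n}" unfolding k_def by (rule card_mono) auto
        then have "k \<in> {..n}" by simp
        moreover have "p_value (x i) \<in> V k"
          using i by (simp add: V_def hc_def p_value_ecdf_count k_def del: One_nat_def)
        ultimately show ?thesis using elim(1) i(1) by blast
      qed
      then have "q / 2 < real n * p_value_ecdf n x a"
        using n q a by (intro hc_large_imp_many_small[OF n, of "1 / real n"]) auto
      then show "x \<in> many_small n a (q / 2)"
        using elim(2) by (simp only: many_small_def space_H0 mem_Collect_eq)
    qed
  qed
  then show ?thesis
    by (rule P0.finite_measure_mono_AE) (simp only: sets_H0 many_small_sets)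
qed

section \<open>Divergence of the null critical value\<close>

definition count_sd :: "nat \<Rightarrow> real \<Rightarrow> real" where
  "count_sd n t = sqrt (real n * (t * (1 - t)))"

text \<open>Tilting the null towards an excess of \<open>p\<close>-values below \<open>t\<close> by \<open>\<theta>\<close> standard deviations.\<close>

definition tilt :: "nat \<Rightarrow> real \<Rightarrow> real \<Rightarrow> real \<Rightarrow> real" where
  "tilt n \<theta> t z = 1 + \<theta> / count_sd n t * (indicator {z. p_value z \<le> t} z - t)"

context
  fixes n :: nat and \<theta> t :: real
  assumes n: "1 \<le> n" and t: "0 < t" "t \<le> 1 / 2" and \<theta>: "0 \<le> \<theta>"
    and small: "\<theta> \<le> count_sd n t"
begin

lemma tilt_measurable [measurable]: "tilt n \<theta> t \<in> borel_measurable borel"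
  unfolding tilt_def[abs_def] by measurable

lemma tilt_root_pos: "0 < count_sd n t"
  using n t by (simp add: count_sd_def)

text \<open>The restriction of \<theta> to one standard deviation of the count keeps the coefficient
  of the tilt at most 1, so the tilt is a density.\<close>

lemma tilt_nonneg: "0 \<le> tilt n \<theta> t z"
proof -
  define d where "d = \<theta> / count_sd n t"
  have d: "0 \<le> d" "d \<le> 1" using \<theta> small tilt_root_pos by (auto simp: d_def)
  have "d * t \<le> 1 * (1 / 2)" using d t by (intro mult_mono) auto
  then show ?thesis using d t unfolding tilt_def d_def[symmetric]
    by (auto simp: algebra_simps split: split_indicator)
qed

end

lemma integral_p_value_indicator:
  assumes "0 < t" "t \<le> 1"
  shows "integrable N01 (indicator {z. p_value z \<le> t} :: real \<Rightarrow> real)" (is ?c1)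
    "(\<integral>z. indicator {z. p_value z \<le> t} z \<partial>N01) = t" (is ?c2)
proof -
  show ?c1
    by (intro integrable_real_indicator) (auto simp: normal.emeasure_eq_measure)
  show ?c2
    using measure_p_value_le[OF assms] by simp
qed

lemma integral_tilt:
  assumes "0 < t" "t \<le> 1"
  shows "integrable N01 (tilt n \<theta> t)" "(\<integral>z. tilt n \<theta> t z \<partial>N01) = 1"
proof -
  note i = integral_p_value_indicator[OF assms]
  show "integrable N01 (tilt n \<theta> t)" "(\<integral>z. tilt n \<theta> t z \<partial>N01) = 1"
    unfolding tilt_def[abs_def] using i normal.prob_space by auto
qed

lemma integrable_tilt_mult: "integrable N01 (\<lambda>z. tilt n \<theta> s z * tilt n \<theta> t z)"
proof -
  let ?b = "\<lambda>t. 1 + \<bar>\<theta> / count_sd n t\<bar> * (1 + \<bar>t\<bar>)"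
  have b: "\<bar>tilt n \<theta> t z\<bar> \<le> ?b t" for t z
    unfolding tilt_def
    by (intro order_trans[OF abs_triangle_ineq] add_mono) (auto simp: abs_mult intro!: mult_left_mono divide_right_mono split: split_indicator)
  have "\<bar>tilt n \<theta> s z * tilt n \<theta> t z\<bar> \<le> ?b s * ?b t" for z
    unfolding abs_mult by (intro mult_mono b) auto
  then show ?thesis
    by (intro normal.integrable_const_bound[where B="?b s * ?b t"]) (auto simp: tilt_def[abs_def])
qed

text \<open>For \<open>s \<le> t\<close> the indicators of \<open>p\<close>-values below
  \<open>s\<close> and below \<open>t\<close> have covariance \<open>s - s * t\<close>, as for a
  Brownian bridge.\<close>

lemma integral_tilt_mult:
  assumes s: "0 < s" "s \<le> t" and t: "t \<le> 1"
  shows "(\<integral>z. tilt n \<theta> s z * tilt n \<theta> t z \<partial>N01) =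
      1 + \<theta> / count_sd n s * (\<theta> / count_sd n t) * (s * (1 - t))"
proof -
  note i1 = integral_p_value_indicator[OF s(1) order_trans[OF s(2) t]]
  note i2 = integral_p_value_indicator[OF less_le_trans[OF s] t]
  define c d where "c = \<theta> / count_sd n s" and "d = \<theta> / count_sd n t"
  have eq: "tilt n \<theta> s z * tilt n \<theta> t z = (1 - c * s) * (1 - d * t) +
     (c * (1 - d * t) + c * d) * indicator {z. p_value z \<le> s} z + d * (1 - c * s) * indicator {z. p_value z \<le> t} z" for z
    using s unfolding tilt_def c_def[symmetric] d_def[symmetric]
    by (auto simp: algebra_simps split: split_indicator)
  have "(\<integral>z. tilt n \<theta> s z * tilt n \<theta> t z \<partial>N01) =
    (1 - c * s) * (1 - d * t) + (c * (1 - d * t) + c * d) * s + d * (1 - c * s) * t"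
    unfolding eq using i1 i2 normal.prob_space by simp
  also have "\<dots> = 1 + c * d * (s * (1 - t))" by (simp add: algebra_simps)
  finally show ?thesis
    by (simp add: c_def d_def)
qed

text \<open>The standardized counts at \<open>s \<le> t\<close> have correlation
  \<open>sqrt (s * (1 - t) / (t * (1 - s)))\<close>, which is at most \<open>sqrt (s / t)\<close>.
  Levels far apart in ratio are nearly uncorrelated.\<close>

lemma tilt_correlation_le:
  assumes n: "1 \<le> n" and s: "0 < s" "s \<le> t" and t: "t \<le> 1 / 2" and \<rho>: "s \<le> \<rho>\<^sup>2 * t" "0 \<le> \<rho>"
  shows "real n * (\<theta> / count_sd n s * (\<theta> / count_sd n t) * (s * (1 - t))) \<le> \<theta>\<^sup>2 * \<rho>"
proof -
  have p: "0 < s * (1 - s)" "0 < t * (1 - t)" using s t by auto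
  define u v w where "u = sqrt (s * (1 - s))" and "v = sqrt (t * (1 - t))" and "w = sqrt (real n)"
  have uvw: "0 < u" "0 < v" "0 < w" using real_sqrt_gt_zero p n by (auto simp: u_def v_def w_def)
  have nw: "real n = w * w" by (simp add: w_def)
  have "real n * (\<theta> / count_sd n s * (\<theta> / count_sd n t) * (s * (1 - t)))
    = \<theta>\<^sup>2 * (s * (1 - t) / sqrt (s * (1 - s) * (t * (1 - t))))"
  proof -
    have "count_sd n s = w * u" "count_sd n t = w * v"
      "sqrt (s * (1 - s) * (t * (1 - t))) = u * v"
      by (simp_all only: real_sqrt_mult u_def v_def w_def count_sd_def)
    moreover have "w * w * (\<theta> / (w * u) * (\<theta> / (w * v)) * z) = \<theta>\<^sup>2 * (z / (u * v))" for z
      using uvw by (simp add: power2_eq_square)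
    ultimately show ?thesis by (simp only: nw)
  qed
  also have "\<dots> \<le> \<theta>\<^sup>2 * \<rho>"
  proof (intro mult_left_mono)
    have "(s * (1 - t))\<^sup>2 = s * s * ((1 - t) * (1 - t))" by (simp add: power2_eq_square)
    also have "\<dots> \<le> s * (\<rho>\<^sup>2 * t) * ((1 - s) * (1 - t))"
      using s t \<rho> by (intro mult_mono) auto
    also have "\<dots> = \<rho>\<^sup>2 * (s * (1 - s) * (t * (1 - t)))" by simp
    finally have "s * (1 - t) \<le> sqrt (\<rho>\<^sup>2 * (s * (1 - s) * (t * (1 - t))))"
      by (rule real_le_rsqrt)
    then have "s * (1 - t) \<le> \<rho> * sqrt (s * (1 - s) * (t * (1 - t)))"
      using \<rho> by (simp add: real_sqrt_mult)
    moreover have "0 < sqrt (s * (1 - s) * (t * (1 - t)))" using p by simp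
    ultimately show "s * (1 - t) / sqrt (s * (1 - s) * (t * (1 - t))) \<le> \<rho>"
      by (simp add: pos_divide_le_eq)
  qed simp
  finally show ?thesis .
qed

lemma nn_integral_tilt:
  assumes "0 < t" "t \<le> 1 / 2" "1 \<le> n" "0 \<le> \<theta>" "\<theta> \<le> count_sd n t"
  shows "(\<integral>\<^sup>+z. ennreal (tilt n \<theta> t z) \<partial>N01) = 1"
proof -
  have "(\<integral>\<^sup>+z. ennreal (tilt n \<theta> t z) \<partial>N01) = ennreal (\<integral>z. tilt n \<theta> t z \<partial>N01)"
    using assms tilt_nonneg by (intro nn_integral_eq_integral integral_tilt AE_I2) auto
  then show ?thesis using integral_tilt(2)[of t n \<theta>] assms by simp
qed

lemma tilt_mean:
  assumes "0 < t" "t \<le> 1 / 2" "1 \<le> n" "0 \<le> \<theta>" "\<theta> \<le> count_sd n t"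
  shows "measure (density N01 (\<lambda>z. ennreal (tilt n \<theta> t z))) {z. p_value z \<le> t} =
    t + \<theta> / count_sd n t * (t * (1 - t))"
proof -
  define d where "d = \<theta> / count_sd n t"
  have i: "integrable N01 (indicator {z. p_value z \<le> t} :: real \<Rightarrow> real)"
    "(\<integral>z. indicator {z. p_value z \<le> t} z \<partial>N01) = t"
    using assms by (intro integral_p_value_indicator; simp)+
  have "measure (density N01 (\<lambda>z. ennreal (tilt n \<theta> t z))) {z. p_value z \<le> t}
    = (\<integral>z. indicator {z. p_value z \<le> t} z \<partial>density N01 (\<lambda>z. ennreal (tilt n \<theta> t z)))" by simp
  also have "\<dots> = (\<integral>z. tilt n \<theta> t z * indicator {z. p_value z \<le> t} z \<partial>N01)"
    using assms by (subst integral_density) (auto simp: tilt_nonneg tilt_measurable)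
  also have "\<dots> = (\<integral>z. (1 + d * (1 - t)) * indicator {z. p_value z \<le> t} z \<partial>N01)"
    by (intro Bochner_Integration.integral_cong) (auto simp: tilt_def d_def split: split_indicator)
  also have "\<dots> = (1 + d * (1 - t)) * t" using i by simp
  finally show ?thesis by (simp add: d_def algebra_simps)
qed

text \<open>The tilt raises the mean count at \<open>t\<close> by \<theta> standard deviations, so a
  statistic of at most \<open>K\<close> means a shortfall of \<open>\<theta> - K\<close> of them.
  The 4 arises from Chebyshev's inequality: the tilted mean \<open>m\<close> is at most
  \<open>2 * t\<close>, hence at most four times \<open>t * (1 - t)\<close>.\<close>

lemma tilted_mHC_small:
  assumes t: "1 / real n \<le> t" "t \<le> 1 / 2" and n: "2 \<le> n" and \<theta>: "0 \<le> \<theta>" "\<theta> \<le> count_sd n t"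
    and K: "K < \<theta>" and B: "B = {x \<in> space (\<Pi>\<^sub>M i\<in>{1..n}. N01). mHC_stat n x \<le> K}"
  shows "measure (\<Pi>\<^sub>M i\<in>{1..n}. density N01 (\<lambda>z. ennreal (tilt n \<theta> t z))) B \<le> 4 / (\<theta> - K)\<^sup>2"
proof -
  let ?D = "density N01 (\<lambda>z. ennreal (tilt n \<theta> t z))"
  have t0: "0 < t" using t n by (smt (verit) divide_pos_pos of_nat_0_less_iff zero_less_numeral order_less_le_trans)
  define S where "S = count_sd n t"
  have S: "0 < S" "S\<^sup>2 = real n * (t * (1 - t))" using t0 t n by (auto simp: S_def count_sd_def)
  define m where "m = t + \<theta> / S * (t * (1 - t))"
  have [measurable]: "tilt n \<theta> t \<in> borel_measurable borel" using assms t0 by (intro tilt_measurable) auto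
  interpret D: prob_space ?D
    using nn_integral_tilt[OF t0 t(2) _ \<theta>] n by (intro prob_spaceI) (simp add: emeasure_density cong: nn_integral_cong)
  interpret PD: prob_space "\<Pi>\<^sub>M i\<in>{1..n}. ?D" by (intro prob_space_PiM D.prob_space_axioms)
  have mean: "measure ?D {z. p_value z \<le> t} = m"
    using tilt_mean[OF t0 t(2) _ \<theta>] n by (simp add: m_def S_def)
  have d0: "0 < (\<theta> - K) * S" using K S by simp
  let ?E = "{x \<in> space (\<Pi>\<^sub>M i\<in>{1..n}. ?D). (\<theta> - K) * S \<le> \<bar>real n * p_value_ecdf n x t - real n * m\<bar>}"
  have sPD: "sets (\<Pi>\<^sub>M i\<in>{1..n}. ?D) = sets (samples n)" by (intro sets_PiM_cong) auto
  have E: "?E \<in> PD.events"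
    using p_value_ecdf_measurable[of n t] unfolding measurable_cong_sets[OF sPD[symmetric] refl] by measurable
  have "B \<subseteq> ?E"
  proof
    fix x assume x: "x \<in> B"
    have "hc n x t \<le> K"
      using less_mHC_stat_iff[OF n, of K x] x t by (auto simp: B not_less[symmetric])
    then have "sqrt (real n) * (p_value_ecdf n x t - t) \<le> K * sqrt (t * (1 - t))"
      unfolding hc_def using t0 t by (subst (asm) pos_divide_le_eq) auto
    then have "sqrt (real n) * (sqrt (real n) * (p_value_ecdf n x t - t)) \<le> sqrt (real n) * (K * sqrt (t * (1 - t)))"
      by (rule mult_left_mono) simp
    then have "real n * (p_value_ecdf n x t - t) \<le> K * S"
      by (simp add: S_def count_sd_def real_sqrt_mult mult.assoc[symmetric] mult.commute[of _ K])
    moreover have "real n * m = real n * t + \<theta> * S"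
    proof -
      have "real n * (\<theta> / S * (t * (1 - t))) = \<theta> / S * S\<^sup>2" by (simp add: S(2))
      also have "\<dots> = \<theta> * S" using S(1) by (simp add: power2_eq_square)
      finally show ?thesis by (simp add: m_def distrib_left)
    qed
    ultimately have "(\<theta> - K) * S \<le> \<bar>real n * p_value_ecdf n x t - real n * m\<bar>"
      by (simp add: algebra_simps)
    then show "x \<in> ?E" using x by (auto simp: B space_PiM)
  qed
  then have "measure (\<Pi>\<^sub>M i\<in>{1..n}. ?D) B \<le> measure (\<Pi>\<^sub>M i\<in>{1..n}. ?D) ?E"
    by (intro PD.finite_measure_mono E)
  also have "\<dots> \<le> real n * m / ((\<theta> - K) * S)\<^sup>2"
    using count_Chebyshev[OF D.prob_space_axioms _ d0, where t = t and n = n] by (simp add: mean)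
  also have "\<dots> \<le> 4 / (\<theta> - K)\<^sup>2"
  proof -
    have "m \<le> 2 * t"
    proof -
      have "\<theta> / S * (t * (1 - t)) \<le> 1 * (t * 1)"
        using \<theta> S t0 t by (intro mult_mono) (auto simp: S_def)
      then show ?thesis by (simp add: m_def)
    qed
    also have "\<dots> \<le> 4 * (t * (1 - t))" using mult_left_mono[OF t(2), of t] t0 by (simp add: algebra_simps)
    finally have "real n * m \<le> real n * (4 * (t * (1 - t)))" by (rule mult_left_mono) simp
    also have "\<dots> = 4 * S\<^sup>2" by (simp add: S(2))
    finally have "real n * m / ((\<theta> - K) * S)\<^sup>2 \<le> 4 * S\<^sup>2 / ((\<theta> - K) * S)\<^sup>2"
      by (rule divide_right_mono) simp
    also have "\<dots> = 4 / (\<theta> - K)\<^sup>2" using S(1) by (simp add: power_mult_distrib)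
    finally show ?thesis .
  qed
  finally show ?thesis .
qed

text \<open>The null law is close to the average of many nearly uncorrelated tilts, under each of which \<open>mHC\<close> is large.\<close>

lemma mHC_stat_null_small:
  fixes t :: "nat \<Rightarrow> real" and J :: nat
  assumes n: "2 \<le> n" and J: "0 < J" and t: "\<And>j. j < J \<Longrightarrow> 1 / real n \<le> t j" "\<And>j. j < J \<Longrightarrow> t j \<le> 1 / 2"
    and \<theta>: "0 \<le> \<theta>" "\<And>j. j < J \<Longrightarrow> \<theta> \<le> count_sd n (t j)" and K: "K < \<theta>"
    and \<rho>: "0 \<le> \<rho>" "\<rho> \<le> 1" "\<And>j k. k < J \<Longrightarrow> j < k \<Longrightarrow> t k \<le> \<rho>\<^sup>2 * t j"
  shows "\<P>(x in H0 n. mHC_stat n x \<le> K)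
    \<le> 4 / (\<theta> - K)\<^sup>2 + sqrt (exp (\<theta>\<^sup>2) / real J + (exp (\<theta>\<^sup>2 * \<rho>) - 1))"
proof -
  interpret P0: prob_space "H0 n" by (rule prob_space_H0)
  define B where "B = {x \<in> space (\<Pi>\<^sub>M i\<in>{1..n}. N01). mHC_stat n x \<le> K}"
  have sN: "sets (\<Pi>\<^sub>M i\<in>{1..n}. N01) = sets (samples n)" by (intro sets_PiM_cong) auto
  have B: "B \<in> sets (\<Pi>\<^sub>M i\<in>{1..n}. N01)"
    unfolding B_def using mHC_stat_measurable[OF n] unfolding measurable_cong_sets[OF sN[symmetric] refl] by measurable
  have t0: "0 < t j" if "j < J" for j
    by (rule order_less_le_trans[OF _ t(1)[OF that]]) (use n in simp)
  define Lr where "Lr j x = (\<Prod>i\<in>{1..n}. tilt n \<theta> (t j) (x i))" for j x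
  have iL: "integrable (H0 n) (Lr j)" and EL: "(\<integral>x. Lr j x \<partial>H0 n) = 1" if "j < J" for j
    using PiM_integral_prod_const[OF finite_atLeastAtMost prob_space_normal_law integral_tilt(1)[of "t j" n \<theta>], of 1 n]
      integral_tilt(2)[of "t j" n \<theta>] t0[OF that] t(2)[OF that]
    unfolding Lr_def[abs_def] H0_eq_PiM by auto
  let ?M = "\<lambda>j k. \<integral>x. Lr j x * Lr k x \<partial>H0 n"
  have LL: "integrable (H0 n) (\<lambda>x. Lr j x * Lr k x)"
    "?M j k = (\<integral>z. tilt n \<theta> (t j) z * tilt n \<theta> (t k) z \<partial>N01) ^ n"
    if "j < J" "k < J" for j k
  proof -
    have i: "integrable N01 (\<lambda>z. tilt n \<theta> (t j) z * tilt n \<theta> (t k) z)"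
      by (rule integrable_tilt_mult)
    show "integrable (H0 n) (\<lambda>x. Lr j x * Lr k x)"
      "?M j k = (\<integral>z. tilt n \<theta> (t j) z * tilt n \<theta> (t k) z \<partial>N01) ^ n"
      using PiM_integral_prod_const[OF finite_atLeastAtMost prob_space_normal_law i, of 1 n]
      unfolding Lr_def H0_eq_PiM prod.distrib[symmetric] by auto
  qed
  \<comment> \<open>One bound for two uses: \<sigma> = 1 on the diagonal and \<sigma> = \<rho> for
    distinct levels. Over \<open>n\<close> coordinates the covariance excess accumulates to at most
    \<open>exp (\<theta>\<^sup>2 * \<sigma>)\<close>.\<close>
  have ordered: "?M k j \<le> exp (\<theta>\<^sup>2 * \<sigma>)"
    if "j < J" "k < J" "t k \<le> t j" "t k \<le> \<sigma>\<^sup>2 * t j" "0 \<le> \<sigma>" for j k \<sigma>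
  proof -
    let ?c = "\<theta> / count_sd n (t k) * (\<theta> / count_sd n (t j)) * (t k * (1 - t j))"
    have c0: "0 \<le> ?c"
      using \<theta>(1) t0[of j] t0[of k] t(2)[of j] t(2)[of k] that
      by (intro mult_nonneg_nonneg divide_nonneg_nonneg real_sqrt_ge_zero) (auto simp: count_sd_def)
    have "?M k j = (1 + ?c) ^ n"
      unfolding LL(2)[OF that(2,1)] using t0[OF that(2)] that(3) t(2)[OF that(1)]
      by (subst integral_tilt_mult) auto
    also have "\<dots> \<le> exp ?c ^ n" using c0 exp_ge_add_one_self[of ?c] by (intro power_mono) auto
    also have "\<dots> = exp (real n * ?c)" by (rule exp_of_nat_mult[symmetric])
    also have "\<dots> \<le> exp (\<theta>\<^sup>2 * \<sigma>)"
      using n t0[OF that(2)] t(2)[OF that(1)] that by (subst exp_le_cancel_iff, intro tilt_correlation_le) auto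
    finally show ?thesis .
  qed
  have diag: "?M j j \<le> exp (\<theta>\<^sup>2)" if "j < J" for j
    using ordered[OF that that, of 1] by simp
  have off: "?M j k \<le> exp (\<theta>\<^sup>2 * \<rho>)" if "j < J" "k < J" "j \<noteq> k" for j k
  proof -
    have *: "?M k j \<le> exp (\<theta>\<^sup>2 * \<rho>)" if "j < k" "k < J" for j k
    proof -
      have "\<rho>\<^sup>2 * t j \<le> 1 * t j" using that \<rho>(1,2) t0[of j] by (intro mult_right_mono power_le_one) auto
      then show ?thesis using that \<rho>(1) \<rho>(3)[OF that(2,1)] by (intro ordered) auto
    qed
    show ?thesis
      using *[of j k] *[of k j] that by (cases "j < k") (auto simp: mult.commute)
  qed
  define Z where "Z x = (\<Sum>j<J. Lr j x) / real J" for x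
  have iZ: "integrable (H0 n) Z" and EZ: "(\<integral>x. Z x \<partial>H0 n) = 1"
  proof -
    show "integrable (H0 n) Z" unfolding Z_def[abs_def]
      by (intro integrable_divide Bochner_Integration.integrable_sum iL) auto
    have "(\<integral>x. Z x \<partial>H0 n) = (\<Sum>j<J. (\<integral>x. Lr j x \<partial>H0 n)) / real J"
      unfolding Z_def using iL by (simp add: Bochner_Integration.integral_sum)
    then show "(\<integral>x. Z x \<partial>H0 n) = 1" using EL J by simp
  qed
  have Zsq: "(Z x)\<^sup>2 = (\<Sum>j<J. \<Sum>k<J. Lr j x * Lr k x) / (real J)\<^sup>2" for x
    by (simp add: Z_def power_divide power2_eq_square sum_product)
  have iZsq: "integrable (H0 n) (\<lambda>x. (Z x)\<^sup>2)"
    unfolding Zsq using LL(1) by (intro integrable_divide Bochner_Integration.integrable_sum) auto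
  have EZsq: "(\<integral>x. (Z x)\<^sup>2 \<partial>H0 n) \<le> exp (\<theta>\<^sup>2) / real J + exp (\<theta>\<^sup>2 * \<rho>)"
  proof -
    have "(\<integral>x. (Z x)\<^sup>2 \<partial>H0 n) = (\<Sum>j<J. \<Sum>k<J. ?M j k) / (real J)\<^sup>2"
    proof -
      have "(\<integral>x. (\<Sum>j<J. \<Sum>k<J. Lr j x * Lr k x) \<partial>H0 n) = (\<Sum>j<J. \<integral>x. (\<Sum>k<J. Lr j x * Lr k x) \<partial>H0 n)"
        by (intro Bochner_Integration.integral_sum Bochner_Integration.integrable_sum LL(1)) auto
      also have "\<dots> = (\<Sum>j<J. \<Sum>k<J. ?M j k)"
        by (intro sum.cong refl Bochner_Integration.integral_sum LL(1)) auto
      finally show ?thesis unfolding Zsq by simp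
    qed
    \<comment> \<open>Only \<open>J\<close> of the \<open>J\<^sup>2\<close> terms are diagonal, so
      the large value \<open>exp (\<theta>\<^sup>2)\<close> receives weight
      \<open>1 / J\<close>.\<close>
    also have "\<dots> \<le> (\<Sum>j<J. \<Sum>k<J. (if j = k then exp (\<theta>\<^sup>2) else 0) + exp (\<theta>\<^sup>2 * \<rho>)) / (real J)\<^sup>2"
    proof (intro divide_right_mono sum_mono)
      fix j k assume "j \<in> {..<J}" "k \<in> {..<J}"
      then show "?M j k \<le> (if j = k then exp (\<theta>\<^sup>2) else 0) + exp (\<theta>\<^sup>2 * \<rho>)"
        using diag[of j] off[of j k] by (auto intro: add_increasing2)
    qed simp
    also have "\<dots> = (real J * exp (\<theta>\<^sup>2) + (real J)\<^sup>2 * exp (\<theta>\<^sup>2 * \<rho>)) / (real J)\<^sup>2"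
      by (simp add: sum.distrib power2_eq_square algebra_simps)
    also have "\<dots> = exp (\<theta>\<^sup>2) / real J + exp (\<theta>\<^sup>2 * \<rho>)"
      using J by (simp add: power2_eq_square add_divide_distrib)
    finally show ?thesis .
  qed
  have iZ1: "integrable (H0 n) (\<lambda>x. (Z x - 1)\<^sup>2)"
    unfolding power2_diff using iZ iZsq by auto
  have "(\<integral>x. (Z x - 1)\<^sup>2 \<partial>H0 n) = (\<integral>x. (Z x)\<^sup>2 \<partial>H0 n) - 1"
    unfolding power2_diff using iZ iZsq EZ P0.prob_space by simp
  also have "\<dots> \<le> exp (\<theta>\<^sup>2) / real J + (exp (\<theta>\<^sup>2 * \<rho>) - 1)" using EZsq by simp
  finally have EZ1: "(\<integral>x. (Z x - 1)\<^sup>2 \<partial>H0 n) \<le> exp (\<theta>\<^sup>2) / real J + (exp (\<theta>\<^sup>2 * \<rho>) - 1)" .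
  have B': "B \<in> sets (H0 n)" using B by (simp add: H0_eq_PiM)
  have "(\<integral>x. Z x * indicator B x \<partial>H0 n) = (\<Sum>j<J. (\<integral>x. Lr j x * indicator B x \<partial>H0 n)) / real J"
  proof -
    have "Z x * indicator B x = (\<Sum>j<J. Lr j x * indicator B x) / real J" for x
      by (simp only: Z_def sum_distrib_right times_divide_eq_left)
    moreover have "(\<integral>x. (\<Sum>j<J. Lr j x * indicator B x) \<partial>H0 n) = (\<Sum>j<J. (\<integral>x. Lr j x * indicator B x \<partial>H0 n))"
      by (intro Bochner_Integration.integral_sum integrable_real_mult_indicator[OF B' iL]) auto
    ultimately show ?thesis by (simp only: integral_divide_zero)
  qed
  also have "\<dots> \<le> (\<Sum>j<J. 4 / (\<theta> - K)\<^sup>2) / real J"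
  proof (intro divide_right_mono sum_mono)
    fix j assume "j \<in> {..<J}"
    then have j: "j < J" by simp
    have nn: "0 \<le> tilt n \<theta> (t j) z" for z using n t0[OF j] t(2)[OF j] \<theta>(1) \<theta>(2)[OF j] by (intro tilt_nonneg) auto
    have one: "(\<integral>\<^sup>+z. ennreal (tilt n \<theta> (t j) z) \<partial>N01) = 1"
      using n t0[OF j] t(2)[OF j] \<theta>(1) \<theta>(2)[OF j] by (intro nn_integral_tilt) auto
    have tm: "tilt n \<theta> (t j) \<in> borel_measurable N01"
      using integral_tilt(1)[of "t j" n \<theta>] t0[OF j] t(2)[OF j] by auto
    have "(\<integral>x. Lr j x * indicator B x \<partial>H0 n)
      = measure (\<Pi>\<^sub>M i\<in>{1..n}. density N01 (\<lambda>z. ennreal (tilt n \<theta> (t j) z))) B"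
      unfolding Lr_def H0_eq_PiM
      by (rule measure_PiM_density[OF finite_atLeastAtMost prob_space_normal_law tm nn one B, symmetric])
    also have "\<dots> \<le> 4 / (\<theta> - K)\<^sup>2"
      by (rule tilted_mHC_small[OF t(1)[OF j] t(2)[OF j] n \<theta>(1) \<theta>(2)[OF j] K B_def])
    finally show "(\<integral>x. Lr j x * indicator B x \<partial>H0 n) \<le> 4 / (\<theta> - K)\<^sup>2" .
  qed simp
  also have "\<dots> = 4 / (\<theta> - K)\<^sup>2" using J by simp
  finally have ZB: "(\<integral>x. Z x * indicator B x \<partial>H0 n) \<le> 4 / (\<theta> - K)\<^sup>2" .
  have "\<bar>(\<integral>x. Z x * indicator B x \<partial>H0 n) - measure (H0 n) B\<bar> \<le> sqrt (\<integral>x. (Z x - 1)\<^sup>2 \<partial>H0 n)"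
    using iZ by (intro P0.tilted_prob_diff_le[OF _ iZ1 B']) auto
  also have "\<dots> \<le> sqrt (exp (\<theta>\<^sup>2) / real J + (exp (\<theta>\<^sup>2 * \<rho>) - 1))"
    using EZ1 by simp
  finally have "measure (H0 n) B \<le> 4 / (\<theta> - K)\<^sup>2 + sqrt (exp (\<theta>\<^sup>2) / real J + (exp (\<theta>\<^sup>2 * \<rho>) - 1))"
    using ZB by linarith
  then show ?thesis by (simp add: B_def H0_eq_PiM)
qed

text \<open>The constants are fixed in the order \<theta>, \<open>J\<close>, \<open>n\<close>: a
  large tilt makes the first error term small, many levels absorb
  \<open>exp (\<theta>\<^sup>2)\<close>, and a large sample makes tilting by \<theta> standard
  deviations admissible at all levels.\<close>

lemma mHC_stat_null_diverges:
  "(\<lambda>n. \<P>(x in H0 n. mHC_stat n x \<le> K)) \<longlonglongrightarrow> 0"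
proof (rule order_tendstoI)
  fix e :: real assume "e < 0"
  then show "eventually (\<lambda>n. e < \<P>(x in H0 n. mHC_stat n x \<le> K)) sequentially"
    by (intro always_eventually allI) (simp add: less_le_trans)
next
  fix e :: real assume e: "0 < e"
  have "((\<lambda>\<theta>::real. 4 / (\<theta> - K)\<^sup>2) \<longlongrightarrow> 0) at_top" by real_asymp
  then have "eventually (\<lambda>\<theta>. 4 / (\<theta> - K)\<^sup>2 < e / 2) at_top" using e by (intro order_tendstoD) auto
  then have "eventually (\<lambda>\<theta>. 4 / (\<theta> - K)\<^sup>2 < e / 2 \<and> max 0 K < \<theta>) at_top"
    by (intro eventually_conj eventually_gt_at_top)
  then obtain \<theta> where \<theta>: "4 / (\<theta> - K)\<^sup>2 < e / 2" "0 < \<theta>" "K < \<theta>"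
    by (auto dest!: eventually_happens)
  have "(\<lambda>J. sqrt (exp (\<theta>\<^sup>2) / real J + (exp (\<theta>\<^sup>2 * (1 / real J)) - 1))) \<longlonglongrightarrow> 0"
  proof -
    have "(\<lambda>J. exp (\<theta>\<^sup>2) / real J + (exp (\<theta>\<^sup>2 * (1 / real J)) - 1)) \<longlonglongrightarrow> 0 + (exp (\<theta>\<^sup>2 * 0) - 1)"
      by (intro tendsto_intros lim_const_over_n)
    from tendsto_real_sqrt[OF this] show ?thesis by simp
  qed
  then have "eventually (\<lambda>J. sqrt (exp (\<theta>\<^sup>2) / real J + (exp (\<theta>\<^sup>2 * (1 / real J)) - 1)) < e / 2) sequentially"
    using e by (intro order_tendstoD) auto
  then have "eventually (\<lambda>J. sqrt (exp (\<theta>\<^sup>2) / real J + (exp (\<theta>\<^sup>2 * (1 / real J)) - 1)) < e / 2 \<and> 0 < J) sequentially"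
    by (intro eventually_conj eventually_gt_at_top)
  then obtain J where J: "sqrt (exp (\<theta>\<^sup>2) / real J + (exp (\<theta>\<^sup>2 * (1 / real J)) - 1)) < e / 2" "0 < J"
    by (auto dest!: eventually_happens)
  \<comment> \<open>Tying \<rho> to \<open>J\<close> lets one limit remove both the diagonal and the
    correlation error. The levels \<open>t j\<close> form a geometric sequence of ratio
    \<open>\<rho>\<^sup>2\<close>; they do not depend on \<open>n\<close>, so their count deviations
    tend to infinity.\<close>
  define \<rho> where "\<rho> = 1 / real J"
  define t where "t j = (\<rho>\<^sup>2) ^ j / 2" for j :: nat
  have \<rho>: "0 < \<rho>" "\<rho> \<le> 1" using J by (auto simp: \<rho>_def)
  have \<rho>2: "0 < \<rho>\<^sup>2" "\<rho>\<^sup>2 \<le> 1" using \<rho> by (auto simp: power_le_one)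
  have t: "0 < t j" "t j \<le> 1 / 2" for j
    using \<rho>2 by (auto simp: t_def power_le_one)
  have "eventually (\<lambda>n. \<forall>j\<in>{..<J}. 1 / real n \<le> t j \<and> \<theta> \<le> count_sd n (t j)) sequentially"
  proof (intro eventually_ball_finite ballI eventually_conj)
    fix j
    have "(\<lambda>n. 1 / real n) \<longlonglongrightarrow> 0" by (rule lim_1_over_n)
    then have "eventually (\<lambda>n. 1 / real n < t j) sequentially" using t[of j] by (intro order_tendstoD) auto
    then show "eventually (\<lambda>n. 1 / real n \<le> t j) sequentially" by eventually_elim simp
    define c where "c = t j * (1 - t j)"
    have "0 < c" unfolding c_def using t[of j] by (intro mult_pos_pos) auto
    then have "filterlim (\<lambda>n. sqrt (real n * c)) at_top sequentially" by real_asymp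
    then have "filterlim (\<lambda>n. count_sd n (t j)) at_top sequentially"
      by (simp only: c_def count_sd_def)
    then show "eventually (\<lambda>n. \<theta> \<le> count_sd n (t j)) sequentially"
      by (simp add: filterlim_at_top)
  qed simp
  then show "eventually (\<lambda>n. \<P>(x in H0 n. mHC_stat n x \<le> K) < e) sequentially"
    using eventually_ge_at_top[of 2]
  proof eventually_elim
    case (elim n)
    have geo: "t k \<le> \<rho>\<^sup>2 * t j" if "j < k" for j k
    proof -
      have "(\<rho>\<^sup>2) ^ k \<le> (\<rho>\<^sup>2) ^ Suc j" using that \<rho>2 by (intro power_decreasing) auto
      then show ?thesis by (simp add: t_def)
    qed
    have "\<P>(x in H0 n. mHC_stat n x \<le> K)
      \<le> 4 / (\<theta> - K)\<^sup>2 + sqrt (exp (\<theta>\<^sup>2) / real J + (exp (\<theta>\<^sup>2 * \<rho>) - 1))"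
      using elim J \<theta> t \<rho> geo by (intro mHC_stat_null_small[where t=t]) auto
    also have "\<dots> < e" using \<theta>(1) J(1) by (simp add: \<rho>_def)
    finally show ?case .
  qed
qed

section \<open>Null and alternative rejection probabilities of modified higher criticism\<close>

lemma many_small_null:
  assumes a: "0 < a" "a \<le> 1" and q: "16 \<le> q" and le: "real n * a \<le> sqrt q"
  shows "measure (H0 n) (many_small n a (q / 2)) \<le> 16 / q"
proof -
  interpret P0: prob_space "H0 n" by (rule prob_space_H0)
  \<comment> \<open>From \<open>q \<ge> 16\<close> the mean count is at most
    \<open>sqrt q \<le> q / 4\<close>, so a count above \<open>q / 2\<close> deviates from it by at
    least \<open>q / 4\<close>.\<close>
  have "sqrt q * 4 \<le> sqrt q * sqrt q"
    using q real_sqrt_le_mono[of "4\<^sup>2" q] by (intro mult_left_mono) auto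
  then have sq: "sqrt q \<le> q / 4" using q by simp
  have d0: "0 < q / 4" using q by simp
  let ?E = "{x \<in> space (H0 n). q / 4 \<le> \<bar>real n * p_value_ecdf n x a - real n * a\<bar>}"
  have [measurable]: "(\<lambda>x. p_value_ecdf n x a) \<in> borel_measurable (H0 n)"
    using p_value_ecdf_measurable[of n a] by (simp add: sets_H0 cong: measurable_cong_sets)
  have "measure (H0 n) (many_small n a (q / 2)) \<le> measure (H0 n) ?E"
  proof (rule P0.finite_measure_mono)
    show "many_small n a (q / 2) \<subseteq> ?E"
    proof
      fix x assume "x \<in> many_small n a (q / 2)"
      then have x: "x \<in> space (H0 n)" "q / 2 < real n * p_value_ecdf n x a"
        by (simp_all only: many_small_def space_H0 mem_Collect_eq)
      then have "q / 4 \<le> \<bar>real n * p_value_ecdf n x a - real n * a\<bar>" using sq le by linarith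
      then show "x \<in> ?E" using x by simp
    qed
  qed measurable
  also have "\<dots> \<le> real n * a / (q / 4)\<^sup>2"
    using count_Chebyshev[OF prob_space_normal_law[of 0] _ d0, where t = a and n = n] measure_p_value_le[OF a]
    by (simp add: H0_eq_PiM)
  also have "\<dots> \<le> q / (q / 4)\<^sup>2" using le sq q by (intro divide_right_mono) auto
  also have "\<dots> = 16 / q" using q by (simp add: power2_eq_square)
  finally show ?thesis .
qed

context heavy_tailed_effects
begin

lemma mHC_test_powerless:
  assumes \<alpha>: "0 < \<alpha>" "\<alpha> < 1"
  shows "mHC_test_power Gs \<beta> \<alpha> \<longlonglongrightarrow> \<alpha>"
proof -
  define q where "q n = quantile (H0 n) (mHC_stat n) (1 - \<alpha>)" for n
  have mH: "mHC_stat n \<in> borel_measurable (H0 n)" if "2 \<le> n" for n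
    using mHC_stat_measurable[OF that] by (simp add: sets_H0 cong: measurable_cong_sets)
  have q_top: "filterlim q at_top sequentially"
    unfolding filterlim_at_top
  proof
    fix K :: real
    have "eventually (\<lambda>n. \<P>(x in H0 n. mHC_stat n x \<le> K) < 1 - \<alpha>) sequentially"
      using \<alpha> by (intro order_tendstoD[OF mHC_stat_null_diverges]) auto
    then show "eventually (\<lambda>n. K \<le> q n) sequentially"
      using eventually_ge_at_top[of 2]
    proof eventually_elim
      case (elim n)
      then show ?case
        unfolding q_def using \<alpha> by (intro quantile_properties(3)[OF prob_space_H0 mH]) auto
    qed
  qed
  \<comment> \<open>The expected number of trimmed null observations. It must diverge for the
    chi-square bound to vanish, and stay below \<open>sqrt (q n)\<close> so that counts of order
    \<open>q n\<close> remain exceptional. The bounds 1 and \<open>n / 2\<close> place the level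
    \<open>a n\<close> between \<open>1 / n\<close> and 1/2.\<close>
  define A where "A n = max 1 (min (sqrt (q n)) (real n / 2))" for n
  have A_top: "filterlim A at_top sequentially"
  proof -
    have "filterlim (\<lambda>n. sqrt (q n)) at_top sequentially" by (rule filterlim_compose[OF sqrt_at_top q_top])
    moreover have "filterlim (\<lambda>n. real n / 2) at_top sequentially" by real_asymp
    ultimately have "filterlim (\<lambda>n. min (sqrt (q n)) (real n / 2)) at_top sequentially"
      unfolding filterlim_at_top by (auto intro: eventually_elim2)
    then show ?thesis
      by (rule filterlim_at_top_mono) (simp add: A_def)
  qed
  \<comment> \<open>Thresholds are requested for every index, so the first two values are
    patched.\<close>
  define a where "a n = A (max 2 n) / real (max 2 n)" for n
  have a: "0 < a n" "a n \<le> 1 / 2" for n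
    by (auto simp: a_def A_def field_simps less_max_iff_disj)
  have "a n \<le> 1" for n using a(2)[of n] by simp
  then obtain \<tau> where \<tau>: "\<And>n. 0 \<le> \<tau> n" and p\<tau>: "\<And>n. p_value (\<tau> n) = a n"
    using p_value_threshold[of a] a(1) by metis
  have nA: "real n * a n = A n" if "2 \<le> n" for n using that by (simp add: a_def max_def)
  have "(\<lambda>n. inverse (A n)) \<longlonglongrightarrow> 0"
    by (rule filterlim_compose[OF tendsto_inverse_0_at_top[OF filterlim_ident] A_top])
  then have "(\<lambda>n. real n powr (2 * (\<beta> - \<beta>)) / (real n * p_value (\<tau> n))) \<longlonglongrightarrow> 0"
    by (rule Lim_transform_eventually)
       (auto intro!: eventually_mono[OF eventually_ge_at_top[of 2]] simp: p\<tau> nA inverse_eq_divide)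
  then obtain e where e: "e \<longlonglongrightarrow> 0"
    and inv: "\<And>n E. 2 \<le> n \<Longrightarrow> trim_invariant n (\<tau> n) E \<Longrightarrow>
      \<bar>measure (H1 Gs \<beta> n) E - measure (H0 n) E\<bar> \<le> e n"
    using trimmed_tv_tendsto_0[of \<beta> \<tau>, OF order_refl less_imp_le[OF \<beta>(2)] \<tau>] by blast
  have "(\<lambda>n. mHC_test_power Gs \<beta> \<alpha> n - \<alpha>) \<longlonglongrightarrow> 0"
  proof (rule Lim_null_comparison)
    have "(\<lambda>n. inverse (q n)) \<longlonglongrightarrow> 0"
      by (rule filterlim_compose[OF tendsto_inverse_0_at_top[OF filterlim_ident] q_top])
    then have "(\<lambda>n. 2 * e n + 48 * inverse (q n)) \<longlonglongrightarrow> 2 * 0 + 48 * 0"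
      by (intro tendsto_intros e)
    then show "(\<lambda>n. 2 * e n + 48 / q n) \<longlonglongrightarrow> 0" by (simp add: divide_inverse)
    have "eventually (\<lambda>n. 16 \<le> q n) sequentially" using q_top by (simp add: filterlim_at_top)
    then show "eventually (\<lambda>n. norm (mHC_test_power Gs \<beta> \<alpha> n - \<alpha>) \<le> 2 * e n + 48 / q n) sequentially"
      using eventually_ge_at_top[of 2]
    proof eventually_elim
      case (elim n)
      have \<beta>0: "0 \<le> \<beta>" using \<beta> by simp
      interpret P0: prob_space "H0 n" by (rule prob_space_H0)
      interpret P1: prob_space "H1 Gs \<beta> n" using elim(2) \<beta>0 by (rule prob_space_H1)
      have s1: "sets (H1 Gs \<beta> n) = sets (samples n)" using elim(2) \<beta>0 by (rule sets_H1)
      have sp1: "space (H1 Gs \<beta> n) = space (samples n)" by (rule sets_eq_imp_space_eq[OF s1])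
      have q: "16 \<le> q n" "0 < q n" using elim by auto
      \<comment> \<open>The rejection event \<open>E\<close> is not invariant under trimming, but
        lies between \<open>Eh\<close> and \<open>Eh \<union> F\<close>, and both \<open>Eh\<close>
        and \<open>F\<close> are.\<close>
      define E where "E = exceed_event n (1 / real n) (q n)"
      define Eh where "Eh = exceed_event n (a n) (q n)"
      define F where "F = many_small n (a n) (q n / 2)"
      have na: "1 / real n \<le> a n" using elim(2) by (simp add: a_def A_def max_def divide_right_mono)
      have E_eq: "E = {x \<in> space (samples n). q n < mHC_stat n x}"
        unfolding E_def exceed_event_def using less_mHC_stat_iff[OF elim(2)] by auto
      have power: "mHC_test_power Gs \<beta> \<alpha> n = measure (H1 Gs \<beta> n) E"
        by (simp only: mHC_test_power_def rejection_prob_def E_eq sp1 flip: q_def)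
      have sE: "E \<in> sets (samples n)" "Eh \<in> sets (samples n)" "F \<in> sets (samples n)"
        using elim(2) a[of n] unfolding E_def Eh_def F_def
        by (auto intro!: exceed_event_sets many_small_sets simp: field_simps simp del: One_nat_def)
      have sub: "Eh \<subseteq> E" "E \<subseteq> Eh \<union> F"
        unfolding E_def Eh_def F_def using exceed_event_split[OF elim(2) na q(2)] by auto
      have dEh: "\<bar>measure (H1 Gs \<beta> n) Eh - measure (H0 n) Eh\<bar> \<le> e n"
        unfolding Eh_def by (intro inv elim trim_invariant_events \<tau> p\<tau> a)
      have dF: "\<bar>measure (H1 Gs \<beta> n) F - measure (H0 n) F\<bar> \<le> e n"
        unfolding F_def by (intro inv elim trim_invariant_events[OF \<tau> p\<tau> a(2)])
      have F0: "measure (H0 n) F \<le> 16 / q n"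
      proof -
        have "4 \<le> sqrt (q n)" using q real_sqrt_le_mono[of "4\<^sup>2" "q n"] by simp
        then have "A n \<le> sqrt (q n)" unfolding A_def by linarith
        then show ?thesis
          unfolding F_def using a[of n] q nA[OF elim(2)] by (intro many_small_null) auto
      qed
      have up0: "measure (H0 n) E \<le> measure (H0 n) Eh + measure (H0 n) F"
        using P0.finite_measure_mono[OF sub(2)] measure_Un_le[of Eh "H0 n" F] sE by (auto simp: sets_H0)
      have up1: "measure (H1 Gs \<beta> n) E \<le> measure (H1 Gs \<beta> n) Eh + measure (H1 Gs \<beta> n) F"
        using P1.finite_measure_mono[OF sub(2)] measure_Un_le[of Eh "H1 Gs \<beta> n" F] sE by (auto simp: s1)
      have lo0: "measure (H0 n) Eh \<le> measure (H0 n) E"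
        using sE by (intro P0.finite_measure_mono sub) (simp only: sets_H0)
      have lo1: "measure (H1 Gs \<beta> n) Eh \<le> measure (H1 Gs \<beta> n) E"
        using sE by (intro P1.finite_measure_mono sub) (simp only: s1)
      note qp = quantile_properties[OF prob_space_H0 mH[OF elim(2)], of "1 - \<alpha>", folded q_def]
      have m[measurable]: "mHC_stat n \<in> borel_measurable (H0 n)" by (rule mH[OF elim(2)])
      have "measure (H0 n) E = 1 - \<P>(x in H0 n. mHC_stat n x \<le> q n)"
      proof -
        have "E = space (H0 n) - {x \<in> space (H0 n). mHC_stat n x \<le> q n}"
          unfolding E_eq space_H0 by auto
        then show ?thesis by (simp only:) (rule P0.prob_compl, measurable)
      qed
      moreover have "\<P>(x in H0 n. mHC_stat n x \<le> q n) =
         \<P>(x in H0 n. mHC_stat n x < q n) + \<P>(x in H0 n. mHC_stat n x = q n)"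
        by (subst P0.finite_measure_Union[symmetric]) (auto intro!: arg_cong[where f="measure _"])
      moreover have "\<P>(x in H0 n. mHC_stat n x = q n) \<le> measure (H0 n) F"
        unfolding F_def by (rule mHC_stat_atom[OF elim(2) na q(2)])
      moreover have "1 - \<alpha> \<le> \<P>(x in H0 n. mHC_stat n x \<le> q n)"
        "\<P>(x in H0 n. mHC_stat n x < q n) \<le> 1 - \<alpha>"
        using qp(1,2) \<alpha> by auto
      \<comment> \<open>The null rejection probability is at most \<alpha> and falls short of it by
        at most the atom at \<open>q n\<close>.\<close>
      ultimately have "\<bar>measure (H0 n) E - \<alpha>\<bar> \<le> measure (H0 n) F" by linarith
      then have "\<bar>measure (H1 Gs \<beta> n) E - \<alpha>\<bar> \<le> 2 * e n + 3 * measure (H0 n) F"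
        using up0 up1 lo0 lo1 dEh dF measure_nonneg[of "H0 n" F] by linarith
      then show ?case using F0 by (simp add: power)
    qed
  qed
  from tendsto_add[OF this tendsto_const[of \<alpha>]] show ?thesis by simp
qed

end

theorem theorem2:
  fixes G :: "real \<Rightarrow> real" and \<nu> C r \<beta> :: real
  assumes "\<nu> > 0" and "C > 0" and "r > 0" and "1 / 2 < \<beta>" and "\<beta> < 1"
    and "distribution_function G"
    and "((\<lambda>\<mu>. (1 - G \<mu>) * \<mu> powr \<nu>) \<longlongrightarrow> C) at_top"
    and "((\<lambda>\<mu>. G (- \<mu>) * \<mu> powr \<nu>) \<longlongrightarrow> C) at_top"
  shows "is_critical_sparsity_level (scaled_seq G \<nu> \<beta> r) \<beta>
    \<and> (\<forall>\<alpha>\<in>{0<..<1}.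
         max_test_power (scaled_seq G \<nu> \<beta> r) \<beta> \<alpha>
           \<longlonglongrightarrow> 1 - exp (- 2 * C * r powr \<nu> + ln (1 - \<alpha>))
         \<and> ((\<lambda>s. lim (max_test_power (scaled_seq G \<nu> \<beta> s) \<beta> \<alpha>)) \<longlongrightarrow> 1) at_top)
    \<and> (\<forall>\<alpha>\<in>{0<..<1}. mHC_test_power (scaled_seq G \<nu> \<beta> r) \<beta> \<alpha> \<longlonglongrightarrow> \<alpha>)"
proof -
  \<comment> \<open>The limit in the scale parameter uses the power limit for all positive
    \<open>s\<close>, not just for \<open>r\<close>.\<close>
  have model: "heavy_tailed_effects G \<nu> C s \<beta>" if "s > 0" for s
    using assms that by unfold_locales
  interpret heavy_tailed_effects G \<nu> C r \<beta> using assms(3) by (rule model)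
  have "((\<lambda>s. lim (max_test_power (scaled_seq G \<nu> \<beta> s) \<beta> \<alpha>)) \<longlongrightarrow> 1) at_top" if \<alpha>: "0 < \<alpha>" "\<alpha> < 1" for \<alpha>
  proof (rule Lim_transform_eventually)
    have "((\<lambda>s. 1 - exp (- 2 * C * s powr \<nu> + ln (1 - \<alpha>))) \<longlongrightarrow> 1 - 0) at_top"
      using \<open>C > 0\<close> \<open>\<nu> > 0\<close> by real_asymp
    then show "((\<lambda>s. 1 - exp (- 2 * C * s powr \<nu> + ln (1 - \<alpha>))) \<longlongrightarrow> 1) at_top" by simp
    show "eventually (\<lambda>s. 1 - exp (- 2 * C * s powr \<nu> + ln (1 - \<alpha>)) =
        lim (max_test_power (scaled_seq G \<nu> \<beta> s) \<beta> \<alpha>)) at_top"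
      using eventually_gt_at_top[of 0]
      by eventually_elim (rule limI[symmetric], rule heavy_tailed_effects.max_test_power_limit[OF model \<alpha>])
  qed
  then show ?thesis
    using critical_sparsity_level max_test_power_limit mHC_test_powerless by auto
qed

end
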